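(* Let $q\in(-1,1)$ and let $\mathcal{H}$ be a real separable Hilbert space. Let $\Phi=\operatorname{proj\,lim}_{\tau\in T}\mathcal{H}_\tau$ be a real nuclear space, and assume that $\Phi$ is densely and continuously embedded into $\mathcal{H}$. Then, for each $\alpha\ge1$, the space $$\mathcal{G}_q(\Phi,\alpha):=\operatorname{proj\,lim}_{(\tau,r)\in T\times[1,\infty)}\mathcal{G}_q(\mathcal{H}_\tau,r,\alpha)$$ is densely and continuously embedded into the $q$-Fock space $\mathcal{F}_q(\mathcal{H})$. Furthermore, $\mathcal{G}_q(\Phi,\alpha)$ is an algebra with respect to the addition and the tensor multiplication $\otimes$, with tensor multiplication being a continuous mapping from $\mathcal{G}_q(\Phi,\alpha)^2$ into $\mathcal{G}_q(\Phi,\alpha)$.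
   Context: Nuclear space. $\Phi=\operatorname{proj\,lim}_{\tau\in T}\mathcal{H}_\tau$, where $(\mathcal{H}_\tau)_{\tau\in T}$ is a family of real separable Hilbert spaces directed by embedding: for any $\tau_1,\tau_2\in T$ there is $\tau_3\in T$ such that $\mathcal{H}_{\tau_3}$ is densely and continuously embedded into both $\mathcal{H}_{\tau_1}$ and $\mathcal{H}_{\tau_2}$; and for each $\tau_1\in T$ there is $\tau_2\in T$ such that the embedding operator of $\mathcal{H}_{\tau_2}$ into $\mathcal{H}_{\tau_1}$ is of Hilbert--Schmidt class. The projective limit is the intersection of the Hilbert spaces with the projective limit topology. Notation. $[n]_q:=1+q+\dots+q^{n-1}$, $[n]_q!:=[1]_q[2]_q\cdots[n]_q$, $[0]_q!:=1$; convention $0^0:=1$. For a real Hilbert space $\mathcal{K}$ and $c>0$, $\mathcal{K}c$ denotes the Hilbert space equal to $\mathcal{K}$ as a set with scalar product $c(\cdot,\cdot)_{\mathcal{K}}$. $\mathcal{K}^{\otimes n}$ is the Hilbert space tensor power, $\mathcal{K}^{\otimes 0}:=\mathbb{R}$. $q$-Fock space. For $n\in\mathbb{N}$ let $P_q^{(n)}$ be the bounded linear operator on $\mathcal{H}^{\otimes n}$ given by $P_q^{(n)}f_1\otimes\dots\otimes f_n:=\sum_{\pi\in S_n}q^{\operatorname{inv}(\pi)}f_{\pi(1)}\otimes\dots\otimes f_{\pi(n)}$, where $\operatorname{inv}(\pi)$ is the number of pairs $i<j$ with $\pi(i)>\pi(j)$; this operator is strictly positive. $\mathcal{F}_q^{(n)}(\mathcal{H})$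 is $\mathcal{H}^{\otimes n}$ as a set, with scalar product $(f,g)_{\mathcal{F}_q^{(n)}(\mathcal{H})}:=(P_q^{(n)}f,g)_{\mathcal{H}^{\otimes n}}$; $\mathcal{F}_q^{(0)}(\mathcal{H}):=\mathbb{R}$; and $\mathcal{F}_q(\mathcal{H}):=\bigoplus_{n=0}^\infty\mathcal{F}_q^{(n)}(\mathcal{H})$ (Hilbert space direct sum). Spaces $\mathcal{G}_q$. For a real separable Hilbert space $\mathcal{K}$, $r>0$, $\alpha\ge1$: $\mathcal{G}_q(\mathcal{K},r,\alpha):=\bigoplus_{n=0}^\infty\mathcal{K}^{\otimes n}\,r^n([n]_q!)^\alpha$ (Hilbert space direct sum). Tensor multiplication: for $F=(f^{(n)})_{n\ge0}$ and $G=(g^{(n)})_{n\ge0}$, $F\otimes G:=\big(\sum_{i=0}^nf^{(i)}\otimes g^{(n-i)}\big)_{n\ge0}$. *)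

theory Defs
  imports "HOL-Analysis.Analysis" "HOL-Combinatorics.Permutations" "HOL-Library.Function_Algebras"
begin

text \<open>Pointwise scalar multiplication: tensors, sequences of tensors and compatible families of
  such sequences are functions, and their linear structure is the pointwise one.\<close>

instantiation "fun" :: (type, real_vector) real_vector
begin

definition scaleR_fun :: "real \<Rightarrow> ('a \<Rightarrow> 'b) \<Rightarrow> 'a \<Rightarrow> 'b"
  where "scaleR_fun c f = (\<lambda>x. c *\<^sub>R f x)"

instance
  by standard (simp_all add: scaleR_fun_def fun_eq_iff scaleR_add_right scaleR_add_left)

end

lemma scaleR_fun_apply [simp]: "(c *\<^sub>R f) x = c *\<^sub>R f x"
  by (simp add: scaleR_fun_def)


section \<open>Hilbert spaces as subspaces of an ambient real vector space\<close>

text \<open>Only the values of \<open>hip K\<close> on \<open>hset K\<close> matter.\<close>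

record 'a hspace =
  hset :: "'a set"
  hip :: "'a \<Rightarrow> 'a \<Rightarrow> real"

definition hnorm :: "'a hspace \<Rightarrow> 'a \<Rightarrow> real"
  where "hnorm K x = sqrt (hip K x x)"

text \<open>The value off \<open>hset K\<close> is \<open>0\<close> because \<open>Metric_space\<close> demands a symmetric
  nonnegative function on the whole type.\<close>

definition hdist :: "'a::real_vector hspace \<Rightarrow> 'a \<Rightarrow> 'a \<Rightarrow> real"
  where "hdist K x y = (if x \<in> hset K \<and> y \<in> hset K then hnorm K (x - y) else 0)"

definition htop :: "'a::real_vector hspace \<Rightarrow> 'a topology"
  where "htop K = Metric_space.mtopology (hset K) (hdist K)"

definition inner_product_space :: "'a::real_vector hspace \<Rightarrow> bool"
  where "inner_product_space K \<longleftrightarrow>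
    subspace (hset K) \<and>
    (\<forall>x\<in>hset K. \<forall>y\<in>hset K. hip K x y = hip K y x) \<and>
    (\<forall>x\<in>hset K. \<forall>y\<in>hset K. \<forall>z\<in>hset K. hip K (x + y) z = hip K x z + hip K y z) \<and>
    (\<forall>c. \<forall>x\<in>hset K. \<forall>y\<in>hset K. hip K (c *\<^sub>R x) y = c * hip K x y) \<and>
    (\<forall>x\<in>hset K. x \<noteq> 0 \<longrightarrow> hip K x x > 0)"

definition separable_hilbert_space :: "'a::real_vector hspace \<Rightarrow> bool"
  where "separable_hilbert_space K \<longleftrightarrow>
    inner_product_space K \<and>
    Metric_space.mcomplete (hset K) (hdist K) \<and>
    separable_space (htop K)"

definition orthonormal_basis :: "'a::real_vector hspace \<Rightarrow> 'a set \<Rightarrow> bool"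
  where "orthonormal_basis K B \<longleftrightarrow>
    B \<subseteq> hset K \<and>
    (\<forall>e\<in>B. \<forall>f\<in>B. hip K e f = (if e = f then 1 else 0)) \<and>
    htop K closure_of (span B) = hset K"

definition some_basis :: "'a::real_vector hspace \<Rightarrow> 'a set"
  where "some_basis K = (SOME B. orthonormal_basis K B)"

definition scaled_hspace :: "'a hspace \<Rightarrow> real \<Rightarrow> 'a hspace"
  where "scaled_hspace K c = \<lparr>hset = hset K, hip = (\<lambda>x y. c * hip K x y)\<rparr>"

definition hilbert_sum :: "(nat \<Rightarrow> 'a hspace) \<Rightarrow> (nat \<Rightarrow> 'a) hspace"
  where "hilbert_sum X =
    \<lparr>hset = {F. (\<forall>n. F n \<in> hset (X n)) \<and> summable (\<lambda>n. hip (X n) (F n) (F n))},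
     hip = (\<lambda>F G. \<Sum>n. hip (X n) (F n) (G n))\<rparr>"


section \<open>Dense continuous embeddings, projective limits and nuclear spaces\<close>

definition dense_continuous_embedding ::
    "'a::real_vector topology \<Rightarrow> 'b::real_vector topology \<Rightarrow> ('a \<Rightarrow> 'b) \<Rightarrow> bool"
  where "dense_continuous_embedding X Y f \<longleftrightarrow>
    (\<forall>x\<in>topspace X. \<forall>y\<in>topspace X. f (x + y) = f x + f y) \<and>
    (\<forall>c. \<forall>x\<in>topspace X. f (c *\<^sub>R x) = c *\<^sub>R f x) \<and>
    inj_on f (topspace X) \<and>
    continuous_map X Y f \<and>
    Y closure_of (f ` topspace X) = topspace Y"

definition hspace_embedded :: "'a::real_vector hspace \<Rightarrow> 'a hspace \<Rightarrow> bool"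
  where "hspace_embedded K' K \<longleftrightarrow> dense_continuous_embedding (htop K') (htop K) (\<lambda>x. x)"

definition hilbert_schmidt :: "'a::real_vector hspace \<Rightarrow> 'b::real_vector hspace \<Rightarrow> ('a \<Rightarrow> 'b) \<Rightarrow> bool"
  where "hilbert_schmidt K L A \<longleftrightarrow>
    (\<exists>B. orthonormal_basis K B \<and> (\<lambda>e. (hnorm L (A e))\<^sup>2) summable_on B)"

text \<open>The coarsest topology on \<open>X\<close> for which all \<open>f i\<close> with \<open>i \<in> I\<close> are continuous.\<close>

definition initial_topology ::
    "'a set \<Rightarrow> 'j set \<Rightarrow> ('j \<Rightarrow> 'a \<Rightarrow> 'b) \<Rightarrow> ('j \<Rightarrow> 'b topology) \<Rightarrow> 'a topology"
  where "initial_topology X I f Y =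
    topology_generated_by (insert X {X \<inter> f i -` U | i U. i \<in> I \<and> openin (Y i) U})"

text \<open>The spaces \<open>H \<tau>\<close> are subspaces of one vector space and the embeddings between them are
  inclusions, so that the projective limit is their intersection.\<close>

definition nuclear_family :: "'i set \<Rightarrow> ('i \<Rightarrow> 'v::real_vector hspace) \<Rightarrow> bool"
  where "nuclear_family T H \<longleftrightarrow>
    T \<noteq> {} \<and>
    (\<forall>\<tau>\<in>T. separable_hilbert_space (H \<tau>)) \<and>
    (\<forall>\<tau>1\<in>T. \<forall>\<tau>2\<in>T. \<exists>\<tau>3\<in>T. hspace_embedded (H \<tau>3) (H \<tau>1) \<and> hspace_embedded (H \<tau>3) (H \<tau>2)) \<and>
    (\<forall>\<tau>1\<in>T. \<exists>\<tau>2\<in>T. hspace_embedded (H \<tau>2) (H \<tau>1) \<and> hilbert_schmidt (H \<tau>2) (H \<tau>1) (\<lambda>x. x))"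

definition nuclear_set :: "'i set \<Rightarrow> ('i \<Rightarrow> 'v::real_vector hspace) \<Rightarrow> 'v set"
  where "nuclear_set T H = (\<Inter>\<tau>\<in>T. hset (H \<tau>))"

definition nuclear_topology :: "'i set \<Rightarrow> ('i \<Rightarrow> 'v::real_vector hspace) \<Rightarrow> 'v topology"
  where "nuclear_topology T H = initial_topology (nuclear_set T H) T (\<lambda>\<tau> x. x) (\<lambda>\<tau>. htop (H \<tau>))"

text \<open>General projective limit, with linking maps \<open>link i j\<close> from \<open>X j\<close> to \<open>X i\<close> whenever
  \<open>le i j\<close>: the families compatible with the linking maps. For linking maps that are inclusions
  these are the constant families with value in the intersection of all \<open>X i\<close>.\<close>

definition proj_lim_set ::
    "'j set \<Rightarrow> ('j \<Rightarrow> 'j \<Rightarrow> bool) \<Rightarrow> ('j \<Rightarrow> 'a::real_vector hspace) \<Rightarrow> ('j \<Rightarrow> 'j \<Rightarrow> 'a \<Rightarrow> 'a) \<Rightarrow> ('j \<Rightarrow> 'a) set"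
  where "proj_lim_set I le X link =
    {F. (\<forall>i. i \<notin> I \<longrightarrow> F i = 0) \<and> (\<forall>i\<in>I. F i \<in> hset (X i)) \<and>
        (\<forall>i\<in>I. \<forall>j\<in>I. le i j \<longrightarrow> F i = link i j (F j))}"

definition proj_lim ::
    "'j set \<Rightarrow> ('j \<Rightarrow> 'j \<Rightarrow> bool) \<Rightarrow> ('j \<Rightarrow> 'a::real_vector hspace) \<Rightarrow> ('j \<Rightarrow> 'j \<Rightarrow> 'a \<Rightarrow> 'a) \<Rightarrow> ('j \<Rightarrow> 'a) topology"
  where "proj_lim I le X link =
    initial_topology (proj_lim_set I le X link) I (\<lambda>i F. F i) (\<lambda>i. htop (X i))"


section \<open>Hilbert tensor powers\<close>

text \<open>The Hilbert space tensor power of \<open>K\<close> is realised, following Kadison and Ringrose, as the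
  space of bounded \<open>n\<close>-linear forms on \<open>K\<close> of Hilbert--Schmidt class; \<open>f\<^sub>1 \<otimes> \<dots> \<otimes> f\<^sub>n\<close> is the form
  sending \<open>(y\<^sub>1, \<dots>, y\<^sub>n)\<close> to the product of the \<open>(f\<^sub>i, y\<^sub>i)\<close>. Forms take lists as arguments and
  vanish on lists that are not in the domain. For \<open>n = 0\<close> the form is determined by its value at
  the empty list, so that the zeroth power is \<open>\<real>\<close>. Neither the space nor the scalar product
  depends on the choice of the basis.\<close>

definition tuples :: "'a set \<Rightarrow> nat \<Rightarrow> 'a list set"
  where "tuples A n = {xs. length xs = n \<and> set xs \<subseteq> A}"

definition multilinear_form :: "'a::real_vector hspace \<Rightarrow> nat \<Rightarrow> ('a list \<Rightarrow> real) \<Rightarrow> bool"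
  where "multilinear_form K n S \<longleftrightarrow>
    (\<forall>xs. xs \<notin> tuples (hset K) n \<longrightarrow> S xs = 0) \<and>
    (\<forall>xs\<in>tuples (hset K) n. \<forall>i<n. \<forall>x\<in>hset K. \<forall>y\<in>hset K. \<forall>a b.
       S (xs[i := a *\<^sub>R x + b *\<^sub>R y]) = a * S (xs[i := x]) + b * S (xs[i := y]))"

definition bounded_form :: "'a::real_vector hspace \<Rightarrow> nat \<Rightarrow> ('a list \<Rightarrow> real) \<Rightarrow> bool"
  where "bounded_form K n S \<longleftrightarrow>
    (\<exists>C. \<forall>xs\<in>tuples (hset K) n. \<bar>S xs\<bar> \<le> C * prod_list (map (hnorm K) xs))"

definition tensor_power :: "'a::real_vector hspace \<Rightarrow> nat \<Rightarrow> ('a list \<Rightarrow> real) hspace"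
  where "tensor_power K n =
    \<lparr>hset = {S. multilinear_form K n S \<and> bounded_form K n S \<and>
               (\<lambda>es. (S es)\<^sup>2) summable_on tuples (some_basis K) n},
     hip = (\<lambda>S R. \<Sum>\<^sub>\<infinity>es\<in>tuples (some_basis K) n. S es * R es)\<rparr>"

definition pure_tensor :: "'a hspace \<Rightarrow> 'a list \<Rightarrow> 'a list \<Rightarrow> real"
  where "pure_tensor K fs =
    (\<lambda>ys. if ys \<in> tuples (hset K) (length fs)
          then (\<Prod>i<length fs. hip K (fs ! i) (ys ! i)) else 0)"

text \<open>\<open>tensor i S R\<close> is \<open>S \<otimes> R\<close> for \<open>S\<close> in the \<open>i\<close>-th tensor power.\<close>

definition tensor :: "nat \<Rightarrow> ('a list \<Rightarrow> real) \<Rightarrow> ('a list \<Rightarrow> real) \<Rightarrow> 'a list \<Rightarrow> real"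
  where "tensor i S R = (\<lambda>ys. S (take i ys) * R (drop i ys))"

lemma tensor_pure_tensor:
  "tensor (length fs) (pure_tensor K fs) (pure_tensor K gs) = pure_tensor K (fs @ gs)"
proof
  fix ys :: "'a list"
  let ?m = "length fs" and ?n = "length gs"
  have dom: "take ?m ys \<in> tuples (hset K) ?m \<and> drop ?m ys \<in> tuples (hset K) ?n
      \<longleftrightarrow> ys \<in> tuples (hset K) (?m + ?n)"
  proof -
    have "set (take ?m ys) \<union> set (drop ?m ys) = set ys"
      by (metis append_take_drop_id set_append)
    then have "set ys \<subseteq> hset K \<longleftrightarrow> set (take ?m ys) \<subseteq> hset K \<and> set (drop ?m ys) \<subseteq> hset K"
      by blast
    then show ?thesis by (simp only: tuples_def mem_Collect_eq length_take length_drop) linarith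
  qed
  show "tensor ?m (pure_tensor K fs) (pure_tensor K gs) ys = pure_tensor K (fs @ gs) ys"
  proof (cases "ys \<in> tuples (hset K) (?m + ?n)")
    case True
    let ?h = "\<lambda>i. hip K ((fs @ gs) ! i) (ys ! i)"
    have len: "length ys = ?m + ?n" using True by (simp add: tuples_def)
    have "prod ?h {..<?m + ?n} = prod ?h {..<?m} * prod ?h {?m..<?m + ?n}"
      using prod.atLeastLessThan_concat[of 0 ?m "?m + ?n" ?h] by (simp add: atLeast0LessThan)
    also have "prod ?h {?m..<?m + ?n} = (\<Prod>i<?n. ?h (i + ?m))"
      using prod.shift_bounds_nat_ivl[of ?h 0 ?m ?n] by (simp add: atLeast0LessThan add.commute[of ?n])
    finally show ?thesis
      using True dom len by (simp add: tensor_def pure_tensor_def nth_append add.commute)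
  next
    case False
    then show ?thesis using dom by (auto simp: tensor_def pure_tensor_def)
  qed
qed

text \<open>The adjoint of a bounded operator \<open>A\<close> from \<open>K\<close> to \<open>L\<close>, and \<open>A\<^sup>\<otimes>\<^sup>n\<close>, which on forms is
  composition with the adjoint in each argument.\<close>

definition hadjoint :: "'a hspace \<Rightarrow> 'b hspace \<Rightarrow> ('a \<Rightarrow> 'b) \<Rightarrow> 'b \<Rightarrow> 'a"
  where "hadjoint K L A y = (THE z. z \<in> hset K \<and> (\<forall>x\<in>hset K. hip K x z = hip L (A x) y))"

definition tensor_map :: "'a hspace \<Rightarrow> 'b hspace \<Rightarrow> ('a \<Rightarrow> 'b) \<Rightarrow> nat \<Rightarrow> ('a list \<Rightarrow> real) \<Rightarrow> 'b list \<Rightarrow> real"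
  where "tensor_map K L A n S =
    (\<lambda>ys. if ys \<in> tuples (hset L) n then S (map (hadjoint K L A) ys) else 0)"

text \<open>In the next lemma the second assumption is the existence of the adjoint (Riesz).\<close>

lemma tensor_map_pure_tensor:
  assumes K: "inner_product_space K"
    and adj: "\<And>y. y \<in> hset L \<Longrightarrow> \<exists>z\<in>hset K. \<forall>x\<in>hset K. hip K x z = hip L (A x) y"
    and fs: "set fs \<subseteq> hset K"
  shows "tensor_map K L A (length fs) (pure_tensor K fs) = pure_tensor L (map A fs)"
proof
  have sub: "subspace (hset K)"
    and commute: "\<And>x y. x \<in> hset K \<Longrightarrow> y \<in> hset K \<Longrightarrow> hip K x y = hip K y x"
    and add: "\<And>x y z. x \<in> hset K \<Longrightarrow> y \<in> hset K \<Longrightarrow> z \<in> hset K \<Longrightarrow>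
      hip K (x + y) z = hip K x z + hip K y z"
    and scale: "\<And>c x y. x \<in> hset K \<Longrightarrow> y \<in> hset K \<Longrightarrow> hip K (c *\<^sub>R x) y = c * hip K x y"
    and pos: "\<And>x. x \<in> hset K \<Longrightarrow> x \<noteq> 0 \<Longrightarrow> hip K x x > 0"
    using K unfolding inner_product_space_def by simp_all
  have adjoint: "hadjoint K L A y \<in> hset K \<and> (\<forall>x\<in>hset K. hip K x (hadjoint K L A y) = hip L (A x) y)"
    if "y \<in> hset L" for y
    unfolding hadjoint_def
  proof (rule theI')
    obtain z where z: "z \<in> hset K" "\<forall>x\<in>hset K. hip K x z = hip L (A x) y"
      using adj[OF \<open>y \<in> hset L\<close>] by blast
    have "w = z" if w: "w \<in> hset K" "\<forall>x\<in>hset K. hip K x w = hip L (A x) y" for w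
    proof (rule ccontr)
      let ?d = "w + (- 1) *\<^sub>R z"
      assume "w \<noteq> z"
      then have "?d \<noteq> 0" by simp
      have mz: "(- 1) *\<^sub>R z \<in> hset K" by (rule subspace_scale[OF sub z(1)])
      have d: "?d \<in> hset K" by (rule subspace_add[OF sub w(1) mz])
      have "hip K ?d ?d = hip K w ?d + hip K ((- 1) *\<^sub>R z) ?d"
        by (rule add[OF w(1) mz d])
      also have "hip K ((- 1) *\<^sub>R z) ?d = - 1 * hip K z ?d"
        by (rule scale[OF z(1) d])
      also have "hip K w ?d = hip K ?d w"
        by (rule commute[OF w(1) d])
      also have "hip K z ?d = hip K ?d z"
        by (rule commute[OF z(1) d])
      finally have "hip K ?d ?d = 0" using w(2) z(2) d by simp
      moreover have "hip K ?d ?d > 0"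
        by (rule pos[OF d \<open>?d \<noteq> 0\<close>])
      ultimately show False by simp
    qed
    with z show "\<exists>!z. z \<in> hset K \<and> (\<forall>x\<in>hset K. hip K x z = hip L (A x) y)" by blast
  qed
  fix ys :: "'b list"
  show "tensor_map K L A (length fs) (pure_tensor K fs) ys = pure_tensor L (map A fs) ys"
  proof (cases "ys \<in> tuples (hset L) (length fs)")
    case True
    then have "map (hadjoint K L A) ys \<in> tuples (hset K) (length fs)"
      using adjoint by (auto simp: tuples_def)
    moreover have "hip K (fs ! i) (hadjoint K L A (ys ! i)) = hip L (A (fs ! i)) (ys ! i)"
      if "i < length fs" for i
    proof -
      have "ys ! i \<in> hset L" "fs ! i \<in> hset K"
        using that True fs by (auto simp: tuples_def dest: nth_mem)
      then show ?thesis using adjoint by blast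
    qed
    ultimately show ?thesis
      using True by (auto simp: tensor_map_def pure_tensor_def tuples_def intro!: prod.cong)
  qed (simp add: tensor_map_def pure_tensor_def)
qed


section \<open>The \<open>q\<close>-Fock space\<close>

definition q_int :: "real \<Rightarrow> nat \<Rightarrow> real"
  where "q_int q n = (\<Sum>k<n. q ^ k)"

definition q_fact :: "real \<Rightarrow> nat \<Rightarrow> real"
  where "q_fact q n = (\<Prod>k=1..n. q_int q k)"

definition inversions :: "nat \<Rightarrow> (nat \<Rightarrow> nat) \<Rightarrow> nat"
  where "inversions n \<pi> = card {(i, j). i < j \<and> j < n \<and> \<pi> i > \<pi> j}"

text \<open>The permutation operators act on forms by permuting the arguments with the inverse
  permutation; the lemma below is the defining property of \<open>P\<^sub>q\<^sup>(\<^sup>n\<^sup>)\<close>.\<close>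

definition q_symmetrizer :: "real \<Rightarrow> nat \<Rightarrow> ('a list \<Rightarrow> real) \<Rightarrow> 'a list \<Rightarrow> real"
  where "q_symmetrizer q n S =
    (\<lambda>ys. \<Sum>\<pi> | \<pi> permutes {..<n}. q ^ inversions n \<pi> * S (permute_list (inv \<pi>) ys))"

lemma q_symmetrizer_pure_tensor:
  "q_symmetrizer q (length fs) (pure_tensor K fs) =
    (\<lambda>ys. \<Sum>\<pi> | \<pi> permutes {..<length fs}.
       q ^ inversions (length fs) \<pi> * pure_tensor K (permute_list \<pi> fs) ys)"
proof
  fix ys :: "'a list"
  let ?n = "length fs"
  have "pure_tensor K fs (permute_list (inv \<pi>) ys) = pure_tensor K (permute_list \<pi> fs) ys"
    if p: "\<pi> permutes {..<?n}" for \<pi>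
  proof (cases "ys \<in> tuples (hset K) ?n")
    case True
    then have len: "length ys = ?n" by (simp add: tuples_def)
    have ip: "inv \<pi> permutes {..<length ys}" using permutes_inv[OF p] len by simp
    have dom: "permute_list (inv \<pi>) ys \<in> tuples (hset K) ?n"
      using True set_permute_list[OF ip] by (simp add: tuples_def)
    have "(\<Prod>i<?n. hip K (fs ! i) (permute_list (inv \<pi>) ys ! i))
        = (\<Prod>i<?n. hip K (fs ! i) (ys ! inv \<pi> i))"
      by (intro prod.cong refl) (simp add: len permute_list_nth[OF ip])
    also have "\<dots> = (\<Prod>i<?n. hip K (fs ! \<pi> i) (ys ! i))"
      by (subst prod.permute[OF p]) (simp only: comp_def permutes_inverses(2)[OF p])
    also have "\<dots> = (\<Prod>i<?n. hip K (permute_list \<pi> fs ! i) (ys ! i))"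
      by (intro prod.cong refl) (simp add: permute_list_nth[OF p])
    finally show ?thesis using True dom by (simp add: pure_tensor_def)
  next
    case False
    have "permute_list (inv \<pi>) ys \<notin> tuples (hset K) ?n"
    proof
      assume a: "permute_list (inv \<pi>) ys \<in> tuples (hset K) ?n"
      then have ip: "inv \<pi> permutes {..<length ys}"
        using permutes_inv[OF p] by (simp add: tuples_def)
      show False using a False set_permute_list[OF ip] by (simp add: tuples_def)
    qed
    then show ?thesis using False by (simp add: pure_tensor_def)
  qed
  then show "q_symmetrizer q ?n (pure_tensor K fs) ys =
      (\<Sum>\<pi> | \<pi> permutes {..<?n}. q ^ inversions ?n \<pi> * pure_tensor K (permute_list \<pi> fs) ys)"
    unfolding q_symmetrizer_def by (intro sum.cong) auto
qed

definition q_fock_level :: "real \<Rightarrow> 'a::real_vector hspace \<Rightarrow> nat \<Rightarrow> ('a list \<Rightarrow> real) hspace"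
  where "q_fock_level q K n =
    \<lparr>hset = hset (tensor_power K n),
     hip = (\<lambda>f g. hip (tensor_power K n) (q_symmetrizer q n f) g)\<rparr>"

definition q_fock :: "real \<Rightarrow> 'a::real_vector hspace \<Rightarrow> (nat \<Rightarrow> 'a list \<Rightarrow> real) hspace"
  where "q_fock q K = hilbert_sum (q_fock_level q K)"


section \<open>The spaces \<open>\<G>\<^sub>q\<close>\<close>

definition G_space :: "real \<Rightarrow> 'a::real_vector hspace \<Rightarrow> real \<Rightarrow> real \<Rightarrow> (nat \<Rightarrow> 'a list \<Rightarrow> real) hspace"
  where "G_space q K r \<alpha> =
    hilbert_sum (\<lambda>n. scaled_hspace (tensor_power K n) (r ^ n * q_fact q n powr \<alpha>))"

text \<open>Ordering of the index set \<open>T \<times> [1,\<infinity>)\<close> and linking maps. For \<open>K' \<subseteq> K\<close> the embedding of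
  the tensor powers of \<open>K'\<close> into those of \<open>K\<close> is the tensor power of the inclusion; as a map
  between spaces of forms it is not a set inclusion, so the projective limit consists of
  compatible families.\<close>

definition G_le :: "('i \<Rightarrow> 'v::real_vector hspace) \<Rightarrow> 'i \<times> real \<Rightarrow> 'i \<times> real \<Rightarrow> bool"
  where "G_le H i j \<longleftrightarrow> hspace_embedded (H (fst j)) (H (fst i)) \<and> snd i \<le> snd j"

definition G_link ::
    "('i \<Rightarrow> 'v::real_vector hspace) \<Rightarrow> 'i \<times> real \<Rightarrow> 'i \<times> real \<Rightarrow>
      (nat \<Rightarrow> 'v list \<Rightarrow> real) \<Rightarrow> nat \<Rightarrow> 'v list \<Rightarrow> real"
  where "G_link H i j F = (\<lambda>n. tensor_map (H (fst j)) (H (fst i)) (\<lambda>x. x) n (F n))"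

definition G_nuclear ::
    "real \<Rightarrow> 'i set \<Rightarrow> ('i \<Rightarrow> 'v::real_vector hspace) \<Rightarrow> real \<Rightarrow>
      ('i \<times> real \<Rightarrow> nat \<Rightarrow> 'v list \<Rightarrow> real) topology"
  where "G_nuclear q T H \<alpha> =
    proj_lim (T \<times> {1..}) (G_le H) (\<lambda>(\<tau>, r). G_space q (H \<tau>) r \<alpha>) (G_link H)"

definition tensor_mult :: "(nat \<Rightarrow> 'a list \<Rightarrow> real) \<Rightarrow> (nat \<Rightarrow> 'a list \<Rightarrow> real) \<Rightarrow> nat \<Rightarrow> 'a list \<Rightarrow> real"
  where "tensor_mult F G = (\<lambda>n. \<Sum>i\<le>n. tensor i (F i) (G (n - i)))"

definition family_mult ::
    "('j \<Rightarrow> nat \<Rightarrow> 'a list \<Rightarrow> real) \<Rightarrow> ('j \<Rightarrow> nat \<Rightarrow> 'a list \<Rightarrow> real) \<Rightarrow> 'j \<Rightarrow> nat \<Rightarrow> 'a list \<Rightarrow> real"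
  where "family_mult F G = (\<lambda>j. tensor_mult (F j) (G j))"

text \<open>The element \<open>(0, \<dots>, 0, f\<^sub>1 \<otimes> \<dots> \<otimes> f\<^sub>n, 0, \<dots>)\<close> of the sequence spaces, and the element of
  the projective limit it represents.\<close>

definition pure_seq :: "'a hspace \<Rightarrow> 'a list \<Rightarrow> nat \<Rightarrow> 'a list \<Rightarrow> real"
  where "pure_seq K fs = (\<lambda>n. if n = length fs then pure_tensor K fs else 0)"

definition pure_family ::
    "'i set \<Rightarrow> ('i \<Rightarrow> 'v hspace) \<Rightarrow> 'v list \<Rightarrow> 'i \<times> real \<Rightarrow> nat \<Rightarrow> 'v list \<Rightarrow> real"
  where "pure_family T H fs = (\<lambda>j. if j \<in> T \<times> {1..} then pure_seq (H (fst j)) fs else 0)"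

text \<open>An algebra structure on a set of vectors, as in the type class \<open>real_algebra\<close>.\<close>

definition real_algebra_on :: "'a::real_vector set \<Rightarrow> ('a \<Rightarrow> 'a \<Rightarrow> 'a) \<Rightarrow> bool"
  where "real_algebra_on A m \<longleftrightarrow>
    subspace A \<and>
    (\<forall>x\<in>A. \<forall>y\<in>A. m x y \<in> A) \<and>
    (\<forall>x\<in>A. \<forall>y\<in>A. \<forall>z\<in>A. m (m x y) z = m x (m y z)) \<and>
    (\<forall>x\<in>A. \<forall>y\<in>A. \<forall>z\<in>A. m (x + y) z = m x z + m y z \<and> m x (y + z) = m x y + m x z) \<and>
    (\<forall>c. \<forall>x\<in>A. \<forall>y\<in>A. m (c *\<^sub>R x) y = c *\<^sub>R m x y \<and> m x (c *\<^sub>R y) = c *\<^sub>R m x y)"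

end

theory Submission
  imports Defs
begin

text \<open>Why the theorem holds. By continuity of \<open>\<iota>\<close> there are \<open>\<tau>\<close> and \<open>C\<close> with \<open>|\<iota> x| \<le> C |x|\<^sub>\<tau>\<close> on \<open>\<Phi>\<close>.
  Hence \<open>\<iota>\<close> has an adjoint \<open>a\<close> from \<open>K\<close> to the closure of \<open>\<Phi>\<close> in \<open>H \<tau>\<close>. On tensors, which are forms,
  the tensor powers of \<open>\<iota>\<close> are composition with \<open>a\<close> in every argument, and the embedding \<open>J\<close> applies
  this to the component of a family at \<open>(\<tau>, r)\<close>. On the \<open>n\<close>-th level the composition multiplies
  squared norms by at most \<open>C\<^sup>2\<^sup>n\<close> (\<open>pullback_tensor_power\<close>). Passing to the Fock norm costs at most
  the sum of \<open>|q|\<close> to the power \<open>inv \<pi>\<close> over all permutations, which is at most \<open>(1 - |q|)\<^sup>-\<^sup>n\<close>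
  (\<open>sum_power_inversions_le\<close>). As the weights \<open>r\<^sup>n ([n]\<^sub>q!)\<^sup>\<alpha>\<close> lie between \<open>(r l)\<^sup>n\<close> and \<open>(r u)\<^sup>n\<close> with
  \<open>l, u > 0\<close> (\<open>weight_bounds\<close>), a large \<open>r\<close> absorbs both factors, and \<open>J\<close> is continuous.

  That the Fock space is an inner product space at all rests on strict positivity of \<open>P\<^sub>q\<close>. Averaged
  over the symmetric group, its quadratic form is a sum of values of the kernel
  \<open>q\<close> to the power \<open>inv (\<pi> \<circ> \<sigma>\<inverse>)\<close>. The exponent is the size of the symmetric difference of the inversion
  sets of \<open>\<pi>\<close> and \<open>\<sigma>\<close>, and on the subsets of a finite set this kernel is a tensor power of a positive
  definite two by two matrix (\<open>symmetric_difference_kernel_ge\<close>, \<open>hip_q_fock_level_ge\<close>).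

  Injectivity of \<open>J\<close> cannot be read off a single component, since \<open>\<iota>\<close> need not extend injectively to
  \<open>H \<tau>\<close>. But if all arguments but one of a component of a compatible family are fixed, the resulting
  functional is represented by a vector lying in every \<open>H \<sigma>\<close>, that is, in \<open>\<Phi>\<close> (lemma \<open>\<G>_slots\<close>), and on \<open>\<Phi>\<close>
  the map \<open>\<iota>\<close> is injective. Applied to one argument after the other, this shows that a component that
  vanishes on the range of \<open>a\<close> vanishes (\<open>form_eq_zero\<close>).

  The range of \<open>J\<close> contains the pure tensors over \<open>\<iota> ` \<Phi>\<close>, whose linear span is dense because \<open>\<iota> ` \<Phi>\<close>
  is dense in \<open>K\<close> (\<open>dense_in_q_fock\<close>). Finally, \<open>|S \<otimes> R| = |S| |R|\<close> reduces continuity of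
  the multiplication to a Cauchy product of series, in which the number \<open>n + 1\<close> of summands on level \<open>n\<close> and the
  quotients of weights are again absorbed by a larger \<open>r\<close> (\<open>tensor_mult_bound\<close>).\<close>

section \<open>Inner product spaces on a carrier\<close>

locale ip_space =
  fixes K :: "'a::real_vector hspace"
  assumes ips: "inner_product_space K"
begin

lemma subspace_hset: "subspace (hset K)"
  using ips by (simp add: inner_product_space_def)

lemma mem_0 [simp]: "0 \<in> hset K"
  and mem_add [simp]: "x \<in> hset K \<Longrightarrow> y \<in> hset K \<Longrightarrow> x + y \<in> hset K"
  and mem_diff [simp]: "x \<in> hset K \<Longrightarrow> y \<in> hset K \<Longrightarrow> x - y \<in> hset K"
  and mem_scale [simp]: "x \<in> hset K \<Longrightarrow> c *\<^sub>R x \<in> hset K"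
  and mem_minus [simp]: "x \<in> hset K \<Longrightarrow> - x \<in> hset K"
  using subspace_hset
  by (simp_all add: subspace_0 subspace_add subspace_diff subspace_scale subspace_neg)

lemma mem_sum: "(\<And>i. i \<in> I \<Longrightarrow> f i \<in> hset K) \<Longrightarrow> sum f I \<in> hset K"
  using subspace_hset by (rule subspace_sum)

lemma span_mem: "V \<subseteq> hset K \<Longrightarrow> span V \<subseteq> hset K"
  using subspace_hset by (simp add: span_minimal)

lemma commute: "x \<in> hset K \<Longrightarrow> y \<in> hset K \<Longrightarrow> hip K x y = hip K y x"
  and add_left: "x \<in> hset K \<Longrightarrow> y \<in> hset K \<Longrightarrow> z \<in> hset K \<Longrightarrow> hip K (x + y) z = hip K x z + hip K y z"
  and scale_left: "x \<in> hset K \<Longrightarrow> y \<in> hset K \<Longrightarrow> hip K (c *\<^sub>R x) y = c * hip K x y"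
  and pos: "x \<in> hset K \<Longrightarrow> x \<noteq> 0 \<Longrightarrow> hip K x x > 0"
  using ips unfolding inner_product_space_def by metis+

lemma add_right: "x \<in> hset K \<Longrightarrow> y \<in> hset K \<Longrightarrow> z \<in> hset K \<Longrightarrow> hip K z (x + y) = hip K z x + hip K z y"
  by (metis add_left commute mem_add)

lemma scale_right: "x \<in> hset K \<Longrightarrow> y \<in> hset K \<Longrightarrow> hip K x (c *\<^sub>R y) = c * hip K x y"
  by (metis scale_left commute mem_scale)

lemma zero_left [simp]: "x \<in> hset K \<Longrightarrow> hip K 0 x = 0"
  using scale_left[of 0 x 0] by simp

lemma zero_right [simp]: "x \<in> hset K \<Longrightarrow> hip K x 0 = 0"
  using scale_right[of x 0 0] by simp

lemma diff_left: "x \<in> hset K \<Longrightarrow> y \<in> hset K \<Longrightarrow> z \<in> hset K \<Longrightarrow> hip K (x - y) z = hip K x z - hip K y z"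
  using add_left[of x "(-1) *\<^sub>R y" z] scale_left[of y z "-1"] by simp

lemma diff_right: "x \<in> hset K \<Longrightarrow> y \<in> hset K \<Longrightarrow> z \<in> hset K \<Longrightarrow> hip K z (x - y) = hip K z x - hip K z y"
  by (metis diff_left commute mem_diff)

lemma sum_left:
  "(\<And>i. i \<in> I \<Longrightarrow> f i \<in> hset K) \<Longrightarrow> y \<in> hset K \<Longrightarrow> hip K (sum f I) y = (\<Sum>i\<in>I. hip K (f i) y)"
  by (induction I rule: infinite_finite_induct) (simp_all add: add_left mem_sum)

lemma sum_right:
  "(\<And>i. i \<in> I \<Longrightarrow> f i \<in> hset K) \<Longrightarrow> y \<in> hset K \<Longrightarrow> hip K y (sum f I) = (\<Sum>i\<in>I. hip K y (f i))"
  by (induction I rule: infinite_finite_induct) (simp_all add: add_right mem_sum)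

lemmas bilinear = add_left add_right diff_left diff_right scale_left scale_right

lemma nonneg: "x \<in> hset K \<Longrightarrow> hip K x x \<ge> 0"
  using pos[of x] by (cases "x = 0") auto

lemma eq_zero_iff: "x \<in> hset K \<Longrightarrow> hip K x x = 0 \<longleftrightarrow> x = 0"
  using pos[of x] by (cases "x = 0") auto

lemma norm_nonneg [simp]: "x \<in> hset K \<Longrightarrow> hnorm K x \<ge> 0"
  by (simp add: hnorm_def nonneg)

lemma norm_sq: "x \<in> hset K \<Longrightarrow> (hnorm K x)\<^sup>2 = hip K x x"
  by (simp add: hnorm_def nonneg)

lemma norm_zero [simp]: "hnorm K 0 = 0"
  by (simp add: hnorm_def)

lemma norm_eq_0: "x \<in> hset K \<Longrightarrow> hnorm K x = 0 \<longleftrightarrow> x = 0"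
  by (simp add: hnorm_def eq_zero_iff nonneg)

lemma norm_scale: "x \<in> hset K \<Longrightarrow> hnorm K (c *\<^sub>R x) = \<bar>c\<bar> * hnorm K x"
  by (simp add: hnorm_def scale_left scale_right real_sqrt_mult power2_eq_square[symmetric]
      mult.assoc[symmetric])

lemma norm_minus_commute: "x \<in> hset K \<Longrightarrow> y \<in> hset K \<Longrightarrow> hnorm K (x - y) = hnorm K (y - x)"
  using norm_scale[of "y - x" "-1"] by simp

lemma norm_diff_sq:
  "x \<in> hset K \<Longrightarrow> y \<in> hset K \<Longrightarrow> (hnorm K (x - y))\<^sup>2 = hip K x x - 2 * hip K x y + hip K y y"
  by (simp add: norm_sq bilinear commute[of y x])

lemma cauchy_schwarz_sq:
  assumes x: "x \<in> hset K" and y: "y \<in> hset K"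
  shows "(hip K x y)\<^sup>2 \<le> hip K x x * hip K y y"
proof (cases "y = 0")
  case False
  define c where "c = hip K x y / hip K y y"
  have yy: "hip K y y > 0" using pos y False by simp
  have "0 \<le> hip K (x - c *\<^sub>R y) (x - c *\<^sub>R y)" using x y by (simp add: nonneg)
  also have "\<dots> = hip K x x - 2 * c * hip K x y + c\<^sup>2 * hip K y y"
    using x y by (simp add: bilinear commute[of y x] power2_eq_square algebra_simps)
  also have "\<dots> = hip K x x - (hip K x y)\<^sup>2 / hip K y y"
    using yy by (simp add: c_def field_simps power2_eq_square)
  finally show ?thesis using yy by (simp add: field_simps)
qed (use x in simp)

lemma cauchy_schwarz:
  assumes x: "x \<in> hset K" and y: "y \<in> hset K"
  shows "\<bar>hip K x y\<bar> \<le> hnorm K x * hnorm K y"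
  using real_sqrt_le_mono[OF cauchy_schwarz_sq[OF assms]] by (simp add: hnorm_def real_sqrt_mult)

lemma norm_triangle:
  assumes x: "x \<in> hset K" and y: "y \<in> hset K"
  shows "hnorm K (x + y) \<le> hnorm K x + hnorm K y"
proof (rule power2_le_imp_le)
  show "(hnorm K (x + y))\<^sup>2 \<le> (hnorm K x + hnorm K y)\<^sup>2"
    using x y cauchy_schwarz[OF x y]
    by (simp add: norm_sq bilinear commute[of y x] power2_sum)
qed (use x y in simp)

lemma norm_triangle_diff:
  "x \<in> hset K \<Longrightarrow> y \<in> hset K \<Longrightarrow> z \<in> hset K \<Longrightarrow> hnorm K (x - z) \<le> hnorm K (x - y) + hnorm K (y - z)"
  using norm_triangle[of "x - y" "y - z"] by simp

lemma norm_sum: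
  "(\<And>i. i \<in> I \<Longrightarrow> f i \<in> hset K) \<Longrightarrow> hnorm K (sum f I) \<le> (\<Sum>i\<in>I. hnorm K (f i))"
proof (induction I rule: infinite_finite_induct)
  case (insert i I)
  then show ?case using norm_triangle[of "f i" "sum f I"] by (simp add: mem_sum)
qed simp_all

sublocale metric: Metric_space "hset K" "hdist K"
proof
  fix x y z
  show "0 \<le> hdist K x y" by (simp add: hdist_def)
  show "hdist K x y = hdist K y x" by (simp add: hdist_def norm_minus_commute)
  show "hdist K x y = 0 \<longleftrightarrow> x = y" if "x \<in> hset K" "y \<in> hset K"
    using that by (simp add: hdist_def norm_eq_0)
  show "hdist K x z \<le> hdist K x y + hdist K y z" if "x \<in> hset K" "y \<in> hset K" "z \<in> hset K"
    using that by (simp add: hdist_def norm_triangle_diff)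
qed

lemma topspace_htop [simp]: "topspace (htop K) = hset K"
  by (simp add: htop_def)

lemma openin_htop:
  "openin (htop K) U \<longleftrightarrow>
    U \<subseteq> hset K \<and> (\<forall>x\<in>U. \<exists>r>0. \<forall>y\<in>hset K. hnorm K (x - y) < r \<longrightarrow> y \<in> U)"
proof -
  have "metric.mball x r \<subseteq> U \<longleftrightarrow> (\<forall>y\<in>hset K. hnorm K (x - y) < r \<longrightarrow> y \<in> U)" if "x \<in> hset K" for x r
    using that by (auto simp: metric.mball_def hdist_def)
  then show ?thesis unfolding htop_def metric.openin_mtopology by (meson subsetD)
qed

lemma openin_ball: "x \<in> hset K \<Longrightarrow> openin (htop K) {y \<in> hset K. hnorm K (x - y) < r}"
proof -
  assume x: "x \<in> hset K"
  have "{y \<in> hset K. hnorm K (x - y) < r} = metric.mball x r"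
    using x by (auto simp: metric.mball_def hdist_def)
  then show ?thesis by (simp add: htop_def)
qed

lemma closure_of_htop:
  "htop K closure_of S = {x \<in> hset K. \<forall>e>0. \<exists>y\<in>S. y \<in> hset K \<and> hnorm K (x - y) < e}"
  unfolding htop_def metric.metric_closure_of by (auto simp: metric.mball_def hdist_def)

lemma continuous_map_into_htop:
  "continuous_map X (htop K) f \<longleftrightarrow>
    f ` topspace X \<subseteq> hset K \<and>
    (\<forall>x\<in>topspace X. \<forall>e>0. \<exists>U. openin X U \<and> x \<in> U \<and> (\<forall>y\<in>U. hnorm K (f x - f y) < e))"
proof -
  have U: "y \<in> topspace X" if "openin X U" "y \<in> U" for U y
    using that openin_subset by blast
  show ?thesis (is "_ \<longleftrightarrow> ?a \<and> ?b")
  proof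
    assume c: "continuous_map X (htop K) f"
    then have a: ?a using continuous_map_image_subset_topspace[OF c] by simp
    moreover have ?b
    proof (intro ballI allI impI)
      fix x and e :: real assume x: "x \<in> topspace X" and e: "e > 0"
      obtain U where U: "openin X U" "x \<in> U" "\<forall>y\<in>U. f y \<in> metric.mball (f x) e"
        using c x e unfolding htop_def metric.continuous_map_to_metric by blast
      then have "\<forall>y\<in>U. hnorm K (f x - f y) < e"
        by (auto simp: metric.mball_def hdist_def)
      with U show "\<exists>U. openin X U \<and> x \<in> U \<and> (\<forall>y\<in>U. hnorm K (f x - f y) < e)" by blast
    qed
    ultimately show "?a \<and> ?b" ..
  next
    assume ab: "?a \<and> ?b"
    show "continuous_map X (htop K) f"
      unfolding htop_def metric.continuous_map_to_metric
    proof (intro ballI allI impI)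
      fix x and e :: real assume x: "x \<in> topspace X" and e: "e > 0"
      obtain U' where U': "openin X U'" "x \<in> U'" "\<forall>y\<in>U'. hnorm K (f x - f y) < e"
        using ab x e by blast
      have "f y \<in> metric.mball (f x) e" if "y \<in> U'" for y
        using U' that ab x U[OF U'(1) that] by (auto simp: metric.mball_def hdist_def)
      with U' show "\<exists>U. openin X U \<and> x \<in> U \<and> (\<forall>y\<in>U. f y \<in> metric.mball (f x) e)" by blast
    qed
  qed
qed

end

text \<open>Linearity is required on a subspace only, since maps out of a carrier are arbitrary elsewhere.\<close>

definition linear_to :: "'a::real_vector set \<Rightarrow> ('a \<Rightarrow> 'b::real_vector) \<Rightarrow> bool"
  where "linear_to V f \<longleftrightarrow>
    (\<forall>x\<in>V. \<forall>y\<in>V. f (x + y) = f x + f y) \<and> (\<forall>c. \<forall>x\<in>V. f (c *\<^sub>R x) = c *\<^sub>R f x)"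

lemma linear_toD:
  assumes "linear_to V f"
  shows "x \<in> V \<Longrightarrow> y \<in> V \<Longrightarrow> f (x + y) = f x + f y"
    and "x \<in> V \<Longrightarrow> f (c *\<^sub>R x) = c *\<^sub>R f x"
  using assms by (simp_all add: linear_to_def)

lemma linear_to_diff:
  assumes f: "linear_to V f" and V: "subspace V" and x: "x \<in> V" and y: "y \<in> V"
  shows "f (x - y) = f x - f y"
  using linear_toD(1)[OF f x subspace_scale[OF V y, of "-1"]] linear_toD(2)[OF f y, of "-1"] by simp

lemma linear_to_zero:
  assumes f: "linear_to V f" and V: "subspace V"
  shows "f 0 = 0"
  using linear_toD(2)[OF f subspace_0[OF V], of 0] by simp

lemma bounded_linear_continuous_map:
  assumes K: "ip_space K" and L: "ip_space L"
    and f: "linear_to (hset K) f" and im: "f ` hset K \<subseteq> hset L"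
    and bd: "\<And>x. x \<in> hset K \<Longrightarrow> hnorm L (f x) \<le> C * hnorm K x"
  shows "continuous_map (htop K) (htop L) f"
proof -
  interpret K: ip_space K by fact
  interpret L: ip_space L by fact
  show ?thesis
    unfolding L.continuous_map_into_htop
  proof (intro conjI ballI allI impI)
    show "f ` topspace (htop K) \<subseteq> hset L" using im by simp
    fix x and e :: real assume x: "x \<in> topspace (htop K)" and e: "e > 0"
    define D where "D = max C 1"
    have D: "D > 0" by (simp add: D_def)
    show "\<exists>U. openin (htop K) U \<and> x \<in> U \<and> (\<forall>y\<in>U. hnorm L (f x - f y) < e)"
    proof (intro exI conjI ballI)
      let ?U = "{y \<in> hset K. hnorm K (x - y) < e / D}"
      show "openin (htop K) ?U" using x by (simp add: K.openin_ball)
      show "x \<in> ?U" using x e D by simp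
      fix y assume y: "y \<in> ?U"
      have "hnorm L (f x - f y) \<le> C * hnorm K (x - y)"
        using bd[of "x - y"] linear_to_diff[OF f K.subspace_hset] x y by simp
      also have "\<dots> \<le> D * hnorm K (x - y)"
        using x y by (intro mult_right_mono) (auto simp: D_def)
      also have "\<dots> < e" using y D by (simp add: field_simps)
      finally show "hnorm L (f x - f y) < e" .
    qed
  qed
qed

lemma continuous_linear_bounded:
  assumes K: "ip_space K" and L: "ip_space L"
    and f: "linear_to (hset K) f" and c: "continuous_map (htop K) (htop L) f"
  obtains C where "C > 0" "\<And>x. x \<in> hset K \<Longrightarrow> hnorm L (f x) \<le> C * hnorm K x"
proof -
  interpret K: ip_space K by fact
  interpret L: ip_space L by fact
  have im: "f x \<in> hset L" if "x \<in> hset K" for x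
    using c that by (auto simp: L.continuous_map_into_htop image_subset_iff)
  obtain U where U: "openin (htop K) U" "0 \<in> U" "\<forall>y\<in>U. hnorm L (f 0 - f y) < 1"
    using c unfolding L.continuous_map_into_htop by (metis K.mem_0 K.topspace_htop zero_less_one)
  then obtain r where r: "r > 0" "\<And>y. y \<in> hset K \<Longrightarrow> hnorm K (0 - y) < r \<Longrightarrow> y \<in> U"
    unfolding K.openin_htop by blast
  have small: "hnorm L (f y) < 1" if "y \<in> hset K" "hnorm K y < r" for y
  proof -
    have "y \<in> U" using r that K.norm_minus_commute[of 0 y] by simp
    then show ?thesis
      using U(3) L.norm_scale[OF im[OF that(1)], of "-1"] linear_to_zero[OF f K.subspace_hset] by auto
  qed
  have "hnorm L (f x) \<le> (2 / r) * hnorm K x" if x: "x \<in> hset K" for x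
  proof (cases "x = 0")
    case False
    then have n: "hnorm K x > 0" using x K.norm_eq_0[of x] K.norm_nonneg[of x] by linarith
    define c where "c = r / (2 * hnorm K x)"
    have c: "c > 0" using n r by (simp add: c_def)
    have "hnorm L (f (c *\<^sub>R x)) < 1"
      by (rule small) (use x n r c in \<open>auto simp: K.norm_scale c_def\<close>)
    then have "c * hnorm L (f x) < 1"
      using x c im by (simp add: linear_toD(2)[OF f] L.norm_scale)
    then show ?thesis using n r by (simp add: c_def field_simps)
  qed (simp add: linear_to_zero[OF f K.subspace_hset])
  then show thesis using that[of "2 / r"] r by simp
qed


section \<open>Riesz representation and orthonormal bases\<close>

locale hilbert = ip_space +
  assumes complete: "Metric_space.mcomplete (hset K) (hdist K)"
begin

text \<open>The functional lives on a subspace that need not be closed. Its representing vector is the limit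
  of a minimising sequence of \<open>|x|\<^sup>2 - 2 \<phi> x\<close>; the sequence is Cauchy by the parallelogram law, and
  its limit represents \<open>\<phi>\<close> because the first variation vanishes there.\<close>

lemma riesz_subspace:
  fixes \<phi> :: "'a \<Rightarrow> real"
  assumes V: "subspace V" "V \<subseteq> hset K" and \<phi>: "linear_to V \<phi>"
    and bd: "\<And>x. x \<in> V \<Longrightarrow> \<bar>\<phi> x\<bar> \<le> C * hnorm K x" and C: "C \<ge> 0"
  obtains z where "z \<in> htop K closure_of V" "\<And>x. x \<in> V \<Longrightarrow> \<phi> x = hip K x z" "hnorm K z \<le> C"
proof -
  \<comment> \<open>up to a constant the squared distance of \<open>x\<close> to the vector that is to represent \<open>\<phi>\<close>\<close>
  define g where "g x = hip K x x - 2 * \<phi> x" for x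
  have VK: "x \<in> hset K" if "x \<in> V" for x using that V by blast
  have g_lower: "- C\<^sup>2 \<le> g x" if x: "x \<in> V" for x
  proof -
    have "\<phi> x \<le> C * hnorm K x" using bd[OF x] by simp
    then have "g x \<ge> (hnorm K x - C)\<^sup>2 - C\<^sup>2"
      using norm_sq[OF VK[OF x]] by (simp add: g_def power2_diff mult.commute)
    then show ?thesis by (smt (verit) zero_le_power2)
  qed
  define m where "m = Inf (g ` V)"
  have ne: "g ` V \<noteq> {}" using subspace_0[OF V(1)] by blast
  have bdd: "bdd_below (g ` V)" using g_lower by (auto intro!: bdd_belowI[of _ "- C\<^sup>2"])
  have m_le: "m \<le> g x" if "x \<in> V" for x
    unfolding m_def by (rule cInf_lower) (use that bdd in auto)
  have "\<exists>x\<in>V. g x < m + inverse (real (Suc n))" for n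
    using cInf_lessD[OF ne, of "m + inverse (real (Suc n))"] by (auto simp: m_def)
  then obtain X where XV: "\<And>n. X n \<in> V" and Xm: "\<And>n. g (X n) < m + inverse (real (Suc n))"
    by metis
  have XK: "X n \<in> hset K" for n using XV VK by blast
  have cauchy: "(hnorm K (X n - X k))\<^sup>2 \<le> 2 * inverse (real (Suc n)) + 2 * inverse (real (Suc k))" for n k
  proof -
    let ?y = "(1/2) *\<^sub>R (X n + X k)"
    have y: "?y \<in> V" using XV V by (simp add: subspace_add subspace_scale)
    have "\<phi> ?y = (\<phi> (X n) + \<phi> (X k)) / 2"
      using XV V by (simp add: linear_toD[OF \<phi>] subspace_add)
    moreover have "hip K ?y ?y = (hip K (X n) (X n) + 2 * hip K (X n) (X k) + hip K (X k) (X k)) / 4"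
      using XK by (simp add: scale_left scale_right add_left add_right commute[of "X k" "X n"] del: scaleR_add_right)
          (simp add: field_simps)
    ultimately have "(hnorm K (X n - X k))\<^sup>2 = 2 * g (X n) + 2 * g (X k) - 4 * g ?y"
      using XK by (simp add: g_def norm_diff_sq)
    then show ?thesis using m_le[OF y] Xm[of n] Xm[of k] by linarith
  qed
  have inv_lim: "(\<lambda>n. inverse (real (Suc n))) \<longlonglongrightarrow> 0" by (rule LIMSEQ_inverse_real_of_nat)
  have "metric.MCauchy X"
    unfolding metric.MCauchy_def
  proof (intro conjI allI impI)
    show "range X \<subseteq> hset K" using XK by blast
    fix e :: real assume e: "e > 0"
    obtain N where N: "inverse (real (Suc N)) < e\<^sup>2 / 4"
      using reals_Archimedean[of "e\<^sup>2 / 4"] e by auto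
    show "\<exists>N. \<forall>n n'. N \<le> n \<longrightarrow> N \<le> n' \<longrightarrow> hdist K (X n) (X n') < e"
    proof (intro exI allI impI)
      fix n n' assume "N \<le> n" "N \<le> n'"
      then have "inverse (real (Suc n)) \<le> inverse (real (Suc N))" "inverse (real (Suc n')) \<le> inverse (real (Suc N))"
        by (simp_all add: le_imp_inverse_le)
      then have "(hnorm K (X n - X n'))\<^sup>2 < e\<^sup>2" using cauchy[of n n'] N by linarith
      then show "hdist K (X n) (X n') < e"
        using XK e by (simp add: hdist_def power2_less_imp_less)
    qed
  qed
  then obtain z where z: "limitin metric.mtopology X z sequentially"
    using complete metric.mcomplete_def by blast
  then have zK: "z \<in> hset K" and "(\<lambda>n. hdist K (X n) z) \<longlonglongrightarrow> 0"
    unfolding metric.limitin_metric_dist_null by auto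
  then have lim: "(\<lambda>n. hnorm K (X n - z)) \<longlonglongrightarrow> 0"
    using XK by (simp add: hdist_def)
  have z_cl: "z \<in> htop K closure_of V"
    unfolding closure_of_htop
  proof (intro CollectI conjI allI impI zK)
    fix e :: real assume "e > 0"
    then have "eventually (\<lambda>n. hnorm K (X n - z) < e) sequentially"
      using order_tendstoD(2)[OF lim] by blast
    then obtain n where "hnorm K (X n - z) < e" by (auto simp: eventually_sequentially)
    then show "\<exists>y\<in>V. y \<in> hset K \<and> hnorm K (z - y) < e"
      using XV XK zK norm_minus_commute by metis
  qed
  have lim_ip: "(\<lambda>n. hip K x (X n)) \<longlonglongrightarrow> hip K x z" if x: "x \<in> hset K" for x
  proof (rule Lim_transform_bound[where f = "\<lambda>n. hip K x (X n) - hip K x z" and g="\<lambda>n. hnorm K x * hnorm K (X n - z)",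
         THEN LIM_zero_cancel])
    show "\<forall>\<^sub>F n in sequentially. norm (hip K x (X n) - hip K x z) \<le> norm (hnorm K x * hnorm K (X n - z))"
      using x XK zK cauchy_schwarz[of x "X n - z" for n]
      by (intro always_eventually) (simp add: diff_right)
    show "(\<lambda>n. hnorm K x * hnorm K (X n - z)) \<longlonglongrightarrow> 0"
      using tendsto_mult_left[OF lim, of "hnorm K x"] by simp
  qed
  have rep: "\<phi> x = hip K x z" if x: "x \<in> V" for x
  proof -
    define d where "d = hip K x z - \<phi> x"
    have quad: "0 \<le> 2 * t * d + t\<^sup>2 * hip K x x" for t
    proof (rule LIMSEQ_le_const)
      show "(\<lambda>n. inverse (real (Suc n)) + (2 * t * (hip K x (X n) - \<phi> x) + t\<^sup>2 * hip K x x))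
          \<longlonglongrightarrow> 2 * t * d + t\<^sup>2 * hip K x x"
        using tendsto_add[OF inv_lim tendsto_add[OF tendsto_mult_left[OF tendsto_diff[OF lim_ip[OF VK[OF x]]
              tendsto_const]] tendsto_const], of "2 * t" "\<phi> x" "t\<^sup>2 * hip K x x"]
        by (simp only: d_def add_0_left)
      have "0 \<le> inverse (real (Suc n)) + (2 * t * (hip K x (X n) - \<phi> x) + t\<^sup>2 * hip K x x)" for n
      proof -
        have "X n + t *\<^sub>R x \<in> V" using XV x V by (simp add: subspace_add subspace_scale)
        then have "m \<le> g (X n + t *\<^sub>R x)" by (rule m_le)
        also have "\<dots> = g (X n) + (2 * t * (hip K x (X n) - \<phi> x) + t\<^sup>2 * hip K x x)"
          using XV[of n] XK[of n] x VK[OF x] V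
          by (simp add: g_def bilinear linear_toD[OF \<phi>] subspace_scale commute[of "X n" x]
              power2_eq_square algebra_simps)
        finally show ?thesis using Xm[of n] by linarith
      qed
      then show "\<exists>N. \<forall>n\<ge>N. 0 \<le> inverse (real (Suc n)) + (2 * t * (hip K x (X n) - \<phi> x) + t\<^sup>2 * hip K x x)"
        by blast
    qed
    have "d = 0"
    proof (cases "hip K x x = 0")
      case True
      then show ?thesis using quad[of "- d"] by (auto simp: mult_le_0_iff)
    next
      case False
      then have xx: "hip K x x > 0" using nonneg[OF VK[OF x]] by simp
      have "2 * (- d / hip K x x) * d + (- d / hip K x x)\<^sup>2 * hip K x x = - (d\<^sup>2 / hip K x x)"
        using xx by (simp add: field_simps power2_eq_square)
      then have "d\<^sup>2 / hip K x x \<le> 0" using quad[of "- d / hip K x x"] by linarith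
      then show ?thesis using xx by (simp add: divide_le_0_iff)
    qed
    then show ?thesis by (simp add: d_def)
  qed
  have "hnorm K z \<le> C"
  proof -
    have "hip K z z \<le> C * hnorm K z"
    proof (rule LIMSEQ_le)
      show "(\<lambda>n. hip K z (X n)) \<longlonglongrightarrow> hip K z z" by (rule lim_ip[OF zK])
      show "(\<lambda>n. C * (hnorm K (X n - z) + hnorm K z)) \<longlonglongrightarrow> C * hnorm K z"
        using lim by (auto intro!: tendsto_eq_intros)
      have "hip K z (X n) \<le> C * (hnorm K (X n - z) + hnorm K z)" for n
      proof -
        have "hip K z (X n) \<le> C * hnorm K (X n)"
          using bd[OF XV[of n]] rep[OF XV[of n]] commute[OF zK XK[of n]] by simp
        also have "\<dots> \<le> C * (hnorm K (X n - z) + hnorm K z)"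
          using norm_triangle[of "X n - z" z] XK[of n] zK C by (intro mult_left_mono) auto
        finally show ?thesis .
      qed
      then show "\<exists>N. \<forall>n\<ge>N. hip K z (X n) \<le> C * (hnorm K (X n - z) + hnorm K z)" by blast
    qed
    then have "hnorm K z * hnorm K z \<le> C * hnorm K z"
      using norm_sq[OF zK] by (simp add: power2_eq_square)
    then show ?thesis
      using norm_nonneg[OF zK] C by (metis mult_le_cancel_right not_less order_le_less)
  qed
  with z_cl rep show thesis by (rule that)
qed

lemma closure_full: "htop K closure_of (hset K) = hset K"
  using closure_of_topspace[of "htop K"] by simp

lemma riesz:
  fixes \<phi> :: "'a \<Rightarrow> real"
  assumes \<phi>: "linear_to (hset K) \<phi>" and bd: "\<And>x. x \<in> hset K \<Longrightarrow> \<bar>\<phi> x\<bar> \<le> C * hnorm K x"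
  obtains z where "z \<in> hset K" "\<And>x. x \<in> hset K \<Longrightarrow> \<phi> x = hip K x z"
proof -
  have "\<bar>\<phi> x\<bar> \<le> max C 0 * hnorm K x" if "x \<in> hset K" for x
    using bd[OF that] mult_right_mono[OF max.cobounded1[of C 0] norm_nonneg[OF that]] by linarith
  then obtain z where "z \<in> htop K closure_of (hset K)" "\<And>x. x \<in> hset K \<Longrightarrow> \<phi> x = hip K x z"
    using riesz_subspace[OF subspace_hset subset_refl \<phi>, of "max C 0"] by (metis max.cobounded2)
  then show thesis using that closure_full by simp
qed

end

context ip_space
begin

lemma orthogonal_closure_span:
  assumes B: "B \<subseteq> hset K" and x: "x \<in> hset K" and orth: "\<And>e. e \<in> B \<Longrightarrow> hip K x e = 0"
    and y: "y \<in> htop K closure_of (span B)"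
  shows "hip K x y = 0"
proof -
  have span: "z \<in> hset K \<and> hip K x z = 0" if "z \<in> span B" for z
    using that
    by (induction rule: span_induct_alt) (use B x orth in \<open>auto simp: bilinear\<close>)
  have yK: "y \<in> hset K" using y by (simp add: closure_of_htop)
  have "\<bar>hip K x y\<bar> \<le> 0"
  proof (rule field_le_epsilon)
    fix e :: real assume e: "e > 0"
    have "e / (hnorm K x + 1) > 0" using e x by (simp add: add_nonneg_pos)
    then obtain z where z: "z \<in> span B" "hnorm K (y - z) < e / (hnorm K x + 1)"
      using y unfolding closure_of_htop by blast
    have "\<bar>hip K x y\<bar> = \<bar>hip K x (y - z)\<bar>" using span[OF z(1)] x yK by (simp add: bilinear)
    also have "\<dots> \<le> hnorm K x * hnorm K (y - z)"
      using x yK span[OF z(1)] by (intro cauchy_schwarz) auto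
    also have "\<dots> \<le> (hnorm K x + 1) * hnorm K (y - z)"
      using x yK span[OF z(1)] by (intro mult_right_mono) auto
    also have "\<dots> \<le> e"
      using z(2) add_nonneg_pos[OF norm_nonneg[OF x] zero_less_one]
      by (simp add: pos_less_divide_eq mult.commute)
    finally show "\<bar>hip K x y\<bar> \<le> 0 + e" by simp
  qed
  then show ?thesis by simp
qed

text \<open>The second estimate is the optimality of the orthogonal projection among the elements of the
  span; it turns density of the span into Parseval's identity.\<close>

lemma bessel:
  assumes F: "finite F" "F \<subseteq> hset K" and on: "\<And>e f. e \<in> F \<Longrightarrow> f \<in> F \<Longrightarrow> hip K e f = (if e = f then 1 else 0)"
    and x: "x \<in> hset K"
  shows "(\<Sum>e\<in>F. (hip K x e)\<^sup>2) \<le> hip K x x"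
    and "y \<in> span F \<Longrightarrow> hip K x x - (\<Sum>e\<in>F. (hip K x e)\<^sup>2) \<le> (hnorm K (x - y))\<^sup>2"
proof -
  define p where "p c = (\<Sum>e\<in>F. c e *\<^sub>R e)" for c :: "'a \<Rightarrow> real"
  have pK: "p c \<in> hset K" for c unfolding p_def using F by (intro mem_sum) auto
  have xp: "hip K x (p c) = (\<Sum>e\<in>F. c e * hip K x e)" for c
    unfolding p_def using F x by (subst sum_right) (auto simp: bilinear subset_iff intro!: sum.cong)
  have pp: "hip K (p c) (p c) = (\<Sum>e\<in>F. (c e)\<^sup>2)" for c
  proof -
    have "hip K (p c) f = c f" if f: "f \<in> F" for f
    proof -
      have "hip K (p c) f = (\<Sum>e\<in>F. c e * hip K e f)"
        unfolding p_def using F f by (subst sum_left) (auto simp: bilinear subset_iff intro!: sum.cong)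
      also have "\<dots> = (\<Sum>e\<in>F. if e = f then c e else 0)"
        using on f by (intro sum.cong) auto
      finally show ?thesis using F f by simp
    qed
    then have "hip K (p c) (p c) = (\<Sum>e\<in>F. c e * c e)"
      using F pK[of c] by (subst (2) p_def, subst sum_right) (auto simp: bilinear subset_iff intro!: sum.cong)
    then show ?thesis by (simp add: power2_eq_square)
  qed
  have dist: "(hnorm K (x - p c))\<^sup>2 = hip K x x - (\<Sum>e\<in>F. (hip K x e)\<^sup>2) + (\<Sum>e\<in>F. (c e - hip K x e)\<^sup>2)" for c
    using x pK[of c]
    by (simp add: norm_diff_sq xp pp power2_diff sum.distrib sum_subtractf sum_distrib_left algebra_simps)
  show "(\<Sum>e\<in>F. (hip K x e)\<^sup>2) \<le> hip K x x"
    using dist[of "\<lambda>e. hip K x e"] zero_le_power2[of "hnorm K (x - p (\<lambda>e. hip K x e))"] by simp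
  assume "y \<in> span F"
  then obtain c where "y = p c" using F(1) by (auto simp: span_finite p_def)
  then show "hip K x x - (\<Sum>e\<in>F. (hip K x e)\<^sup>2) \<le> (hnorm K (x - y))\<^sup>2"
    using dist[of c] sum_nonneg[of F "\<lambda>e. (c e - hip K x e)\<^sup>2"] by simp
qed

lemma parseval:
  assumes B: "orthonormal_basis K B" and x: "x \<in> hset K"
  shows "((\<lambda>e. (hip K x e)\<^sup>2) has_sum hip K x x) B"
proof -
  have BK: "B \<subseteq> hset K" and on: "\<And>e f. e \<in> B \<Longrightarrow> f \<in> B \<Longrightarrow> hip K e f = (if e = f then 1 else 0)"
    and cl: "htop K closure_of (span B) = hset K"
    using B by (auto simp: orthonormal_basis_def)
  show ?thesis
    unfolding has_sum_def tendsto_iff eventually_finite_subsets_at_top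
  proof (intro allI impI)
    fix e :: real assume e: "e > 0"
    have "x \<in> htop K closure_of (span B)" using cl x by simp
    then obtain y where y: "y \<in> span B" "hnorm K (x - y) < sqrt e"
      using real_sqrt_gt_zero[OF e] unfolding closure_of_htop by blast
    obtain F r where F: "finite F" "F \<subseteq> B" and "y = (\<Sum>a\<in>F. r a *\<^sub>R a)"
      using y(1) unfolding span_explicit by blast
    then have yF: "y \<in> span F" by (auto intro: span_sum span_scale span_base)
    have yK: "y \<in> hset K" using y(1) span_mem[OF BK] by blast
    show "\<exists>X. finite X \<and> X \<subseteq> B \<and> (\<forall>Y. finite Y \<and> X \<subseteq> Y \<and> Y \<subseteq> B \<longrightarrow> dist (\<Sum>e\<in>Y. (hip K x e)\<^sup>2) (hip K x x) < e)"
    proof (intro exI conjI allI impI)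
      fix Y assume Y: "finite Y \<and> F \<subseteq> Y \<and> Y \<subseteq> B"
      have "(hnorm K (x - y))\<^sup>2 < (sqrt e)\<^sup>2"
        using y(2) x yK by (intro power_strict_mono) auto
      then have "(hnorm K (x - y))\<^sup>2 < e" using e by simp
      moreover have "y \<in> span Y" using yF Y span_mono[of F Y] by blast
      ultimately show "dist (\<Sum>e\<in>Y. (hip K x e)\<^sup>2) (hip K x x) < e"
        using bessel(1)[OF _ _ _ x, of Y] bessel(2)[OF _ _ _ x, of Y y] Y BK on
        by (auto simp: dist_real_def subset_iff)
    qed (use F in auto)
  qed
qed

end

context hilbert
begin

text \<open>A maximal orthonormal set is a basis: the projection onto its closed span is supplied by the
  representation theorem on the span.\<close>

lemma ex_orthonormal_basis: "\<exists>B. orthonormal_basis K B"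
proof -
  define on where "on B \<longleftrightarrow> B \<subseteq> hset K \<and> (\<forall>e\<in>B. \<forall>f\<in>B. hip K e f = (if e = f then 1 else 0))" for B
  have "\<exists>M\<in>{B. on B}. \<forall>X\<in>{B. on B}. M \<subseteq> X \<longrightarrow> X = M"
  proof (rule subset_Zorn_nonempty)
    show "{B. on B} \<noteq> {}" by (auto simp: on_def)
    fix \<C> assume "\<C> \<noteq> {}" and C: "subset.chain {B. on B} \<C>"
    show "\<Union>\<C> \<in> {B. on B}"
      unfolding on_def mem_Collect_eq
    proof (intro conjI ballI)
      show "\<Union>\<C> \<subseteq> hset K" using C by (auto simp: subset.chain_def on_def)
      fix e f assume "e \<in> \<Union>\<C>" "f \<in> \<Union>\<C>"
      then obtain X Y where XY: "X \<in> \<C>" "e \<in> X" "Y \<in> \<C>" "f \<in> Y" by blast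
      then have "X \<subseteq> Y \<or> Y \<subseteq> X" using C unfolding subset.chain_def by blast
      then obtain Z where "Z \<in> \<C>" "e \<in> Z" "f \<in> Z" using XY by blast
      then show "hip K e f = (if e = f then 1 else 0)" using C by (auto simp: subset.chain_def on_def)
    qed
  qed
  then obtain B where B: "on B" and max: "\<And>X. on X \<Longrightarrow> B \<subseteq> X \<Longrightarrow> X = B" by blast
  have BK: "B \<subseteq> hset K" using B by (simp add: on_def)
  have "hset K \<subseteq> htop K closure_of (span B)"
  proof
    fix x assume x: "x \<in> hset K"
    obtain z where z: "z \<in> htop K closure_of (span B)" "\<And>y. y \<in> span B \<Longrightarrow> hip K x y = hip K y z"
      using riesz_subspace[OF subspace_span span_mem[OF BK], of "\<lambda>y. hip K x y" "hnorm K x"]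
      using x span_mem[OF BK] cauchy_schwarz[OF x]
      by (smt (verit) linear_to_def add_right scale_right real_scaleR_def norm_nonneg subsetD)
    have zK: "z \<in> hset K" using z(1) by (simp add: closure_of_htop)
    show "x \<in> htop K closure_of (span B)"
    proof (rule ccontr)
      assume "x \<notin> htop K closure_of (span B)"
      then have "x - z \<noteq> 0" using z(1) by auto
      define u where "u = (1 / hnorm K (x - z)) *\<^sub>R (x - z)"
      have u: "u \<in> hset K" using x zK by (simp add: u_def)
      have uu: "hip K u u = 1"
        using pos[OF _ \<open>x - z \<noteq> 0\<close>] x zK norm_sq[of "x - z"]
        by (simp add: u_def scale_left scale_right power2_eq_square del: scaleR_diff_right)
      have ue: "hip K u e = 0" if "e \<in> B" for e
      proof -
        have "hip K (x - z) e = 0"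
          using z(2)[OF span_base[OF that]] x zK that BK by (simp add: diff_left commute[of z e] subset_iff)
        then show ?thesis using x zK that BK by (auto simp: u_def scale_left)
      qed
      have eu: "hip K e u = 0" if "e \<in> B" for e
        using ue[OF that] commute[OF _ u, of e] that BK by auto
      have une: "u \<notin> B" using ue uu by fastforce
      have "on (insert u B)"
        unfolding on_def
      proof (intro conjI ballI)
        show "insert u B \<subseteq> hset K" using u BK by simp
        fix e f assume "e \<in> insert u B" "f \<in> insert u B"
        then show "hip K e f = (if e = f then 1 else 0)"
          using B uu ue eu une unfolding on_def by (elim insertE) auto
      qed
      then have "u \<in> B" using max[of "insert u B"] by blast
      then show False using une by simp
    qed
  qed
  then have "htop K closure_of (span B) = hset K"
    using closure_of_subset_topspace[of "htop K" "span B"] by simp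
  then show ?thesis using B unfolding orthonormal_basis_def on_def by blast
qed

lemma some_basis: "orthonormal_basis K (some_basis K)"
  unfolding some_basis_def by (rule someI_ex) (rule ex_orthonormal_basis)

end


section \<open>Bounded multilinear forms\<close>

lemma tuples_0 [simp]: "tuples A 0 = {[]}"
  by (auto simp: tuples_def)

lemma Cons_in_tuples [simp]: "x # xs \<in> tuples A (Suc n) \<longleftrightarrow> x \<in> A \<and> xs \<in> tuples A n"
  by (auto simp: tuples_def)

lemma tuples_SucE:
  assumes "ys \<in> tuples A (Suc n)"
  obtains x xs where "ys = x # xs" "x \<in> A" "xs \<in> tuples A n"
  using assms by (cases ys) (auto simp: tuples_def)

lemma tuples_Suc: "tuples A (Suc n) = (\<lambda>(x, xs). x # xs) ` (A \<times> tuples A n)"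
  by (auto elim!: tuples_SucE)

lemma tuples_mono: "A \<subseteq> B \<Longrightarrow> tuples A n \<subseteq> tuples B n"
  by (auto simp: tuples_def)

lemma tuples_length: "xs \<in> tuples A n \<Longrightarrow> length xs = n"
  by (simp add: tuples_def)

lemma tuples_update: "xs \<in> tuples A n \<Longrightarrow> x \<in> A \<Longrightarrow> xs[i := x] \<in> tuples A n"
  using set_update_subset_insert[of xs i x] by (auto simp: tuples_def)

lemma map_in_tuples: "(\<And>x. x \<in> A \<Longrightarrow> f x \<in> B) \<Longrightarrow> xs \<in> tuples A n \<Longrightarrow> map f xs \<in> tuples B n"
  by (auto simp: tuples_def)

lemma append_in_tuples [simp]:
  "length xs = i \<Longrightarrow> xs @ ys \<in> tuples A (i + j) \<longleftrightarrow> xs \<in> tuples A i \<and> ys \<in> tuples A j"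
  by (auto simp: tuples_def)

lemma take_drop_in_tuples:
  assumes "length ys = i + j"
  shows "ys \<in> tuples A (i + j) \<longleftrightarrow> take i ys \<in> tuples A i \<and> drop i ys \<in> tuples A j"
  using append_in_tuples[of "take i ys" i "drop i ys" A j] assms by simp

lemma tuples_add_iff:
  "ys \<in> tuples A (i + j) \<longleftrightarrow> take i ys \<in> tuples A i \<and> drop i ys \<in> tuples A j"
proof (cases "length ys = i + j")
  case False
  then have "\<not> (length (take i ys) = i \<and> length (drop i ys) = j)" by auto
  with False show ?thesis by (auto dest: tuples_length)
qed (rule take_drop_in_tuples)

lemma tuples_append: "tuples A (i + j) = (\<lambda>(xs, ys). xs @ ys) ` (tuples A i \<times> tuples A j)"
proof
  show "tuples A (i + j) \<subseteq> (\<lambda>(xs, ys). xs @ ys) ` (tuples A i \<times> tuples A j)"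
  proof
    fix ys assume "ys \<in> tuples A (i + j)"
    then have "(take i ys, drop i ys) \<in> tuples A i \<times> tuples A j" by (simp add: tuples_add_iff)
    then show "ys \<in> (\<lambda>(xs, ys). xs @ ys) ` (tuples A i \<times> tuples A j)"
      by (metis (mono_tags, lifting) append_take_drop_id case_prod_conv image_eqI)
  qed
qed (auto simp: tuples_def)

lemma inj_on_Cons_pair: "inj_on (\<lambda>(x, xs). x # xs) X"
  by (auto simp: inj_on_def)

lemma inj_on_append_pair: "inj_on (\<lambda>(xs, ys). xs @ ys) (tuples A i \<times> tuples A j)"
  by (auto simp: inj_on_def tuples_def)

lemma summable_on_tuples_Suc:
  "f summable_on tuples A (Suc n) \<longleftrightarrow> (\<lambda>(x, xs). f (x # xs)) summable_on (A \<times> tuples A n)"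
  unfolding tuples_Suc summable_on_reindex[OF inj_on_Cons_pair] by (simp add: comp_def case_prod_unfold)

lemma infsum_tuples_Suc:
  "infsum f (tuples A (Suc n)) = infsum (\<lambda>(x, xs). f (x # xs)) (A \<times> tuples A n)"
  unfolding tuples_Suc infsum_reindex[OF inj_on_Cons_pair] by (simp add: comp_def case_prod_unfold)

text \<open>For the whole carrier as \<open>P\<close> this is what the Riesz theorem extracts from a bounded multilinear
  form. A smaller \<open>P\<close> records that the vectors representing the form in a single argument are not
  arbitrary.\<close>

definition slots_in :: "'a hspace \<Rightarrow> 'a set \<Rightarrow> nat \<Rightarrow> ('a list \<Rightarrow> real) \<Rightarrow> bool"
  where "slots_in K P n S \<longleftrightarrow>
    (\<forall>ys\<in>tuples (hset K) n. \<forall>i<n. \<exists>x\<in>P. \<forall>z\<in>hset K. S (ys[i := z]) = hip K x z)"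

lemma slots_in_Cons:
  assumes "slots_in K P (Suc n) S" and x: "x \<in> hset K"
  shows "slots_in K P n (\<lambda>ys. S (x # ys))"
  unfolding slots_in_def
proof (intro ballI allI impI)
  fix ys i assume "ys \<in> tuples (hset K) n" "i < n"
  then have "x # ys \<in> tuples (hset K) (Suc n)" "Suc i < Suc n" using x by auto
  then obtain v where "v \<in> P" "\<forall>z\<in>hset K. S ((x # ys)[Suc i := z]) = hip K v z"
    using assms(1) unfolding slots_in_def by blast
  then show "\<exists>v\<in>P. \<forall>z\<in>hset K. S (x # ys[i := z]) = hip K v z" by auto
qed

lemma slots_in_head:
  assumes "slots_in K P (Suc n) S" and ys: "ys \<in> tuples (hset K) n" and x: "x \<in> hset K"
  obtains v where "v \<in> P" "\<And>z. z \<in> hset K \<Longrightarrow> S (z # ys) = hip K v z"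
proof -
  have "x # ys \<in> tuples (hset K) (Suc n)" using x ys by simp
  then obtain v where "v \<in> P" "\<forall>z\<in>hset K. S ((x # ys)[0 := z]) = hip K v z"
    using assms(1) unfolding slots_in_def by blast
  then show thesis using that by auto
qed

text \<open>Arguments are freed from \<open>D\<close> one at a time: with the others fixed, the form is represented by a
  vector of \<open>P\<close> orthogonal to \<open>D\<close>, hence zero.\<close>

lemma form_eq_zero:
  assumes D: "D \<subseteq> hset K" and sep: "\<And>x. x \<in> P \<Longrightarrow> (\<And>d. d \<in> D \<Longrightarrow> hip K x d = 0) \<Longrightarrow> x = 0"
    and zero: "\<And>z. z \<in> hset K \<Longrightarrow> hip K 0 z = 0"
    and S: "slots_in K P n S" and off: "\<And>ys. ys \<notin> tuples (hset K) n \<Longrightarrow> S ys = 0"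
    and van: "\<And>ys. ys \<in> tuples D n \<Longrightarrow> S ys = 0"
  shows "S = 0"
proof -
  have "S ys = 0" for ys
    using S off van
  proof (induction n arbitrary: S ys)
    case 0
    then show ?case by (cases "ys = []") auto
  next
    case (Suc n)
    have D0: "S (d # ys) = 0" if d: "d \<in> D" for d ys
    proof (rule Suc.IH[of "\<lambda>ys. S (d # ys)"])
      show "slots_in K P n (\<lambda>ys. S (d # ys))" using Suc.prems(1) d D by (auto intro: slots_in_Cons)
      show "S (d # ys) = 0" if "ys \<notin> tuples (hset K) n" for ys
        using that by (intro Suc.prems(2)) simp
      show "S (d # ys) = 0" if "ys \<in> tuples D n" for ys
        using that d by (intro Suc.prems(3)) simp
    qed
    show ?case
    proof (cases "ys \<in> tuples (hset K) (Suc n)")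
      case True
      then obtain y ys' where ys: "ys = y # ys'" "y \<in> hset K" "ys' \<in> tuples (hset K) n"
        by (rule tuples_SucE)
      obtain v where v: "v \<in> P" "\<And>z. z \<in> hset K \<Longrightarrow> S (z # ys') = hip K v z"
        using slots_in_head[OF Suc.prems(1) ys(3,2)] by blast
      then have "v = 0" using sep[OF v(1)] D0 D by (metis subsetD)
      then show ?thesis using v(2) ys zero by simp
    qed (rule Suc.prems(2))
  qed
  then show ?thesis by (simp add: fun_eq_iff)
qed

lemma multilinear_formD:
  assumes "multilinear_form K n S"
  shows "xs \<notin> tuples (hset K) n \<Longrightarrow> S xs = 0"
    and "xs \<in> tuples (hset K) n \<Longrightarrow> i < n \<Longrightarrow> x \<in> hset K \<Longrightarrow> y \<in> hset K \<Longrightarrow>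
       S (xs[i := a *\<^sub>R x + b *\<^sub>R y]) = a * S (xs[i := x]) + b * S (xs[i := y])"
  using assms by (simp_all add: multilinear_form_def)

lemma (in hilbert) bounded_form_slots_in:
  assumes S: "multilinear_form K n S" "bounded_form K n S"
  shows "slots_in K (hset K) n S"
  unfolding slots_in_def
proof (intro ballI allI impI)
  fix ys i assume ys: "ys \<in> tuples (hset K) n" and i: "i < n"
  obtain C where C: "\<And>xs. xs \<in> tuples (hset K) n \<Longrightarrow> \<bar>S xs\<bar> \<le> C * prod_list (map (hnorm K) xs)"
    using S(2) unfolding bounded_form_def by blast
  have lin: "linear_to (hset K) (\<lambda>z. S (ys[i := z]))"
    unfolding linear_to_def
  proof (intro conjI ballI allI)
    fix x y assume "x \<in> hset K" "y \<in> hset K"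
    then show "S (ys[i := x + y]) = S (ys[i := x]) + S (ys[i := y])"
      using multilinear_formD(2)[OF S(1) ys i, of x y 1 1] by simp
  next
    fix c x assume "x \<in> hset K"
    then show "S (ys[i := c *\<^sub>R x]) = c *\<^sub>R S (ys[i := x])"
      using multilinear_formD(2)[OF S(1) ys i, of x x c 0] by simp
  qed
  let ?p = "prod_list (map (hnorm K) (take i ys)) * prod_list (map (hnorm K) (drop (Suc i) ys))"
  have bd: "\<bar>S (ys[i := z])\<bar> \<le> (C * ?p) * hnorm K z" if z: "z \<in> hset K" for z
  proof -
    have "ys[i := z] = take i ys @ z # drop (Suc i) ys"
      using i ys by (intro upd_conv_take_nth_drop) (simp add: tuples_def)
    then show ?thesis using C[OF tuples_update[OF ys z, of i]] by (simp add: mult_ac)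
  qed
  show "\<exists>x\<in>hset K. \<forall>z\<in>hset K. S (ys[i := z]) = hip K x z"
    using riesz[OF lin bd] commute by metis
qed

lemma summable_Sigma_mono:
  fixes u :: "'a \<times> 'b \<Rightarrow> real" and v :: "'a \<times> 'c \<Rightarrow> real"
  assumes u: "u summable_on (A \<times> B)" and c: "c \<ge> 0"
    and v0: "\<And>a b. a \<in> A \<Longrightarrow> b \<in> B' \<Longrightarrow> v (a, b) \<ge> 0"
    and vs: "\<And>a. a \<in> A \<Longrightarrow> (\<lambda>b. v (a, b)) summable_on B'"
    and le: "\<And>a. a \<in> A \<Longrightarrow> (\<Sum>\<^sub>\<infinity>b\<in>B'. v (a, b)) \<le> c * (\<Sum>\<^sub>\<infinity>b\<in>B. u (a, b))"
  shows "v summable_on (A \<times> B')" and "infsum v (A \<times> B') \<le> c * infsum u (A \<times> B)"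
proof -
  have us: "(\<lambda>a. \<Sum>\<^sub>\<infinity>b\<in>B. u (a, b)) summable_on A"
    using summable_on_Sigma_banach[of "\<lambda>a b. u (a, b)"] u by simp
  have us': "(\<lambda>a. c * (\<Sum>\<^sub>\<infinity>b\<in>B. u (a, b))) summable_on A"
    by (rule summable_on_cmult_right) (rule us)
  have vs': "(\<lambda>a. \<Sum>\<^sub>\<infinity>b\<in>B'. v (a, b)) summable_on A"
    by (rule summable_on_comparison_test[OF us']) (use le v0 in \<open>auto intro: infsum_nonneg\<close>)
  show v: "v summable_on (A \<times> B')"
    by (rule summable_on_SigmaI[OF _ vs']) (use vs v0 in \<open>auto intro: has_sum_infsum\<close>)
  have "infsum v (A \<times> B') = (\<Sum>\<^sub>\<infinity>a\<in>A. \<Sum>\<^sub>\<infinity>b\<in>B'. v (a, b))" by (rule infsum_Sigma_banach[OF v, symmetric])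
  also have "\<dots> \<le> (\<Sum>\<^sub>\<infinity>a\<in>A. c * (\<Sum>\<^sub>\<infinity>b\<in>B. u (a, b)))"
    by (rule infsum_mono[OF vs' us' le])
  also have "\<dots> = c * infsum u (A \<times> B)"
    by (simp add: infsum_cmult_right us infsum_Sigma_banach[OF u])
  finally show "infsum v (A \<times> B') \<le> c * infsum u (A \<times> B)" .
qed

lemma infsum_swap_pairs: "infsum (\<lambda>(y, x). f (x, y)) (B \<times> A) = infsum f (A \<times> B)"
proof -
  have "bij_betw (\<lambda>(x, y). (y, x)) (B \<times> A) (A \<times> B)"
    by (rule bij_betwI[of _ _ _ "\<lambda>(x, y). (y, x)"]) auto
  from infsum_reindex_bij_betw[OF this, of f] show ?thesis by (simp add: case_prod_unfold)
qed

text \<open>Hilbert--Schmidt forms may be evaluated along any family satisfying a Bessel inequality, such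
  as the image of an orthonormal set under a bounded operator. One argument at a time is moved
  from the orthonormal set \<open>F\<close> to the family \<open>b\<close>.\<close>

lemma hilbert_schmidt_form_bessel:
  fixes b :: "'b \<Rightarrow> 'a::real_vector"
  assumes F: "F \<subseteq> hset K" and b: "\<And>e. e \<in> E \<Longrightarrow> b e \<in> hset K" and c: "c \<ge> 0"
    and sumE: "\<And>x. x \<in> hset K \<Longrightarrow> (\<lambda>e. (hip K x (b e))\<^sup>2) summable_on E"
    and bes: "\<And>x. x \<in> hset K \<Longrightarrow> (\<Sum>\<^sub>\<infinity>e\<in>E. (hip K x (b e))\<^sup>2) \<le> c * (\<Sum>\<^sub>\<infinity>f\<in>F. (hip K x f)\<^sup>2)"
    and S: "slots_in K (hset K) n S" and sum: "(\<lambda>fs. (S fs)\<^sup>2) summable_on tuples F n"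
  shows "(\<lambda>es. (S (map b es))\<^sup>2) summable_on tuples E n \<and>
    (\<Sum>\<^sub>\<infinity>es\<in>tuples E n. (S (map b es))\<^sup>2) \<le> c ^ n * (\<Sum>\<^sub>\<infinity>fs\<in>tuples F n. (S fs)\<^sup>2)"
  using S sum
proof (induction n arbitrary: S)
  case 0
  show ?case by simp
next
  case (Suc n)
  define u where "u = (\<lambda>(fs, f). (S (f # fs))\<^sup>2)"
  define v where "v = (\<lambda>(fs, e). (S (b e # fs))\<^sup>2)"
  define w where "w = (\<lambda>(e, es). (S (b e # map b es))\<^sup>2)"
  let ?TF = "tuples F n"
  have "(\<lambda>(f, fs). u (fs, f)) summable_on (F \<times> ?TF)"
    using Suc.prems(2) by (simp add: summable_on_tuples_Suc u_def)
  then have u: "u summable_on (?TF \<times> F)"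
    by (subst summable_on_swap) (simp add: case_prod_unfold)
  have v1: "(\<lambda>e. v (fs, e)) summable_on E \<and> (\<Sum>\<^sub>\<infinity>e\<in>E. v (fs, e)) \<le> c * (\<Sum>\<^sub>\<infinity>f\<in>F. u (fs, f))"
    if "fs \<in> ?TF" for fs
  proof (cases "E = {}")
    case True
    then show ?thesis using c by (auto simp: u_def intro!: mult_nonneg_nonneg infsum_nonneg)
  next
    case False
    then obtain e where "e \<in> E" by blast
    have fs: "fs \<in> tuples (hset K) n" using that tuples_mono[OF F] by blast
    obtain x where "x \<in> hset K" and x: "\<And>z. z \<in> hset K \<Longrightarrow> S (z # fs) = hip K x z"
      using slots_in_head[OF Suc.prems(1) fs b[OF \<open>e \<in> E\<close>]] by blast
    moreover have "(\<lambda>e. v (fs, e)) summable_on E \<longleftrightarrow> (\<lambda>e. (hip K x (b e))\<^sup>2) summable_on E"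
      by (rule summable_on_cong) (simp add: v_def x b)
    moreover have "(\<Sum>\<^sub>\<infinity>e\<in>E. v (fs, e)) = (\<Sum>\<^sub>\<infinity>e\<in>E. (hip K x (b e))\<^sup>2)"
      by (rule infsum_cong) (simp add: v_def x b)
    moreover have "(\<Sum>\<^sub>\<infinity>f\<in>F. u (fs, f)) = (\<Sum>\<^sub>\<infinity>f\<in>F. (hip K x f)\<^sup>2)"
      using F by (intro infsum_cong) (auto simp: u_def x subset_iff)
    ultimately show ?thesis using sumE bes by simp
  qed
  have v0: "v (fs, e) \<ge> 0" for fs e by (simp add: v_def)
  have v: "v summable_on (?TF \<times> E)" and v_le: "infsum v (?TF \<times> E) \<le> c * infsum u (?TF \<times> F)"
    using summable_Sigma_mono[OF u c, of E v] v1 v0 by auto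
  have v': "(\<lambda>(e, fs). v (fs, e)) summable_on (E \<times> ?TF)"
    using v by (subst summable_on_swap) (simp add: case_prod_unfold)
  have w1: "(\<lambda>es. w (e, es)) summable_on tuples E n \<and>
      (\<Sum>\<^sub>\<infinity>es\<in>tuples E n. w (e, es)) \<le> c ^ n * (\<Sum>\<^sub>\<infinity>fs\<in>?TF. v (fs, e))" if e: "e \<in> E" for e
  proof -
    have "slots_in K (hset K) n (\<lambda>fs. S (b e # fs))" using slots_in_Cons[OF Suc.prems(1) b[OF e]] .
    moreover have "(\<lambda>fs. (S (b e # fs))\<^sup>2) summable_on ?TF"
      using summable_on_SigmaD1[of "\<lambda>e fs. v (fs, e)" E "\<lambda>_. ?TF" e] v' e by (simp add: v_def)
    ultimately show ?thesis using Suc.IH[of "\<lambda>fs. S (b e # fs)"] by (simp add: w_def v_def)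
  qed
  have w0: "w (e, es) \<ge> 0" for e es by (simp add: w_def)
  have cn: "c ^ n \<ge> 0" using c by simp
  have w: "w summable_on (E \<times> tuples E n)"
    and w_le: "infsum w (E \<times> tuples E n) \<le> c ^ n * infsum (\<lambda>(e, fs). v (fs, e)) (E \<times> ?TF)"
    using summable_Sigma_mono[OF v' cn, of "tuples E n" w] w1 w0 by auto
  have "(\<lambda>es. (S (map b es))\<^sup>2) summable_on tuples E (Suc n)"
    using w by (simp add: summable_on_tuples_Suc w_def)
  moreover have "(\<Sum>\<^sub>\<infinity>es\<in>tuples E (Suc n). (S (map b es))\<^sup>2) = infsum w (E \<times> tuples E n)"
    by (simp add: infsum_tuples_Suc w_def)
  moreover have "(\<Sum>\<^sub>\<infinity>fs\<in>tuples F (Suc n). (S fs)\<^sup>2) = infsum u (?TF \<times> F)"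
    using infsum_swap_pairs[of u F ?TF] by (simp add: infsum_tuples_Suc u_def case_prod_unfold)
  moreover have "c ^ n * infsum (\<lambda>(e, fs). v (fs, e)) (E \<times> ?TF) \<le> c ^ n * (c * infsum u (?TF \<times> F))"
    using v_le cn infsum_swap_pairs[of v E ?TF] by (intro mult_left_mono) auto
  ultimately show ?case using w_le by (simp add: mult_ac)
qed


section \<open>Hilbert tensor powers\<close>

lemma sum_fun_apply: "(\<Sum>i\<in>I. f i) x = (\<Sum>i\<in>I. f i x)"
  by (induction I rule: infinite_finite_induct) simp_all

lemma has_sum_finite_sum:
  fixes f :: "'i \<Rightarrow> 'a \<Rightarrow> real"
  assumes "\<And>i. i \<in> I \<Longrightarrow> f i summable_on A"
  shows "((\<lambda>x. \<Sum>i\<in>I. f i x) has_sum (\<Sum>i\<in>I. infsum (f i) A)) A"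
  using assms
proof (induction I rule: infinite_finite_induct)
  case (insert i I)
  then show ?case using has_sum_add[OF has_sum_infsum[of "f i" A]] by simp
qed simp_all

lemmas infsum_finite_sum = infsumI[OF has_sum_finite_sum]
  and summable_on_finite_sum = has_sum_imp_summable[OF has_sum_finite_sum]

lemma has_sum_diff_real:
  fixes f g :: "'a \<Rightarrow> real"
  assumes "f summable_on A" "g summable_on A"
  shows "((\<lambda>x. f x - g x) has_sum (infsum f A - infsum g A)) A"
  using has_sum_add[OF has_sum_infsum[OF assms(1)] has_sum_uminusI[OF has_sum_infsum[OF assms(2)]]] by simp

lemma square_summable_add:
  fixes f g :: "'a \<Rightarrow> real"
  assumes f: "(\<lambda>x. (f x)\<^sup>2) summable_on A" and g: "(\<lambda>x. (g x)\<^sup>2) summable_on A"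
  shows "(\<lambda>x. (f x + g x)\<^sup>2) summable_on A"
proof (rule summable_on_comparison_test)
  show "(\<lambda>x. 2 * (f x)\<^sup>2 + 2 * (g x)\<^sup>2) summable_on A"
    by (intro summable_on_add summable_on_cmult_right f g)
  show "(f x + g x)\<^sup>2 \<le> 2 * (f x)\<^sup>2 + 2 * (g x)\<^sup>2" for x
    using zero_le_power2[of "f x - g x"] by (simp add: power2_sum power2_diff)
qed simp

lemma square_summable_mult:
  fixes f g :: "'a \<Rightarrow> real"
  assumes f: "(\<lambda>x. (f x)\<^sup>2) summable_on A" and g: "(\<lambda>x. (g x)\<^sup>2) summable_on A"
  shows "(\<lambda>x. f x * g x) summable_on A"
proof -
  have "(\<lambda>x. (f x + g x)\<^sup>2 - (f x)\<^sup>2) summable_on A"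
    by (rule has_sum_imp_summable[OF has_sum_diff_real[OF square_summable_add[OF f g] f]])
  from has_sum_imp_summable[OF has_sum_diff_real[OF this g]]
  have "(\<lambda>x. (1/2) * ((f x + g x)\<^sup>2 - (f x)\<^sup>2 - (g x)\<^sup>2)) summable_on A"
    by (rule summable_on_cmult_right)
  then show ?thesis by (simp add: power2_sum)
qed

lemma hset_tensor_power:
  "S \<in> hset (tensor_power K n) \<longleftrightarrow> multilinear_form K n S \<and> bounded_form K n S \<and>
     (\<lambda>es. (S es)\<^sup>2) summable_on tuples (some_basis K) n"
  by (simp add: tensor_power_def)

lemma hip_tensor_power:
  "hip (tensor_power K n) S R = (\<Sum>\<^sub>\<infinity>es\<in>tuples (some_basis K) n. S es * R es)"
  by (simp add: tensor_power_def)

lemma multilinear_form_off: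
  "S \<in> hset (tensor_power K n) \<Longrightarrow> ys \<notin> tuples (hset K) n \<Longrightarrow> S ys = 0"
  by (simp add: hset_tensor_power multilinear_form_def)

lemma multilinear_form_add:
  "multilinear_form K n S \<Longrightarrow> multilinear_form K n R \<Longrightarrow> multilinear_form K n (S + R)"
  by (simp add: multilinear_form_def algebra_simps)

lemma multilinear_form_scale: "multilinear_form K n S \<Longrightarrow> multilinear_form K n (c *\<^sub>R S)"
  by (simp add: multilinear_form_def algebra_simps)

lemma bounded_form_add:
  assumes "bounded_form K n S" "bounded_form K n R"
  shows "bounded_form K n (S + R)"
proof -
  obtain C where C: "\<forall>xs\<in>tuples (hset K) n. \<bar>S xs\<bar> \<le> C * prod_list (map (hnorm K) xs)"
    using assms(1) unfolding bounded_form_def by blast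
  obtain D where D: "\<forall>xs\<in>tuples (hset K) n. \<bar>R xs\<bar> \<le> D * prod_list (map (hnorm K) xs)"
    using assms(2) unfolding bounded_form_def by blast
  have "\<bar>(S + R) xs\<bar> \<le> (C + D) * prod_list (map (hnorm K) xs)" if "xs \<in> tuples (hset K) n" for xs
    using C[rule_format, OF that] D[rule_format, OF that] by (simp add: distrib_right)
  then show ?thesis unfolding bounded_form_def by blast
qed

lemma bounded_form_scale:
  assumes "bounded_form K n S"
  shows "bounded_form K n (c *\<^sub>R S)"
proof -
  obtain C where C: "\<forall>xs\<in>tuples (hset K) n. \<bar>S xs\<bar> \<le> C * prod_list (map (hnorm K) xs)"
    using assms(1) unfolding bounded_form_def by blast
  have "\<bar>(c *\<^sub>R S) xs\<bar> \<le> (\<bar>c\<bar> * C) * prod_list (map (hnorm K) xs)" if "xs \<in> tuples (hset K) n" for xs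
    using mult_left_mono[OF C[rule_format, OF that], of "\<bar>c\<bar>"] by (simp add: abs_mult mult.assoc)
  then show ?thesis unfolding bounded_form_def by blast
qed

lemma zero_form_in_tensor_power: "0 \<in> hset (tensor_power K n)"
  by (auto simp: hset_tensor_power multilinear_form_def bounded_form_def intro: exI[of _ 0])

lemma subspace_tensor_power: "subspace (hset (tensor_power K n))"
  unfolding subspace_def
proof (intro conjI ballI allI)
  show "0 \<in> hset (tensor_power K n)" by (rule zero_form_in_tensor_power)
  fix S assume S: "S \<in> hset (tensor_power K n)"
  show "S + R \<in> hset (tensor_power K n)" if "R \<in> hset (tensor_power K n)" for R
    using S that by (simp add: hset_tensor_power multilinear_form_add bounded_form_add square_summable_add)
  show "c *\<^sub>R S \<in> hset (tensor_power K n)" for c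
    using S by (simp add: hset_tensor_power multilinear_form_scale bounded_form_scale
        power_mult_distrib summable_on_cmult_right)
qed

lemma multilinear_form_tensor:
  assumes S: "multilinear_form K i S" and R: "multilinear_form K j R"
  shows "multilinear_form K (i + j) (tensor i S R)"
  unfolding multilinear_form_def
proof (intro conjI allI impI ballI)
  fix ys assume "ys \<notin> tuples (hset K) (i + j)"
  then show "tensor i S R ys = 0"
    using multilinear_formD(1)[OF S] multilinear_formD(1)[OF R] by (auto simp: tensor_def tuples_add_iff)
next
  fix ys k x y a b
  assume ys: "ys \<in> tuples (hset K) (i + j)" and k: "k < i + j" and xy: "x \<in> hset K" "y \<in> hset K"
  have t: "take i ys \<in> tuples (hset K) i" and d: "drop i ys \<in> tuples (hset K) j"
    using ys by (auto simp: tuples_add_iff)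
  show "tensor i S R (ys[k := a *\<^sub>R x + b *\<^sub>R y]) =
      a * tensor i S R (ys[k := x]) + b * tensor i S R (ys[k := y])"
  proof (cases "k < i")
    case True
    then show ?thesis
      using multilinear_formD(2)[OF S t True xy]
      by (simp add: tensor_def take_update_swap drop_update_cancel algebra_simps)
  next
    case False
    then have "k - i < j" using k by simp
    from multilinear_formD(2)[OF R d this xy] show ?thesis
      using False by (simp add: tensor_def drop_update_swap algebra_simps)
  qed
qed

lemma bounded_form_tensor:
  assumes S: "bounded_form K i S" and R: "bounded_form K j R"
  shows "bounded_form K (i + j) (tensor i S R)"
proof -
  obtain C where C: "\<forall>xs\<in>tuples (hset K) i. \<bar>S xs\<bar> \<le> C * prod_list (map (hnorm K) xs)"
    using S unfolding bounded_form_def by blast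
  obtain D where D: "\<forall>xs\<in>tuples (hset K) j. \<bar>R xs\<bar> \<le> D * prod_list (map (hnorm K) xs)"
    using R unfolding bounded_form_def by blast
  have "\<bar>tensor i S R xs\<bar> \<le> (C * D) * prod_list (map (hnorm K) xs)" if xs: "xs \<in> tuples (hset K) (i + j)" for xs
  proof -
    let ?t = "prod_list (map (hnorm K) (take i xs))" and ?d = "prod_list (map (hnorm K) (drop i xs))"
    have t: "\<bar>S (take i xs)\<bar> \<le> C * ?t" and d: "\<bar>R (drop i xs)\<bar> \<le> D * ?d"
      using C D xs by (auto simp: tuples_add_iff)
    have "\<bar>tensor i S R xs\<bar> \<le> (C * ?t) * (D * ?d)"
      unfolding tensor_def abs_mult using t d by (intro mult_mono) (auto intro: order_trans[OF abs_ge_zero])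
    also have "\<dots> = (C * D) * (?t * ?d)" by simp
    also have "?t * ?d = prod_list (map (hnorm K) xs)"
      by (metis append_take_drop_id map_append prod_list.append)
    finally show ?thesis .
  qed
  then show ?thesis unfolding bounded_form_def by blast
qed

lemma infsum_tuples_product:
  fixes f g :: "'a list \<Rightarrow> real"
  assumes f: "f summable_on tuples A i" and g: "g summable_on tuples A j"
    and f0: "\<And>xs. f xs \<ge> 0" and g0: "\<And>xs. g xs \<ge> 0"
  shows "((\<lambda>ys. f (take i ys) * g (drop i ys)) has_sum (infsum f (tuples A i) * infsum g (tuples A j)))
     (tuples A (i + j))"
proof -
  let ?h = "\<lambda>(xs, ys). f xs * g ys"
  have inner: "((\<lambda>ys. ?h (xs, ys)) has_sum f xs * infsum g (tuples A j)) (tuples A j)" for xs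
    using has_sum_cmult_right[OF has_sum_infsum[OF g], of "f xs"] by simp
  have outer: "((\<lambda>xs. f xs * infsum g (tuples A j)) has_sum (infsum f (tuples A i) * infsum g (tuples A j))) (tuples A i)"
    by (rule has_sum_cmult_left[OF has_sum_infsum[OF f]])
  have "?h summable_on (tuples A i \<times> tuples A j)"
    by (rule summable_on_SigmaI[OF inner]) (use outer f0 g0 in \<open>auto intro: has_sum_imp_summable\<close>)
  then have "(?h has_sum (infsum f (tuples A i) * infsum g (tuples A j))) (tuples A i \<times> tuples A j)"
    by (rule has_sum_SigmaI[OF inner outer])
  moreover have "(((\<lambda>ys. f (take i ys) * g (drop i ys)) \<circ> (\<lambda>(xs, ys). xs @ ys)) has_sum s) (tuples A i \<times> tuples A j)
      \<longleftrightarrow> (?h has_sum s) (tuples A i \<times> tuples A j)" for s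
    by (rule has_sum_cong) (auto simp: tuples_def)
  ultimately show ?thesis
    unfolding tuples_append by (subst has_sum_reindex[OF inj_on_append_pair]) simp
qed

text \<open>Since tuples of length \<open>i + j\<close> are pairs of tuples, the square sum of \<open>S \<otimes> R\<close> is a product.\<close>

lemma tensor_in_tensor_power:
  assumes S: "S \<in> hset (tensor_power K i)" and R: "R \<in> hset (tensor_power K j)"
  shows "tensor i S R \<in> hset (tensor_power K (i + j))"
    and "hip (tensor_power K (i + j)) (tensor i S R) (tensor i S R) =
      hip (tensor_power K i) S S * hip (tensor_power K j) R R"
proof -
  have sum: "((\<lambda>ys. (S (take i ys))\<^sup>2 * (R (drop i ys))\<^sup>2) has_sum
      (infsum (\<lambda>xs. (S xs)\<^sup>2) (tuples (some_basis K) i) * infsum (\<lambda>ys. (R ys)\<^sup>2) (tuples (some_basis K) j)))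
     (tuples (some_basis K) (i + j))"
    using S R by (intro infsum_tuples_product) (auto simp: hset_tensor_power)
  have eq: "(tensor i S R ys)\<^sup>2 = (S (take i ys))\<^sup>2 * (R (drop i ys))\<^sup>2" for ys
    by (simp add: tensor_def power_mult_distrib)
  show "tensor i S R \<in> hset (tensor_power K (i + j))"
    using S R has_sum_imp_summable[OF sum]
    by (simp add: hset_tensor_power multilinear_form_tensor bounded_form_tensor eq)
  show "hip (tensor_power K (i + j)) (tensor i S R) (tensor i S R) =
      hip (tensor_power K i) S S * hip (tensor_power K j) R R"
    using infsumI[OF sum] eq by (simp add: hip_tensor_power power2_eq_square)
qed

lemma pure_tensor_Nil: "pure_tensor K [] = (\<lambda>ys. if ys = [] then 1 else 0)"
  by (auto simp: pure_tensor_def)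

lemma pure_tensor_Cons: "pure_tensor K (x # xs) = tensor 1 (pure_tensor K [x]) (pure_tensor K xs)"
  using tensor_pure_tensor[of "[x]" K xs] by simp

lemma pure_tensor_single: "pure_tensor K [x] [y] = (if y \<in> hset K then hip K x y else 0)"
  by (simp add: pure_tensor_def tuples_def)

lemma tensor_diff_left: "tensor i (S - S') R = tensor i S R - tensor i S' R"
  by (simp add: tensor_def fun_eq_iff algebra_simps)

lemma tensor_diff_right: "tensor i S (R - R') = tensor i S R - tensor i S R'"
  by (simp add: tensor_def fun_eq_iff algebra_simps)

context hilbert
begin

lemma basis_subset: "some_basis K \<subseteq> hset K"
  using some_basis by (simp add: orthonormal_basis_def)

lemma basis_separates:
  assumes "x \<in> hset K" "\<And>e. e \<in> some_basis K \<Longrightarrow> hip K x e = 0"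
  shows "x = 0"
proof -
  have "((\<lambda>e. (hip K x e)\<^sup>2) has_sum 0) (some_basis K)"
    using assms(2) by (intro has_sum_0) simp
  then have "hip K x x = 0" using parseval[OF some_basis assms(1)] has_sum_unique by blast
  then show ?thesis using assms(1) by (simp add: eq_zero_iff)
qed

lemma tensor_power_slots: "S \<in> hset (tensor_power K n) \<Longrightarrow> slots_in K (hset K) n S"
  by (simp add: hset_tensor_power bounded_form_slots_in)

text \<open>The square sum over the basis tuples is definite because the basis separates vectors.\<close>

lemma ip_space_tensor_power: "ip_space (tensor_power K n)"
proof
  let ?T = "hset (tensor_power K n)" and ?B = "tuples (some_basis K) n"
  have sq: "(\<lambda>es. (S es)\<^sup>2) summable_on ?B" if "S \<in> ?T" for S
    using that by (simp add: hset_tensor_power)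
  have pr: "(\<lambda>es. S es * R es) summable_on ?B" if "S \<in> ?T" "R \<in> ?T" for S R
    using that sq by (intro square_summable_mult) auto
  show "inner_product_space (tensor_power K n)"
    unfolding inner_product_space_def
  proof (intro conjI ballI allI impI)
    show "subspace ?T" by (rule subspace_tensor_power)
    fix S assume S: "S \<in> ?T"
    show "hip (tensor_power K n) S R = hip (tensor_power K n) R S" for R
      by (simp add: hip_tensor_power mult.commute)
    show "hip (tensor_power K n) (S + R) Q = hip (tensor_power K n) S Q + hip (tensor_power K n) R Q"
      if "R \<in> ?T" "Q \<in> ?T" for R Q
      using pr[OF S that(2)] pr[OF that] by (simp add: hip_tensor_power distrib_right infsum_add)
    show "hip (tensor_power K n) (c *\<^sub>R S) R = c * hip (tensor_power K n) S R" if "R \<in> ?T" for c R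
      by (simp add: hip_tensor_power mult.assoc infsum_cmult_right')
    assume "S \<noteq> 0"
    have nn: "hip (tensor_power K n) S S \<ge> 0"
      by (simp add: hip_tensor_power infsum_nonneg)
    have "hip (tensor_power K n) S S \<noteq> 0"
    proof
      assume "hip (tensor_power K n) S S = 0"
      then have "(\<Sum>\<^sub>\<infinity>es\<in>?B. (S es)\<^sup>2) = 0" by (simp add: hip_tensor_power power2_eq_square)
      then have "S es = 0" if "es \<in> ?B" for es
        using nonneg_infsum_le_0D[of "\<lambda>es. (S es)\<^sup>2" ?B es] sq[OF S] that by simp
      then have "S = 0"
        using basis_separates multilinear_form_off[OF S]
        by (intro form_eq_zero[OF basis_subset, where P = "hset K"]) (auto intro: tensor_power_slots[OF S])
      with \<open>S \<noteq> 0\<close> show False ..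
    qed
    with nn show "hip (tensor_power K n) S S > 0" by simp
  qed
qed

sublocale tensor: ip_space "tensor_power K n" for n
  by (rule ip_space_tensor_power)

lemma hnorm_tensor:
  assumes "S \<in> hset (tensor_power K i)" "R \<in> hset (tensor_power K j)"
  shows "hnorm (tensor_power K (i + j)) (tensor i S R) = hnorm (tensor_power K i) S * hnorm (tensor_power K j) R"
  unfolding hnorm_def tensor_in_tensor_power(2)[OF assms] by (rule real_sqrt_mult)

text \<open>Induction splits off the first factor, for which the claim is Parseval's identity.\<close>

lemma pure_tensor_in_tensor_power:
  assumes "xs \<in> tuples (hset K) n"
  shows "pure_tensor K xs \<in> hset (tensor_power K n) \<and>
    hnorm (tensor_power K n) (pure_tensor K xs) = prod_list (map (hnorm K) xs)"
  using assms
proof (induction n arbitrary: xs)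
  case 0
  have "multilinear_form K 0 (pure_tensor K [])"
    by (simp add: multilinear_form_def pure_tensor_Nil)
  moreover have "bounded_form K 0 (pure_tensor K [])"
    by (auto simp: bounded_form_def pure_tensor_Nil intro: exI[of _ 1])
  ultimately show ?case
    using 0 by (simp add: hset_tensor_power hnorm_def hip_tensor_power pure_tensor_Nil)
next
  case (Suc n)
  then obtain y ys where xs: "xs = y # ys" "y \<in> hset K" "ys \<in> tuples (hset K) n"
    by (auto elim: tuples_SucE)
  let ?p = "pure_tensor K [y]"
  have single: "?p [z] = hip K y z" if "z \<in> hset K" for z
    using that by (simp add: pure_tensor_single)
  have one: "zs \<in> tuples A 1 \<longleftrightarrow> (\<exists>z\<in>A. zs = [z])" for zs and A :: "'a set"
    by (cases zs) (auto simp: tuples_def)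
  have "multilinear_form K 1 ?p"
    unfolding multilinear_form_def
  proof (intro conjI allI impI ballI)
    show "?p zs = 0" if "zs \<notin> tuples (hset K) 1" for zs
      using that by (simp add: pure_tensor_def)
    fix zs i u v a b
    assume zs: "zs \<in> tuples (hset K) 1" and "i < (1::nat)" and uv: "u \<in> hset K" "v \<in> hset K"
    obtain z where "zs = [z]" using one[THEN iffD1, OF zs] by blast
    then show "?p (zs[i := a *\<^sub>R u + b *\<^sub>R v]) = a * ?p (zs[i := u]) + b * ?p (zs[i := v])"
      using \<open>i < 1\<close> uv xs(2) by (simp add: pure_tensor_single bilinear)
  qed
  moreover have "bounded_form K 1 ?p"
    unfolding bounded_form_def
  proof (intro exI ballI)
    fix zs assume "zs \<in> tuples (hset K) 1"
    then obtain z where "zs = [z]" "z \<in> hset K" using one[THEN iffD1] by blast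
    then show "\<bar>?p zs\<bar> \<le> hnorm K y * prod_list (map (hnorm K) zs)"
      using cauchy_schwarz[OF xs(2)] by (simp add: single)
  qed
  moreover have sum: "((\<lambda>es. (?p es)\<^sup>2) has_sum hip K y y) (tuples (some_basis K) 1)"
  proof -
    have im: "tuples (some_basis K) 1 = (\<lambda>e. [e]) ` some_basis K" by (auto simp: one simp del: One_nat_def)
    have "((\<lambda>e. (?p [e])\<^sup>2) has_sum hip K y y) (some_basis K) \<longleftrightarrow> ((\<lambda>e. (hip K y e)\<^sup>2) has_sum hip K y y) (some_basis K)"
      using basis_subset by (intro has_sum_cong) (auto simp: single subset_iff)
    then show ?thesis
      unfolding im using parseval[OF some_basis xs(2)]
      by (subst has_sum_reindex) (auto simp: comp_def inj_on_def)
  qed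
  ultimately have p: "?p \<in> hset (tensor_power K 1)"
    using has_sum_imp_summable[OF sum] by (simp add: hset_tensor_power)
  have pn: "hnorm (tensor_power K 1) ?p = hnorm K y"
    using infsumI[OF sum] by (simp add: hnorm_def hip_tensor_power power2_eq_square)
  note IH = Suc.IH[OF xs(3)]
  have "tensor 1 ?p (pure_tensor K ys) \<in> hset (tensor_power K (1 + n))"
    by (rule tensor_in_tensor_power(1)[OF p IH[THEN conjunct1]])
  moreover have "hnorm (tensor_power K (1 + n)) (tensor 1 ?p (pure_tensor K ys)) =
      prod_list (map (hnorm K) xs)"
    using hnorm_tensor[OF p IH[THEN conjunct1]] IH pn xs(1) by simp
  ultimately show ?case
    unfolding xs(1) pure_tensor_Cons[of K y ys] plus_1_eq_Suc ..
qed

lemmas pure_tensor_mem = pure_tensor_in_tensor_power[THEN conjunct1]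
  and hnorm_pure_tensor = pure_tensor_in_tensor_power[THEN conjunct2]

lemma pure_tensor_diff_single:
  assumes "x \<in> hset K" "y \<in> hset K"
  shows "pure_tensor K [x] - pure_tensor K [y] = pure_tensor K [x - y]"
proof
  fix zs
  show "(pure_tensor K [x] - pure_tensor K [y]) zs = pure_tensor K [x - y] zs"
  proof (cases "zs \<in> tuples (hset K) 1")
    case True
    then obtain z where "zs = [z]" "z \<in> hset K" by (cases zs) (auto simp: tuples_def)
    then show ?thesis using assms by (simp add: pure_tensor_single bilinear)
  qed (simp add: pure_tensor_def)
qed

text \<open>The factors are replaced from the last to the first. The error made in a factor is chosen small
  relative to the norm of the tensor by which it gets multiplied.\<close>

lemma pure_tensor_approx:
  assumes D: "D \<subseteq> hset K" and dense: "htop K closure_of D = hset K"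
    and xs: "xs \<in> tuples (hset K) n" and e: "e > 0"
  shows "\<exists>ds\<in>tuples D n. hnorm (tensor_power K n) (pure_tensor K xs - pure_tensor K ds) < e"
  using xs e
proof (induction n arbitrary: xs e)
  case 0
  then show ?case by (simp add: tensor.norm_zero[unfolded zero_fun_def])
next
  case (Suc n)
  then obtain y ys where xs: "xs = y # ys" "y \<in> hset K" "ys \<in> tuples (hset K) n"
    by (auto elim: tuples_SucE)
  let ?N = "\<lambda>n. hnorm (tensor_power K n)" and ?p = "pure_tensor K"
  have yn: "hnorm K y + 1 > 0" using norm_nonneg[OF xs(2)] by linarith
  have "e / (2 * (hnorm K y + 1)) > 0" using Suc.prems(2) yn by simp
  from Suc.IH[OF xs(3) this] obtain ds where ds: "ds \<in> tuples D n"
      and ds_near: "?N n (?p ys - ?p ds) < e / (2 * (hnorm K y + 1))" by blast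
  have dsK: "ds \<in> tuples (hset K) n" using ds tuples_mono[OF D] by blast
  note pd = pure_tensor_mem[OF dsK] and py = pure_tensor_mem[OF xs(3)]
  have dn: "?N n (?p ds) + 1 > 0" using tensor.norm_nonneg[OF pd] by linarith
  have "e / (2 * (?N n (?p ds) + 1)) > 0" using Suc.prems(2) dn by simp
  then obtain d where d: "d \<in> D" "hnorm K (y - d) < e / (2 * (?N n (?p ds) + 1))"
    using dense xs(2) unfolding closure_of_htop by blast
  have dK: "d \<in> hset K" using d D by blast
  have y1: "[y] \<in> tuples (hset K) 1" and yd1: "[y - d] \<in> tuples (hset K) 1"
    using xs(2) dK by (auto simp: tuples_def)
  have n1: "?N 1 (?p [y]) = hnorm K y" "?N 1 (?p [y - d]) = hnorm K (y - d)"
    using hnorm_pure_tensor[OF y1] hnorm_pure_tensor[OF yd1] by simp_all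
  have split: "?p xs - ?p (d # ds) = tensor 1 (?p [y]) (?p ys - ?p ds) + tensor 1 (?p [y - d]) (?p ds)"
    unfolding xs(1) pure_tensor_Cons[of K y ys] pure_tensor_Cons[of K d ds]
    by (simp add: tensor_diff_right tensor_diff_left pure_tensor_diff_single[OF xs(2) dK, symmetric])
  have Suc1: "Suc n = 1 + n" by simp
  have mem: "tensor 1 (?p [y]) (?p ys - ?p ds) \<in> hset (tensor_power K (Suc n))"
    "tensor 1 (?p [y - d]) (?p ds) \<in> hset (tensor_power K (Suc n))"
    unfolding Suc1
    by (intro tensor_in_tensor_power(1) tensor.mem_diff pure_tensor_mem[OF y1] pure_tensor_mem[OF yd1] py pd)+
  have "?N (Suc n) (?p xs - ?p (d # ds)) \<le>
      ?N (1 + n) (tensor 1 (?p [y]) (?p ys - ?p ds)) + ?N (1 + n) (tensor 1 (?p [y - d]) (?p ds))"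
    unfolding split using tensor.norm_triangle[OF mem] by simp
  also have "\<dots> = hnorm K y * ?N n (?p ys - ?p ds) + hnorm K (y - d) * ?N n (?p ds)"
    using pure_tensor_mem[OF y1] pure_tensor_mem[OF yd1] py pd n1 by (simp add: hnorm_tensor del: One_nat_def)
  also have "\<dots> \<le> (hnorm K y + 1) * ?N n (?p ys - ?p ds) + hnorm K (y - d) * (?N n (?p ds) + 1)"
    using py pd xs(2) dK by (intro add_mono mult_mono) auto
  also have "\<dots> < e / 2 + e / 2"
    using ds_near d(2) yn dn by (intro add_strict_mono) (simp_all add: field_simps)
  finally have "?N (Suc n) (?p xs - ?p (d # ds)) < e" by simp
  moreover have "d # ds \<in> tuples D (Suc n)" using ds d(1) by simp
  ultimately show ?case by blast
qed

text \<open>On the basis tuples the difference has the values of \<open>S\<close> outside \<open>E\<close> and zero on \<open>E\<close>.\<close>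

lemma finite_basis_approx:
  assumes S: "S \<in> hset (tensor_power K n)" and e: "e > 0"
  obtains E where "finite E" "E \<subseteq> tuples (some_basis K) n"
    "hnorm (tensor_power K n) (S - (\<Sum>es\<in>E. S es *\<^sub>R pure_tensor K es)) < e"
proof -
  let ?B = "tuples (some_basis K) n"
  have on: "hip K x y = (if x = y then 1 else 0)" if "x \<in> some_basis K" "y \<in> some_basis K" for x y
    using some_basis that unfolding orthonormal_basis_def by blast
  have BK: "es \<in> tuples (hset K) n" if "es \<in> ?B" for es
    using that tuples_mono[OF basis_subset] by blast
  have p: "pure_tensor K es fs = (if es = fs then 1 else 0)" if es: "es \<in> ?B" and fs: "fs \<in> ?B" for es fs
  proof -
    have len: "length es = n" "length fs = n" using es fs by (auto simp: tuples_def)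
    have "pure_tensor K es fs = (\<Prod>i<n. hip K (es ! i) (fs ! i))"
      using BK[OF fs] len by (simp add: pure_tensor_def)
    also have "\<dots> = (\<Prod>i<n. if es ! i = fs ! i then 1 else 0)"
      using es fs len by (intro prod.cong refl on) (auto simp: tuples_def subset_iff)
    also have "\<dots> = (if \<forall>i<n. es ! i = fs ! i then 1 else 0)" by (auto intro!: prod_zero)
    also have "(\<forall>i<n. es ! i = fs ! i) \<longleftrightarrow> es = fs" using len by (auto simp: list_eq_iff_nth_eq)
    finally show ?thesis .
  qed
  have sq: "(\<lambda>es. (S es)\<^sup>2) summable_on ?B" using S by (simp add: hset_tensor_power)
  obtain E where E: "finite E" "E \<subseteq> ?B"
    and near: "dist (\<Sum>es\<in>E. (S es)\<^sup>2) (\<Sum>\<^sub>\<infinity>es\<in>?B. (S es)\<^sup>2) < e\<^sup>2"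
    using has_sum_infsum[OF sq] e zero_less_power[OF e, of 2]
    unfolding has_sum_def tendsto_iff eventually_finite_subsets_at_top by blast
  let ?A = "\<Sum>es\<in>E. S es *\<^sub>R pure_tensor K es"
  have A: "?A \<in> hset (tensor_power K n)"
    using E BK by (intro tensor.mem_sum tensor.mem_scale pure_tensor_mem) auto
  have Af: "?A fs = (if fs \<in> E then S fs else 0)" if fs: "fs \<in> ?B" for fs
  proof -
    have "?A fs = (\<Sum>es\<in>E. if es = fs then S es else 0)"
      unfolding sum_fun_apply scaleR_fun_apply using E p[OF _ fs] by (intro sum.cong) auto
    then show ?thesis using E by simp
  qed
  have "hip (tensor_power K n) (S - ?A) (S - ?A) = (\<Sum>\<^sub>\<infinity>fs\<in>?B. (S fs)\<^sup>2 - (if fs \<in> E then (S fs)\<^sup>2 else 0))"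
    unfolding hip_tensor_power by (rule infsum_cong) (simp add: Af power2_eq_square)
  also have "\<dots> = (\<Sum>\<^sub>\<infinity>fs\<in>?B. (S fs)\<^sup>2) - (\<Sum>\<^sub>\<infinity>fs\<in>?B. if fs \<in> E then (S fs)\<^sup>2 else 0)"
  proof (rule infsumI[OF has_sum_diff_real[OF sq]])
    have "(\<lambda>fs. if fs \<in> E then (S fs)\<^sup>2 else 0) summable_on E \<longleftrightarrow> (\<lambda>fs. if fs \<in> E then (S fs)\<^sup>2 else 0) summable_on ?B"
      using E by (intro summable_on_cong_neutral) auto
    then show "(\<lambda>fs. if fs \<in> E then (S fs)\<^sup>2 else 0) summable_on ?B" using E by simp
  qed
  also have "(\<Sum>\<^sub>\<infinity>fs\<in>?B. if fs \<in> E then (S fs)\<^sup>2 else 0) = (\<Sum>\<^sub>\<infinity>fs\<in>E. (S fs)\<^sup>2)"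
    using E by (intro infsum_cong_neutral) auto
  also have "\<dots> = (\<Sum>fs\<in>E. (S fs)\<^sup>2)" using E by simp
  finally have "hip (tensor_power K n) (S - ?A) (S - ?A) < e\<^sup>2"
    using near unfolding dist_real_def by linarith
  then have "hnorm (tensor_power K n) (S - ?A) < e"
    using e real_sqrt_less_mono by (fastforce simp: hnorm_def)
  with E show thesis by (rule that)
qed

end


section \<open>Inversions of permutations\<close>

text \<open>On the subsets of an \<open>N\<close>-element set the kernel \<open>q\<close> to the power \<open>card (A \<triangle> B)\<close> is the
  \<open>N\<close>-fold tensor power of the matrix with diagonal entries \<open>1\<close> and off-diagonal entries \<open>q\<close>,
  whose smallest eigenvalue is \<open>1 - \<bar>q\<bar>\<close>.\<close>

lemma symmetric_difference_kernel_ge: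
  fixes c :: "'a set \<Rightarrow> real"
  assumes q: "\<bar>q\<bar> < 1" and X: "finite X"
  shows "(1 - \<bar>q\<bar>) ^ card X * (\<Sum>A\<in>Pow X. (c A)\<^sup>2) \<le>
    (\<Sum>A\<in>Pow X. \<Sum>B\<in>Pow X. q ^ card ((A - B) \<union> (B - A)) * (c A * c B))"
  using X
proof (induction X arbitrary: c rule: finite_induct)
  case empty
  then show ?case by (simp add: power2_eq_square)
next
  case (insert x X)
  define k where "k A B = q ^ card ((A - B) \<union> (B - A))" for A B :: "'a set"
  define Q where "Q c d = (\<Sum>A\<in>Pow X. \<Sum>B\<in>Pow X. k A B * (c A * d B))" for c d :: "'a set \<Rightarrow> real"
  define d where "d A = c (insert x A)" for A
  define m where "m = (1 - \<bar>q\<bar>) ^ card X"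
  have m: "m \<ge> 0" using q by (simp add: m_def)
  have IH: "m * (\<Sum>A\<in>Pow X. (c A)\<^sup>2) \<le> Q c c" for c
    using insert.IH unfolding Q_def k_def m_def by blast
  then have Q0: "Q c c \<ge> 0" for c
    using m by (meson order_trans mult_nonneg_nonneg sum_nonneg zero_le_power2)
  have k_sym: "k A B = k B A" for A B by (simp add: k_def Un_commute)
  have Q_sym: "Q c d = Q d c" for c d
    unfolding Q_def by (subst sum.swap) (simp add: k_sym mult_ac)
  have Q_add: "Q (\<lambda>A. c A + s * d A) (\<lambda>A. c A + s * d A) = Q c c + 2 * s * Q c d + s\<^sup>2 * Q d d" for s c d
  proof -
    have "Q (\<lambda>A. c A + s * d A) (\<lambda>A. c A + s * d A) = Q c c + s * Q c d + s * Q d c + s\<^sup>2 * Q d d"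
      by (simp add: Q_def algebra_simps sum.distrib sum_distrib_left power2_eq_square)
    then show ?thesis by (simp add: Q_sym[of d c])
  qed
  have cd: "\<bar>2 * Q c d\<bar> \<le> Q c c + Q d d"
    using Q0[of "\<lambda>A. c A + 1 * d A"] Q0[of "\<lambda>A. c A + (-1) * d A"] unfolding Q_add by simp
  have split: "sum f (Pow (insert x X)) = (\<Sum>A\<in>Pow X. f A + f (insert x A))" for f :: "'a set \<Rightarrow> real"
  proof -
    have "sum f (Pow (insert x X)) = sum f (Pow X) + sum f (insert x ` Pow X)"
      unfolding Pow_insert using insert.hyps by (intro sum.union_disjoint) auto
    also have "sum f (insert x ` Pow X) = (\<Sum>A\<in>Pow X. f (insert x A))"
    proof -
      have "inj_on (insert x) (Pow X)"
        using insert.hyps(2) by (intro inj_onI) (metis Pow_iff insert_ident subsetD)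
      then show ?thesis by (simp add: sum.reindex)
    qed
    finally show ?thesis by (simp add: sum.distrib)
  qed
  have k1: "k (insert x A) (insert x B) = k A B" "k (insert x A) B = q * k A B" "k A (insert x B) = q * k A B"
    if "A \<in> Pow X" "B \<in> Pow X" for A B
  proof -
    have x: "x \<notin> A" "x \<notin> B" using that insert.hyps by auto
    have fin: "finite ((A - B) \<union> (B - A))" using that insert.hyps finite_subset by blast
    have xn: "x \<notin> (A - B) \<union> (B - A)" using x by blast
    have "(insert x A - insert x B) \<union> (insert x B - insert x A) = (A - B) \<union> (B - A)"
      "(insert x A - B) \<union> (B - insert x A) = insert x ((A - B) \<union> (B - A))"
      "(A - insert x B) \<union> (insert x B - A) = insert x ((A - B) \<union> (B - A))"
      using x by blast+
    then show "k (insert x A) (insert x B) = k A B" "k (insert x A) B = q * k A B" "k A (insert x B) = q * k A B"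
      by (simp_all add: k_def card_insert_disjoint[OF fin xn])
  qed
  have "(\<Sum>A\<in>Pow (insert x X). \<Sum>B\<in>Pow (insert x X). k A B * (c A * c B)) =
      (\<Sum>A\<in>Pow X. \<Sum>B\<in>Pow X. k A B * (c A * c B) + q * (k A B * (c A * d B))
         + q * (k A B * (d A * c B)) + k A B * (d A * d B))"
    unfolding split sum.distrib[symmetric] by (intro sum.cong refl) (simp add: k1 d_def)
  also have "\<dots> = Q c c + q * Q c d + q * Q d c + Q d d"
    by (simp add: Q_def sum.distrib sum_distrib_left)
  also have "\<dots> = Q c c + Q d d + q * (2 * Q c d)" by (simp add: Q_sym[of d c])
  also have "\<dots> \<ge> (1 - \<bar>q\<bar>) * (Q c c + Q d d)"
  proof -
    have "\<bar>q * (2 * Q c d)\<bar> \<le> \<bar>q\<bar> * (Q c c + Q d d)"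
      unfolding abs_mult[of q] using cd by (intro mult_left_mono) auto
    then show ?thesis by (simp add: algebra_simps abs_le_iff)
  qed
  finally have "(1 - \<bar>q\<bar>) * (Q c c + Q d d) \<le>
      (\<Sum>A\<in>Pow (insert x X). \<Sum>B\<in>Pow (insert x X). k A B * (c A * c B))" .
  moreover have "(1 - \<bar>q\<bar>) ^ card (insert x X) * (\<Sum>A\<in>Pow (insert x X). (c A)\<^sup>2) \<le> (1 - \<bar>q\<bar>) * (Q c c + Q d d)"
  proof -
    have "(1 - \<bar>q\<bar>) ^ card (insert x X) * (\<Sum>A\<in>Pow (insert x X). (c A)\<^sup>2)
        = (1 - \<bar>q\<bar>) * (m * (\<Sum>A\<in>Pow X. (c A)\<^sup>2) + m * (\<Sum>A\<in>Pow X. (d A)\<^sup>2))"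
      using insert.hyps unfolding split by (simp add: m_def d_def sum.distrib algebra_simps)
    also have "\<dots> \<le> (1 - \<bar>q\<bar>) * (Q c c + Q d d)"
      using IH[of c] IH[of d] q by (intro mult_left_mono add_mono) auto
    finally show ?thesis .
  qed
  ultimately show ?case unfolding k_def by linarith
qed

definition inversion_set :: "nat \<Rightarrow> (nat \<Rightarrow> nat) \<Rightarrow> (nat \<times> nat) set"
  where "inversion_set n \<pi> = {(i, j). i < j \<and> j < n \<and> \<pi> i > \<pi> j}"

lemma inversions_card: "inversions n \<pi> = card (inversion_set n \<pi>)"
  by (simp add: inversions_def inversion_set_def)

lemma inversion_set_subset: "inversion_set n \<pi> \<subseteq> {..<n} \<times> {..<n}"
  by (auto simp: inversion_set_def)

definition lehmer_code :: "nat \<Rightarrow> (nat \<Rightarrow> nat) \<Rightarrow> nat \<Rightarrow> nat"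
  where "lehmer_code n \<pi> i = card {j. i < j \<and> j < n \<and> \<pi> j < \<pi> i}"

lemma inversions_eq_sum_lehmer_code: "inversions n \<pi> = (\<Sum>i<n. lehmer_code n \<pi> i)"
proof -
  have "inversion_set n \<pi> = Sigma {..<n} (\<lambda>i. {j. i < j \<and> j < n \<and> \<pi> j < \<pi> i})"
    by (auto simp: inversion_set_def)
  then show ?thesis by (simp add: inversions_card lehmer_code_def card_SigmaI)
qed

lemma lehmer_code_less: "i < n \<Longrightarrow> lehmer_code n \<pi> i < n"
proof -
  assume "i < n"
  then have "{j. i < j \<and> j < n \<and> \<pi> j < \<pi> i} \<subset> {..<n}" by auto
  from psubset_card_mono[OF _ this] show ?thesis by (simp add: lehmer_code_def)
qed

text \<open>The code determines \<open>\<pi> i\<close> among the values not yet taken by \<open>\<pi> 0, \<dots>, \<pi> (i - 1)\<close>.\<close>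

lemma lehmer_code_inj:
  assumes p: "\<pi> permutes {..<n}" and s: "\<sigma> permutes {..<n}"
    and eq: "\<And>i. i < n \<Longrightarrow> lehmer_code n \<pi> i = lehmer_code n \<sigma> i"
  shows "\<pi> = \<sigma>"
proof -
  have code: "lehmer_code n \<rho> i = card {v \<in> {..<n} - \<rho> ` {..<i}. v < \<rho> i}"
    if r: "\<rho> permutes {..<n}" and i: "i < n" for \<rho> i
  proof -
    have im: "\<rho> ` {j. i < j \<and> j < n \<and> \<rho> j < \<rho> i} = {v \<in> {..<n} - \<rho> ` {..<i}. v < \<rho> i}"
    proof (intro equalityI subsetI)
      fix v assume "v \<in> \<rho> ` {j. i < j \<and> j < n \<and> \<rho> j < \<rho> i}"
      then obtain j where j: "i < j" "j < n" "\<rho> j < \<rho> i" "v = \<rho> j" by blast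
      have "\<rho> j < n" using permutes_in_image[OF r, of j] j by simp
      moreover have "\<rho> j \<notin> \<rho> ` {..<i}" using j inj_eq[OF permutes_inj[OF r]] by auto
      ultimately show "v \<in> {v \<in> {..<n} - \<rho> ` {..<i}. v < \<rho> i}" using j by simp
    next
      fix v assume v: "v \<in> {v \<in> {..<n} - \<rho> ` {..<i}. v < \<rho> i}"
      then have "v \<in> \<rho> ` {..<n}" using permutes_image[OF r] by simp
      then obtain j where j: "j < n" "v = \<rho> j" by blast
      moreover have "\<not> j < i" "j \<noteq> i" using v j by auto
      ultimately show "v \<in> \<rho> ` {j. i < j \<and> j < n \<and> \<rho> j < \<rho> i}" using v by force
    qed
    show ?thesis
      unfolding lehmer_code_def im[symmetric]
      by (rule card_image[OF inj_on_subset[OF permutes_inj[OF r] subset_UNIV], symmetric])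
  qed
  have free: "\<rho> i \<in> {..<n} - \<rho> ` {..<i}" if r: "\<rho> permutes {..<n}" and i: "i < n" for \<rho> i
    using permutes_in_image[OF r, of i] inj_eq[OF permutes_inj[OF r]] i by auto
  have strict: "card {v \<in> R. v < a} < card {v \<in> R. v < b}" if "finite R" "a \<in> R" "a < b" for R and a b :: nat
    using that by (intro psubset_card_mono) (auto intro: less_trans)
  have "\<pi> i = \<sigma> i" if "i < n" for i
    using that
  proof (induction i rule: less_induct)
    case (less i)
    then have im: "\<pi> ` {..<i} = \<sigma> ` {..<i}" by (intro image_cong) auto
    let ?R = "{..<n} - \<sigma> ` {..<i}"
    have cards: "card {v \<in> ?R. v < \<pi> i} = card {v \<in> ?R. v < \<sigma> i}"
      using eq[OF less.prems] code[OF p less.prems] code[OF s less.prems] im by simp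
    have mem: "\<pi> i \<in> ?R" "\<sigma> i \<in> ?R" using free[OF p less.prems] free[OF s less.prems] im by simp_all
    have "\<not> \<pi> i < \<sigma> i" using cards strict[of ?R "\<pi> i" "\<sigma> i"] mem(1) by auto
    moreover have "\<not> \<sigma> i < \<pi> i" using cards strict[of ?R "\<sigma> i" "\<pi> i"] mem(2) by auto
    ultimately show ?case by simp
  qed
  then show ?thesis using permutes_not_in[OF p] permutes_not_in[OF s] by (intro ext) (metis lessThan_iff)
qed

lemma inversion_set_inj: "inj_on (inversion_set n) {\<pi>. \<pi> permutes {..<n}}"
proof (rule inj_onI, unfold mem_Collect_eq)
  fix \<pi> \<sigma> assume p: "\<pi> permutes {..<n}" and s: "\<sigma> permutes {..<n}" and eq: "inversion_set n \<pi> = inversion_set n \<sigma>"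
  have "{j. i < j \<and> j < n \<and> \<rho> j < \<rho> i} = {j. (i, j) \<in> inversion_set n \<rho>}" for \<rho> i
    by (auto simp: inversion_set_def)
  then have "lehmer_code n \<pi> i = lehmer_code n \<sigma> i" for i by (simp add: lehmer_code_def eq)
  then show "\<pi> = \<sigma>" by (rule lehmer_code_inj[OF p s])
qed

text \<open>Summing over all codes instead of those of permutations gives a power of a geometric sum.\<close>

lemma sum_power_inversions_le:
  fixes t :: real
  assumes t: "0 \<le> t" "t < 1"
  shows "(\<Sum>\<pi> | \<pi> permutes {..<n}. t ^ inversions n \<pi>) \<le> (1 / (1 - t)) ^ n"
proof -
  let ?P = "{\<pi>. \<pi> permutes {..<n}}" and ?C = "Pi\<^sub>E {..<n} (\<lambda>_. {..<n})"
  define code where "code \<pi> = restrict (lehmer_code n \<pi>) {..<n}" for \<pi>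
  have inj: "inj_on code ?P"
  proof (rule inj_onI, unfold mem_Collect_eq)
    fix \<pi> \<sigma> assume p: "\<pi> permutes {..<n}" and s: "\<sigma> permutes {..<n}" and eq: "code \<pi> = code \<sigma>"
    have "lehmer_code n \<pi> i = lehmer_code n \<sigma> i" if "i < n" for i
      using fun_cong[OF eq, of i] that by (simp add: code_def)
    then show "\<pi> = \<sigma>" by (rule lehmer_code_inj[OF p s])
  qed
  have "(\<Sum>\<pi>\<in>?P. t ^ inversions n \<pi>) = (\<Sum>\<pi>\<in>?P. \<Prod>i<n. t ^ code \<pi> i)"
    by (intro sum.cong refl) (simp add: inversions_eq_sum_lehmer_code power_sum code_def)
  also have "\<dots> = (\<Sum>c\<in>code ` ?P. \<Prod>i<n. t ^ c i)" by (simp add: sum.reindex[OF inj])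
  also have "\<dots> \<le> (\<Sum>c\<in>?C. \<Prod>i<n. t ^ c i)"
  proof (rule sum_mono2)
    show "finite ?C" by (simp add: finite_PiE)
    show "code ` ?P \<subseteq> ?C" by (auto simp: code_def lehmer_code_less split: if_splits)
    show "0 \<le> (\<Prod>i<n. t ^ c i)" for c using t by (intro prod_nonneg) simp
  qed
  also have "\<dots> = (\<Prod>i<n. \<Sum>k<n. t ^ k)" by (rule prod_sum_PiE[symmetric]) auto
  also have "\<dots> = (\<Sum>k<n. t ^ k) ^ n" by simp
  also have "\<dots> \<le> (1 / (1 - t)) ^ n"
  proof (rule power_mono)
    have "(\<Sum>k<n. t ^ k) = (1 - t ^ n) / (1 - t)" using t by (simp add: sum_gp_strict)
    also have "\<dots> \<le> 1 / (1 - t)" using t by (intro divide_right_mono) auto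
    finally show "(\<Sum>k<n. t ^ k) \<le> 1 / (1 - t)" .
  qed (use t in \<open>auto intro: sum_nonneg\<close>)
  finally show ?thesis .
qed

text \<open>A pair of positions contributes to the symmetric difference when \<open>\<pi>\<close> and \<open>\<sigma>\<close> order it
  differently; relabelled by \<open>\<sigma>\<close> these are the inversions of \<open>\<pi> \<circ> \<sigma>\<inverse>\<close>.\<close>

lemma card_inversion_set_diff:
  assumes p: "\<pi> permutes {..<n}" and s: "\<sigma> permutes {..<n}"
  shows "card ((inversion_set n \<pi> - inversion_set n \<sigma>) \<union> (inversion_set n \<sigma> - inversion_set n \<pi>))
    = inversions n (\<pi> \<circ> inv \<sigma>)"
proof -
  let ?D = "(inversion_set n \<pi> - inversion_set n \<sigma>) \<union> (inversion_set n \<sigma> - inversion_set n \<pi>)"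
  let ?f = "\<lambda>(i, j). (min (\<sigma> i) (\<sigma> j), max (\<sigma> i) (\<sigma> j))"
  let ?g = "\<lambda>(k, l). (min (inv \<sigma> k) (inv \<sigma> l), max (inv \<sigma> k) (inv \<sigma> l))"
  have s': "inv \<sigma> permutes {..<n}" by (rule permutes_inv[OF s])
  have ss: "inv \<sigma> (\<sigma> i) = i" "\<sigma> (inv \<sigma> i) = i" for i using permutes_inverses[OF s] by auto
  have less: "\<sigma> i < n \<longleftrightarrow> i < n" "inv \<sigma> i < n \<longleftrightarrow> i < n" for i
    using permutes_in_image[OF s, of i] permutes_in_image[OF s', of i] by auto
  have eq: "\<sigma> i = \<sigma> j \<longleftrightarrow> i = j" "inv \<sigma> i = inv \<sigma> j \<longleftrightarrow> i = j" "\<pi> i = \<pi> j \<longleftrightarrow> i = j" for i j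
    by (rule inj_eq[OF permutes_inj[OF s]] inj_eq[OF permutes_inj[OF s']] inj_eq[OF permutes_inj[OF p]])+
  have D: "(i, j) \<in> ?D \<longleftrightarrow> i < j \<and> j < n \<and> ((\<pi> i > \<pi> j \<and> \<sigma> i < \<sigma> j) \<or> (\<pi> i < \<pi> j \<and> \<sigma> i > \<sigma> j))" for i j
    using eq[of i j] by (auto simp: inversion_set_def)
  have I: "(k, l) \<in> inversion_set n (\<pi> \<circ> inv \<sigma>) \<longleftrightarrow> k < l \<and> l < n \<and> \<pi> (inv \<sigma> k) > \<pi> (inv \<sigma> l)" for k l
    by (auto simp: inversion_set_def)
  have "bij_betw ?f ?D (inversion_set n (\<pi> \<circ> inv \<sigma>))"
  proof (rule bij_betwI[of _ _ _ ?g])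
    show "?f \<in> ?D \<rightarrow> inversion_set n (\<pi> \<circ> inv \<sigma>)"
    proof
      fix z assume z: "z \<in> ?D"
      obtain i j where [simp]: "z = (i, j)" by fastforce
      have "i < j" "j < n" "(\<pi> i > \<pi> j \<and> \<sigma> i < \<sigma> j) \<or> (\<pi> i < \<pi> j \<and> \<sigma> i > \<sigma> j)" using z D[of i j] by auto
      then show "?f z \<in> inversion_set n (\<pi> \<circ> inv \<sigma>)"
        by (auto simp: I less ss min_def max_def)
    qed
    show "?g \<in> inversion_set n (\<pi> \<circ> inv \<sigma>) \<rightarrow> ?D"
    proof
      fix z assume z: "z \<in> inversion_set n (\<pi> \<circ> inv \<sigma>)"
      obtain k l where [simp]: "z = (k, l)" by fastforce
      have kl: "k < l" "l < n" "\<pi> (inv \<sigma> k) > \<pi> (inv \<sigma> l)" using z I[of k l] by auto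
      then have "inv \<sigma> k < inv \<sigma> l \<or> inv \<sigma> l < inv \<sigma> k" using eq(2)[of k l] by linarith
      then have "(min (inv \<sigma> k) (inv \<sigma> l), max (inv \<sigma> k) (inv \<sigma> l)) \<in> ?D"
        unfolding D using kl by (auto simp: less ss min_def max_def)
      then show "?g z \<in> ?D" by simp
    qed
    show "?g (?f z) = z" if "z \<in> ?D" for z
    proof -
      obtain i j where [simp]: "z = (i, j)" by fastforce
      have "i < j" using that D[of i j] by auto
      then show ?thesis by (auto simp: ss min_def max_def)
    qed
    show "?f (?g z) = z" if "z \<in> inversion_set n (\<pi> \<circ> inv \<sigma>)" for z
    proof -
      obtain k l where [simp]: "z = (k, l)" by fastforce
      have "k < l" using that I[of k l] by auto
      then show ?thesis by (auto simp: ss min_def max_def)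
    qed
  qed
  then show ?thesis unfolding inversions_card by (rule bij_betw_same_card)
qed

lemma inversions_inv:
  assumes "\<pi> permutes {..<n}"
  shows "inversions n (inv \<pi>) = inversions n \<pi>"
proof -
  have "inversion_set n id = {}" by (auto simp: inversion_set_def)
  then show ?thesis
    using card_inversion_set_diff[OF permutes_id assms] by (simp add: inversions_card)
qed

text \<open>Permutations are determined by their inversion sets, so this is a restriction of the kernel on
  subsets.\<close>

lemma inversion_kernel_ge:
  fixes c :: "(nat \<Rightarrow> nat) \<Rightarrow> real"
  assumes q: "\<bar>q\<bar> < 1"
  shows "(1 - \<bar>q\<bar>) ^ (n * n) * (\<Sum>\<pi> | \<pi> permutes {..<n}. (c \<pi>)\<^sup>2) \<le>
    (\<Sum>\<pi> | \<pi> permutes {..<n}. \<Sum>\<sigma> | \<sigma> permutes {..<n}. q ^ inversions n (\<pi> \<circ> inv \<sigma>) * (c \<pi> * c \<sigma>))"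
proof -
  let ?P = "{\<pi>. \<pi> permutes {..<n}}" and ?X = "{..<n} \<times> {..<n}"
  let ?I = "inversion_set n"
  \<comment> \<open>the coefficients \<open>c\<close> as a function of inversion sets, extended by zero to all other subsets\<close>
  define d where "d A = (if A \<in> ?I ` ?P then c (the_inv_into ?P ?I A) else 0)" for A
  have d: "d (?I \<pi>) = c \<pi>" if "\<pi> \<in> ?P" for \<pi>
    using that the_inv_into_f_f[OF inversion_set_inj that] by (simp add: d_def)
  have reindex: "(\<Sum>A\<in>Pow ?X. f A) = (\<Sum>\<pi>\<in>?P. f (?I \<pi>))" if "\<And>A. A \<notin> ?I ` ?P \<Longrightarrow> f A = 0" for f :: "_ \<Rightarrow> real"
  proof -
    have "(\<Sum>A\<in>Pow ?X. f A) = (\<Sum>A\<in>?I ` ?P. f A)"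
      using inversion_set_subset that by (intro sum.mono_neutral_right) auto
    then show ?thesis by (simp add: sum.reindex[OF inversion_set_inj])
  qed
  have "(1 - \<bar>q\<bar>) ^ card ?X * (\<Sum>A\<in>Pow ?X. (d A)\<^sup>2) \<le>
    (\<Sum>A\<in>Pow ?X. \<Sum>B\<in>Pow ?X. q ^ card ((A - B) \<union> (B - A)) * (d A * d B))"
    by (rule symmetric_difference_kernel_ge[OF q]) simp
  also have "(\<Sum>A\<in>Pow ?X. (d A)\<^sup>2) = (\<Sum>\<pi>\<in>?P. (d (?I \<pi>))\<^sup>2)"
    by (rule reindex) (simp add: d_def)
  also have "\<dots> = (\<Sum>\<pi>\<in>?P. (c \<pi>)\<^sup>2)" by (intro sum.cong refl) (simp only: d)
  also have "(\<Sum>A\<in>Pow ?X. \<Sum>B\<in>Pow ?X. q ^ card ((A - B) \<union> (B - A)) * (d A * d B)) =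
    (\<Sum>\<pi>\<in>?P. \<Sum>\<sigma>\<in>?P. q ^ card ((?I \<pi> - ?I \<sigma>) \<union> (?I \<sigma> - ?I \<pi>)) * (d (?I \<pi>) * d (?I \<sigma>)))"
    by (subst reindex, simp add: d_def, subst reindex, simp add: d_def, rule refl)
  also have "\<dots> = (\<Sum>\<pi>\<in>?P. \<Sum>\<sigma>\<in>?P. q ^ inversions n (\<pi> \<circ> inv \<sigma>) * (c \<pi> * c \<sigma>))"
    by (intro sum.cong refl) (simp add: d card_inversion_set_diff)
  finally show ?thesis by (simp add: card_cartesian_product)
qed


section \<open>The \<open>q\<close>-deformed scalar product\<close>

lemma permute_list_in_tuples:
  assumes "\<pi> permutes {..<n}" "ys \<in> tuples A n"
  shows "permute_list \<pi> ys \<in> tuples A n"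
  using assms by (simp add: tuples_def)

lemma permute_list_comp:
  assumes "\<sigma> permutes {..<n}" "ys \<in> tuples A n"
  shows "permute_list \<sigma> (permute_list \<rho> ys) = permute_list (\<rho> \<circ> \<sigma>) ys"
  using permute_list_compose[of \<sigma> ys \<rho>] assms by (simp add: tuples_def)

lemma bij_betw_permute_list:
  assumes p: "\<pi> permutes {..<n}"
  shows "bij_betw (permute_list \<pi>) (tuples A n) (tuples A n)"
  by (rule bij_betwI[of _ _ _ "permute_list (inv \<pi>)"])
    (use p permutes_inv[OF p] in \<open>auto simp: permute_list_in_tuples permute_list_comp[where n = n and A = A] permutes_inv_o\<close>)

text \<open>The matrix coefficients of the permutation operators; those with \<open>inv \<pi>\<close> occur in \<open>P\<close>.\<close>

definition permuted_product :: "'a::real_vector hspace \<Rightarrow> nat \<Rightarrow> (nat \<Rightarrow> nat) \<Rightarrow> ('a list \<Rightarrow> real) \<Rightarrow> ('a list \<Rightarrow> real) \<Rightarrow> real"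
  where "permuted_product K n \<tau> S R = (\<Sum>\<^sub>\<infinity>es\<in>tuples (some_basis K) n. S (permute_list \<tau> es) * R es)"

lemma permuted_square_summable:
  assumes S: "S \<in> hset (tensor_power K n)" and t: "\<tau> permutes {..<n}"
  shows "(\<lambda>es. (S (permute_list \<tau> es))\<^sup>2) summable_on tuples (some_basis K) n"
  using summable_on_reindex_bij_betw[OF bij_betw_permute_list[OF t], of "\<lambda>es. (S es)\<^sup>2" "some_basis K"] S
  by (simp add: hset_tensor_power)

lemma infsum_permuted_square:
  assumes t: "\<tau> permutes {..<n}"
  shows "(\<Sum>\<^sub>\<infinity>es\<in>tuples (some_basis K) n. (S (permute_list \<tau> es))\<^sup>2) = hip (tensor_power K n) S S"
  using infsum_reindex_bij_betw[OF bij_betw_permute_list[OF t], of "\<lambda>es. (S es)\<^sup>2" "some_basis K"]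
  by (simp add: hip_tensor_power power2_eq_square)

lemma permuted_product_summable:
  assumes "S \<in> hset (tensor_power K n)" "R \<in> hset (tensor_power K n)"
    and "\<tau> permutes {..<n}" "\<rho> permutes {..<n}"
  shows "(\<lambda>es. S (permute_list \<tau> es) * R (permute_list \<rho> es)) summable_on tuples (some_basis K) n"
  using assms by (intro square_summable_mult permuted_square_summable)

lemma permuted_product_shift:
  assumes t: "\<tau> permutes {..<n}" and r: "\<rho> permutes {..<n}"
  shows "(\<Sum>\<^sub>\<infinity>es\<in>tuples (some_basis K) n. S (permute_list \<tau> es) * R (permute_list \<rho> es)) =
    permuted_product K n (inv \<rho> \<circ> \<tau>) S R"
proof -
  have r': "inv \<rho> permutes {..<n}" by (rule permutes_inv[OF r])
  have "permuted_product K n (inv \<rho> \<circ> \<tau>) S R =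
      (\<Sum>\<^sub>\<infinity>es\<in>tuples (some_basis K) n. S (permute_list (inv \<rho> \<circ> \<tau>) (permute_list \<rho> es)) * R (permute_list \<rho> es))"
    unfolding permuted_product_def
    by (rule infsum_reindex_bij_betw[OF bij_betw_permute_list[OF r], symmetric])
  also have "\<dots> = (\<Sum>\<^sub>\<infinity>es\<in>tuples (some_basis K) n. S (permute_list \<tau> es) * R (permute_list \<rho> es))"
  proof (rule infsum_cong)
    fix es assume es: "es \<in> tuples (some_basis K) n"
    have "permute_list (inv \<rho> \<circ> \<tau>) (permute_list \<rho> es) = permute_list (\<rho> \<circ> (inv \<rho> \<circ> \<tau>)) es"
      using permute_list_comp[OF permutes_compose[OF t r'] es] .
    also have "\<rho> \<circ> (inv \<rho> \<circ> \<tau>) = \<tau>" using permutes_inverses(1)[OF r] by (simp add: fun_eq_iff)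
    finally show "S (permute_list (inv \<rho> \<circ> \<tau>) (permute_list \<rho> es)) * R (permute_list \<rho> es) =
      S (permute_list \<tau> es) * R (permute_list \<rho> es)" by (simp only:)
  qed
  finally show ?thesis by simp
qed

lemma permuted_product_inv:
  assumes "\<tau> permutes {..<n}"
  shows "permuted_product K n (inv \<tau>) S R = permuted_product K n \<tau> R S"
proof -
  have "permuted_product K n \<tau> R S = (\<Sum>\<^sub>\<infinity>es\<in>tuples (some_basis K) n. S (permute_list id es) * R (permute_list \<tau> es))"
    by (simp add: permuted_product_def mult.commute)
  then show ?thesis using permuted_product_shift[OF permutes_id assms, where K = K and S = S and R = R] by simp
qed

lemma hset_q_fock_level [simp]: "hset (q_fock_level q K n) = hset (tensor_power K n)"
  by (simp add: q_fock_level_def)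

lemma hip_q_fock_level:
  assumes S: "S \<in> hset (tensor_power K n)" and R: "R \<in> hset (tensor_power K n)"
  shows "hip (q_fock_level q K n) S R =
    (\<Sum>\<pi> | \<pi> permutes {..<n}. q ^ inversions n \<pi> * permuted_product K n (inv \<pi>) S R)"
proof -
  let ?P = "{\<pi>. \<pi> permutes {..<n}}" and ?B = "tuples (some_basis K) n"
  have s: "(\<lambda>es. q ^ inversions n \<pi> * (S (permute_list (inv \<pi>) es) * R es)) summable_on ?B" if "\<pi> \<in> ?P" for \<pi>
    using permuted_product_summable[OF S R permutes_inv permutes_id, of \<pi>] that
    by (intro summable_on_cmult_right) simp
  have "hip (q_fock_level q K n) S R =
      (\<Sum>\<^sub>\<infinity>es\<in>?B. \<Sum>\<pi>\<in>?P. q ^ inversions n \<pi> * (S (permute_list (inv \<pi>) es) * R es))"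
    by (simp add: q_fock_level_def hip_tensor_power q_symmetrizer_def sum_distrib_right mult.assoc)
  also have "\<dots> = (\<Sum>\<pi>\<in>?P. \<Sum>\<^sub>\<infinity>es\<in>?B. q ^ inversions n \<pi> * (S (permute_list (inv \<pi>) es) * R es))"
    by (rule infsum_finite_sum) (rule s)
  finally show ?thesis by (simp add: permuted_product_def infsum_cmult_right')
qed

lemma hip_q_fock_level_commute:
  assumes S: "S \<in> hset (tensor_power K n)" and R: "R \<in> hset (tensor_power K n)"
  shows "hip (q_fock_level q K n) S R = hip (q_fock_level q K n) R S"
proof -
  let ?P = "{\<pi>. \<pi> permutes {..<n}}"
  have bij: "bij_betw inv ?P ?P"
    by (rule bij_betwI[of _ _ _ inv]) (auto simp: permutes_inv permutes_inv_inv)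
  have "hip (q_fock_level q K n) S R = (\<Sum>\<pi>\<in>?P. q ^ inversions n (inv \<pi>) * permuted_product K n \<pi> R S)"
    unfolding hip_q_fock_level[OF S R] by (intro sum.cong refl) (simp add: permuted_product_inv inversions_inv)
  also have "\<dots> = (\<Sum>\<pi>\<in>?P. q ^ inversions n (inv (inv \<pi>)) * permuted_product K n (inv \<pi>) R S)"
    by (rule sum.reindex_bij_betw[OF bij, symmetric])
  also have "\<dots> = hip (q_fock_level q K n) R S"
    unfolding hip_q_fock_level[OF R S] by (intro sum.cong refl) (simp add: permutes_inv_inv)
  finally show ?thesis .
qed

text \<open>Averaging over the group turns the form of \<open>P\<close> into a sum of values of the kernel that
  compares inversion sets; this is where strict positivity of \<open>P\<close> comes from.\<close>

lemma hip_q_fock_level_ge: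
  assumes q: "\<bar>q\<bar> < 1" and S: "S \<in> hset (tensor_power K n)"
  shows "(1 - \<bar>q\<bar>) ^ (n * n) * hip (tensor_power K n) S S \<le> hip (q_fock_level q K n) S S"
proof -
  let ?P = "{\<pi>. \<pi> permutes {..<n}}" and ?B = "tuples (some_basis K) n"
  let ?N = "real (card ?P)"
  define v where "v es \<pi> = S (permute_list (inv \<pi>) es)" for es and \<pi> :: "nat \<Rightarrow> nat"
  have vv: "(\<lambda>es. v es \<pi> * v es \<sigma>) summable_on ?B" if "\<pi> \<in> ?P" "\<sigma> \<in> ?P" for \<pi> \<sigma>
    unfolding v_def using that by (intro permuted_product_summable[OF S S]) (auto simp: permutes_inv)
  have ip: "(\<Sum>\<^sub>\<infinity>es\<in>?B. v es \<pi> * v es \<sigma>) = permuted_product K n (inv (\<pi> \<circ> inv \<sigma>)) S S"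
    if "\<pi> \<in> ?P" "\<sigma> \<in> ?P" for \<pi> \<sigma>
  proof -
    have p: "\<pi> permutes {..<n}" and s: "\<sigma> permutes {..<n}" using that by auto
    have "inv (\<pi> \<circ> inv \<sigma>) = inv (inv \<sigma>) \<circ> inv \<pi>"
      using permutes_bij[OF p] permutes_bij[OF permutes_inv[OF s]] by (simp add: o_inv_distrib)
    then show ?thesis
      unfolding v_def using permuted_product_shift[OF permutes_inv[OF p] permutes_inv[OF s], where K = K and S = S and R = S] by simp
  qed
  have avg: "?N * hip (q_fock_level q K n) S S =
      (\<Sum>\<^sub>\<infinity>es\<in>?B. \<Sum>\<pi>\<in>?P. \<Sum>\<sigma>\<in>?P. q ^ inversions n (\<pi> \<circ> inv \<sigma>) * (v es \<pi> * v es \<sigma>))"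
  proof -
    have "(\<Sum>\<^sub>\<infinity>es\<in>?B. \<Sum>\<pi>\<in>?P. \<Sum>\<sigma>\<in>?P. q ^ inversions n (\<pi> \<circ> inv \<sigma>) * (v es \<pi> * v es \<sigma>)) =
        (\<Sum>\<pi>\<in>?P. \<Sum>\<^sub>\<infinity>es\<in>?B. \<Sum>\<sigma>\<in>?P. q ^ inversions n (\<pi> \<circ> inv \<sigma>) * (v es \<pi> * v es \<sigma>))"
      by (rule infsum_finite_sum) (intro summable_on_finite_sum summable_on_cmult_right vv)
    also have "\<dots> = (\<Sum>\<pi>\<in>?P. \<Sum>\<sigma>\<in>?P. \<Sum>\<^sub>\<infinity>es\<in>?B. q ^ inversions n (\<pi> \<circ> inv \<sigma>) * (v es \<pi> * v es \<sigma>))"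
      by (intro sum.cong refl infsum_finite_sum summable_on_cmult_right vv)
    also have "\<dots> = (\<Sum>\<pi>\<in>?P. \<Sum>\<sigma>\<in>?P. q ^ inversions n (\<pi> \<circ> inv \<sigma>) * permuted_product K n (inv (\<pi> \<circ> inv \<sigma>)) S S)"
      by (intro sum.cong refl) (simp add: infsum_cmult_right' ip)
    also have "\<dots> = (\<Sum>\<sigma>\<in>?P. \<Sum>\<pi>\<in>?P. q ^ inversions n (\<pi> \<circ> inv \<sigma>) * permuted_product K n (inv (\<pi> \<circ> inv \<sigma>)) S S)"
      by (rule sum.swap)
    also have "\<dots> = (\<Sum>\<sigma>\<in>?P. hip (q_fock_level q K n) S S)"
    proof (rule sum.cong[OF refl])
      fix \<sigma> assume "\<sigma> \<in> ?P"
      then have s: "\<sigma> permutes {..<n}" by simp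
      have "bij_betw (\<lambda>\<pi>. \<pi> \<circ> inv \<sigma>) ?P ?P"
        by (rule bij_betwI[of _ _ _ "\<lambda>\<pi>. \<pi> \<circ> \<sigma>"])
          (use s permutes_inv[OF s] in \<open>auto simp: permutes_compose comp_assoc permutes_inv_o\<close>)
      from sum.reindex_bij_betw[OF this, of "\<lambda>\<rho>. q ^ inversions n \<rho> * permuted_product K n (inv \<rho>) S S"]
      show "(\<Sum>\<pi>\<in>?P. q ^ inversions n (\<pi> \<circ> inv \<sigma>) * permuted_product K n (inv (\<pi> \<circ> inv \<sigma>)) S S)
        = hip (q_fock_level q K n) S S"
        by (simp add: hip_q_fock_level[OF S S])
    qed
    finally show ?thesis by simp
  qed
  have sq: "(\<lambda>es. (v es \<pi>)\<^sup>2) summable_on ?B" if "\<pi> \<in> ?P" for \<pi>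
    using vv[OF that that] by (simp add: power2_eq_square)
  have "?N * ((1 - \<bar>q\<bar>) ^ (n * n) * hip (tensor_power K n) S S) =
      (1 - \<bar>q\<bar>) ^ (n * n) * (\<Sum>\<pi>\<in>?P. \<Sum>\<^sub>\<infinity>es\<in>?B. (v es \<pi>)\<^sup>2)"
    by (simp add: v_def infsum_permuted_square permutes_inv)
  also have "\<dots> = (\<Sum>\<^sub>\<infinity>es\<in>?B. (1 - \<bar>q\<bar>) ^ (n * n) * (\<Sum>\<pi>\<in>?P. (v es \<pi>)\<^sup>2))"
    by (subst infsum_finite_sum[symmetric]) (simp_all add: sq infsum_cmult_right')
  also have "\<dots> \<le> (\<Sum>\<^sub>\<infinity>es\<in>?B. \<Sum>\<pi>\<in>?P. \<Sum>\<sigma>\<in>?P. q ^ inversions n (\<pi> \<circ> inv \<sigma>) * (v es \<pi> * v es \<sigma>))"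
    by (intro infsum_mono summable_on_finite_sum summable_on_cmult_right vv sq inversion_kernel_ge[OF q])
  also have "\<dots> = ?N * hip (q_fock_level q K n) S S" by (rule avg[symmetric])
  finally have "?N * ((1 - \<bar>q\<bar>) ^ (n * n) * hip (tensor_power K n) S S) \<le> ?N * hip (q_fock_level q K n) S S" .
  moreover have "?N > 0" by (simp add: card_permutations[OF refl])
  ultimately show ?thesis by simp
qed

lemma hip_q_fock_level_le:
  assumes q: "\<bar>q\<bar> < 1" and S: "S \<in> hset (tensor_power K n)"
  shows "hip (q_fock_level q K n) S S \<le> (1 / (1 - \<bar>q\<bar>)) ^ n * hip (tensor_power K n) S S"
proof -
  let ?P = "{\<pi>. \<pi> permutes {..<n}}" and ?B = "tuples (some_basis K) n" and ?h = "hip (tensor_power K n) S S"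
  have h0: "?h \<ge> 0" by (simp add: hip_tensor_power infsum_nonneg)
  have sq: "(\<lambda>es. (S es)\<^sup>2) summable_on ?B" using S by (simp add: hset_tensor_power)
  \<comment> \<open>permutation operators are isometric\<close>
  have u: "\<bar>permuted_product K n \<tau> S S\<bar> \<le> ?h" if t: "\<tau> permutes {..<n}" for \<tau>
  proof -
    let ?s = "\<lambda>es. (1/2) * ((S (permute_list \<tau> es))\<^sup>2 + (S es)\<^sup>2)"
    have sum: "?s summable_on ?B"
      by (intro summable_on_cmult_right summable_on_add permuted_square_summable[OF S t] sq)
    have pr: "(\<lambda>es. S (permute_list \<tau> es) * S es) summable_on ?B"
      using permuted_product_summable[OF S S t permutes_id] by simp
    have h: "infsum (\<lambda>es. (S es)\<^sup>2) ?B = ?h" by (simp add: hip_tensor_power power2_eq_square)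
    have s_eq: "infsum ?s ?B = ?h"
      unfolding infsum_cmult_right' infsum_add[OF permuted_square_summable[OF S t] sq]
        infsum_permuted_square[OF t] h by simp
    have "x * y \<le> (1/2) * (x\<^sup>2 + y\<^sup>2)" "- (x * y) \<le> (1/2) * (x\<^sup>2 + y\<^sup>2)" for x y :: real
      using zero_le_power2[of "x - y"] zero_le_power2[of "x + y"] by (simp_all add: power2_sum power2_diff)
    then have le: "S (permute_list \<tau> es) * S es \<le> ?s es" "- (S (permute_list \<tau> es) * S es) \<le> ?s es" for es
      by blast+
    have "permuted_product K n \<tau> S S \<le> ?h"
      unfolding permuted_product_def s_eq[symmetric] by (rule infsum_mono[OF pr sum le(1)])
    moreover have "- permuted_product K n \<tau> S S \<le> ?h"
      unfolding permuted_product_def s_eq[symmetric] infsum_uminus[symmetric]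
      by (rule infsum_mono[OF _ sum le(2)]) (simp add: summable_on_uminus pr)
    ultimately show ?thesis by simp
  qed
  have "hip (q_fock_level q K n) S S \<le> (\<Sum>\<pi>\<in>?P. \<bar>q\<bar> ^ inversions n \<pi> * ?h)"
    unfolding hip_q_fock_level[OF S S]
  proof (rule sum_mono)
    fix \<pi> assume "\<pi> \<in> ?P"
    then have "\<bar>q ^ inversions n \<pi> * permuted_product K n (inv \<pi>) S S\<bar> \<le> \<bar>q\<bar> ^ inversions n \<pi> * ?h"
      unfolding abs_mult power_abs using u[of "inv \<pi>"] by (intro mult_left_mono) (auto simp: permutes_inv)
    then show "q ^ inversions n \<pi> * permuted_product K n (inv \<pi>) S S \<le> \<bar>q\<bar> ^ inversions n \<pi> * ?h" by simp
  qed
  also have "\<dots> = (\<Sum>\<pi>\<in>?P. \<bar>q\<bar> ^ inversions n \<pi>) * ?h" by (simp add: sum_distrib_right)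
  also have "\<dots> \<le> (1 / (1 - \<bar>q\<bar>)) ^ n * ?h"
    using sum_power_inversions_le[of "\<bar>q\<bar>" n] q h0 by (intro mult_right_mono) auto
  finally show ?thesis .
qed

lemma (in hilbert) ip_space_q_fock_level:
  assumes q: "\<bar>q\<bar> < 1"
  shows "ip_space (q_fock_level q K n)"
proof
  let ?T = "hset (tensor_power K n)" and ?F = "q_fock_level q K n"
  have add: "hip ?F (S + R) Q = hip ?F S Q + hip ?F R Q" if "S \<in> ?T" "R \<in> ?T" "Q \<in> ?T" for S R Q
  proof -
    have "permuted_product K n (inv \<pi>) (S + R) Q = permuted_product K n (inv \<pi>) S Q + permuted_product K n (inv \<pi>) R Q"
      if "\<pi> permutes {..<n}" for \<pi>
      using permuted_product_summable[OF \<open>S \<in> ?T\<close> \<open>Q \<in> ?T\<close> permutes_inv[OF that] permutes_id]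
        permuted_product_summable[OF \<open>R \<in> ?T\<close> \<open>Q \<in> ?T\<close> permutes_inv[OF that] permutes_id]
      by (simp add: permuted_product_def distrib_right infsum_add)
    then show ?thesis
      using that by (simp add: hip_q_fock_level distrib_left sum.distrib)
  qed
  have scale: "hip ?F (c *\<^sub>R S) R = c * hip ?F S R" if "S \<in> ?T" "R \<in> ?T" for c S R
  proof -
    have "permuted_product K n \<tau> (c *\<^sub>R S) R = c * permuted_product K n \<tau> S R" for \<tau>
      by (simp add: permuted_product_def mult.assoc infsum_cmult_right')
    then show ?thesis using that by (simp add: hip_q_fock_level sum_distrib_left mult_ac)
  qed
  have "hip ?F S S > 0" if S: "S \<in> ?T" and "S \<noteq> 0" for S
  proof -
    have "(1 - \<bar>q\<bar>) ^ (n * n) * hip (tensor_power K n) S S > 0"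
      using tensor.pos[OF that] q by simp
    then show ?thesis using hip_q_fock_level_ge[OF q S] by linarith
  qed
  then show "inner_product_space ?F"
    unfolding inner_product_space_def hset_q_fock_level
    by (intro conjI ballI allI impI subspace_tensor_power hip_q_fock_level_commute add scale)
qed


section \<open>Hilbert sums\<close>

lemma hset_hilbert_sum:
  "F \<in> hset (hilbert_sum X) \<longleftrightarrow> (\<forall>n. F n \<in> hset (X n)) \<and> summable (\<lambda>n. hip (X n) (F n) (F n))"
  by (simp add: hilbert_sum_def)

lemma hip_hilbert_sum: "hip (hilbert_sum X) F G = (\<Sum>n. hip (X n) (F n) (G n))"
  by (simp add: hilbert_sum_def)

locale hilbert_sum_family =
  fixes X :: "nat \<Rightarrow> 'a::real_vector hspace"
  assumes ip_space_level: "ip_space (X n)"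
begin

sublocale level: ip_space "X n" for n
  by (rule ip_space_level)

lemma summable_products:
  assumes F: "F \<in> hset (hilbert_sum X)" and G: "G \<in> hset (hilbert_sum X)"
  shows "summable (\<lambda>n. hip (X n) (F n) (G n))"
proof (rule summable_comparison_test')
  show "summable (\<lambda>n. hip (X n) (F n) (F n) + hip (X n) (G n) (G n))"
    using F G by (intro summable_add) (auto simp: hset_hilbert_sum)
  fix n :: nat
  have FG: "F n \<in> hset (X n)" "G n \<in> hset (X n)" using F G by (auto simp: hset_hilbert_sum)
  have "\<bar>hip (X n) (F n) (G n)\<bar> \<le> hnorm (X n) (F n) * hnorm (X n) (G n)"
    by (rule level.cauchy_schwarz[OF FG])
  also have "\<dots> \<le> (hnorm (X n) (F n))\<^sup>2 + (hnorm (X n) (G n))\<^sup>2"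
    using zero_le_power2[of "hnorm (X n) (F n) - hnorm (X n) (G n)"] mult_nonneg_nonneg[OF level.norm_nonneg[OF FG(1)] level.norm_nonneg[OF FG(2)]]
    unfolding power2_diff by linarith
  finally show "norm (hip (X n) (F n) (G n)) \<le> hip (X n) (F n) (F n) + hip (X n) (G n) (G n)"
    using FG by (simp add: level.norm_sq)
qed

lemma subspace_hilbert_sum: "subspace (hset (hilbert_sum X))"
  unfolding subspace_def
proof (intro conjI ballI allI)
  show "0 \<in> hset (hilbert_sum X)" by (simp add: hset_hilbert_sum)
  fix F assume F: "F \<in> hset (hilbert_sum X)"
  have Fm: "F n \<in> hset (X n)" for n using F by (simp add: hset_hilbert_sum)
  show "F + G \<in> hset (hilbert_sum X)" if G: "G \<in> hset (hilbert_sum X)" for G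
  proof -
    have Gm: "G n \<in> hset (X n)" for n using G by (simp add: hset_hilbert_sum)
    have "summable (\<lambda>n. hip (X n) (F n) (F n) + hip (X n) (F n) (G n) + hip (X n) (G n) (F n) + hip (X n) (G n) (G n))"
      using summable_products F G by (intro summable_add) auto
    then show ?thesis using Fm Gm by (simp add: hset_hilbert_sum level.bilinear algebra_simps)
  qed
  show "c *\<^sub>R F \<in> hset (hilbert_sum X)" for c
    using F Fm by (simp add: hset_hilbert_sum level.bilinear summable_mult)
qed

lemma ip_space_hilbert_sum: "ip_space (hilbert_sum X)"
proof
  have mem: "F n \<in> hset (X n)" if "F \<in> hset (hilbert_sum X)" for F n
    using that by (simp add: hset_hilbert_sum)
  show "inner_product_space (hilbert_sum X)"
    unfolding inner_product_space_def
  proof (intro conjI ballI allI impI)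
    show "subspace (hset (hilbert_sum X))" by (rule subspace_hilbert_sum)
    fix F assume F: "F \<in> hset (hilbert_sum X)"
    show "hip (hilbert_sum X) F G = hip (hilbert_sum X) G F" if "G \<in> hset (hilbert_sum X)" for G
      unfolding hip_hilbert_sum using mem[OF F] mem[OF that] by (intro suminf_cong level.commute)
    show "hip (hilbert_sum X) (F + G) Q = hip (hilbert_sum X) F Q + hip (hilbert_sum X) G Q"
      if G: "G \<in> hset (hilbert_sum X)" and Q: "Q \<in> hset (hilbert_sum X)" for G Q
      unfolding hip_hilbert_sum suminf_add[OF summable_products[OF F Q] summable_products[OF G Q]]
      using mem F G Q by (simp add: level.add_left)
    show "hip (hilbert_sum X) (c *\<^sub>R F) G = c * hip (hilbert_sum X) F G" if G: "G \<in> hset (hilbert_sum X)" for c G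
      unfolding hip_hilbert_sum suminf_mult[OF summable_products[OF F G], symmetric]
      using mem F G by (simp add: level.scale_left)
    assume "F \<noteq> 0"
    then obtain n where "F n \<noteq> 0" by (auto simp: fun_eq_iff)
    then have "hip (X n) (F n) (F n) > 0" using mem[OF F] by (rule level.pos[rotated])
    then show "hip (hilbert_sum X) F F > 0"
      unfolding hip_hilbert_sum using F mem[OF F]
      by (intro suminf_pos2[of _ n]) (auto simp: hset_hilbert_sum level.nonneg)
  qed
qed

sublocale ip_space "hilbert_sum X"
  by (rule ip_space_hilbert_sum)

end

lemma hilbert_sum_mono:
  assumes X: "hilbert_sum_family X" and Y: "hilbert_sum_family Y"
    and F: "F \<in> hset (hilbert_sum X)" and G: "\<And>n. G n \<in> hset (Y n)"
    and le: "\<And>n. hip (Y n) (G n) (G n) \<le> hip (X n) (F n) (F n)"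
  shows "G \<in> hset (hilbert_sum Y)" and "hnorm (hilbert_sum Y) G \<le> hnorm (hilbert_sum X) F"
proof -
  interpret Y: hilbert_sum_family Y by fact
  have sF: "summable (\<lambda>n. hip (X n) (F n) (F n))" using F by (simp add: hset_hilbert_sum)
  have sG: "summable (\<lambda>n. hip (Y n) (G n) (G n))"
    by (rule summable_comparison_test'[OF sF]) (use G le Y.level.nonneg in simp)
  show "G \<in> hset (hilbert_sum Y)" using sG G by (simp add: hset_hilbert_sum)
  show "hnorm (hilbert_sum Y) G \<le> hnorm (hilbert_sum X) F"
    unfolding hnorm_def hip_hilbert_sum by (intro real_sqrt_le_mono suminf_le le sF sG)
qed

definition at_level :: "nat \<Rightarrow> 'a::zero \<Rightarrow> nat \<Rightarrow> 'a"
  where "at_level n x = (\<lambda>k. if k = n then x else 0)"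

context hilbert_sum_family
begin

lemma at_level_mem:
  assumes x: "x \<in> hset (X n)"
  shows "at_level n x \<in> hset (hilbert_sum X)" and "hnorm (hilbert_sum X) (at_level n x) = hnorm (X n) x"
proof -
  have eq: "hip (X k) (at_level n x k) (at_level n x k) = (if k = n then hip (X n) x x else 0)" for k
    by (simp add: at_level_def)
  have "(\<lambda>k. if k = n then hip (X n) x x else 0) sums hip (X n) x x"
    by (rule sums_single)
  then show "at_level n x \<in> hset (hilbert_sum X)" "hnorm (hilbert_sum X) (at_level n x) = hnorm (X n) x"
    using x by (auto simp: hset_hilbert_sum hnorm_def hip_hilbert_sum eq sums_iff) (simp add: at_level_def)
qed

lemma truncation_approx:
  assumes F: "F \<in> hset (hilbert_sum X)" and e: "e > 0"
  obtains N where "hnorm (hilbert_sum X) (F - (\<Sum>n<N. at_level n (F n))) < e"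
proof -
  let ?a = "\<lambda>n. hip (X n) (F n) (F n)"
  have sF: "summable ?a" using F by (simp add: hset_hilbert_sum)
  obtain N where N: "norm (\<Sum>i. ?a (i + N)) < e\<^sup>2"
    using suminf_exist_split[OF _ sF, of "e\<^sup>2"] e by auto
  let ?G = "F - (\<Sum>n<N. at_level n (F n))"
  have "(\<Sum>n<M. at_level n (F n)) k = (if k < M then F k else 0)" for M k
    by (induction M) (auto simp: at_level_def less_Suc_eq)
  then have G: "hip (X k) (?G k) (?G k) = (if k < N then 0 else ?a k)" for k
    by simp
  have "hip (hilbert_sum X) ?G ?G = (\<Sum>k. if k < N then 0 else ?a k)"
    by (simp add: hip_hilbert_sum G del: minus_apply)
  also have "\<dots> = (\<Sum>i. ?a (i + N))"
  proof -
    have "summable (\<lambda>k. if k < N then 0 else ?a k)"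
      using summable_iff_shift[of "\<lambda>k. if k < N then 0 else ?a k" N] sF summable_iff_shift[of ?a N] by simp
    from suminf_split_initial_segment[OF this, of N] show ?thesis by simp
  qed
  finally have "hip (hilbert_sum X) ?G ?G < e\<^sup>2" using N by simp
  then have "hnorm (hilbert_sum X) ?G < e"
    using e real_sqrt_less_mono by (fastforce simp: hnorm_def)
  then show thesis by (rule that)
qed

end


section \<open>Closures of subspaces and initial topologies\<close>

context ip_space
begin

lemma closure_ofI:
  assumes "x \<in> hset K" "\<And>e. e > 0 \<Longrightarrow> \<exists>y\<in>htop K closure_of V. hnorm K (x - y) < e"
  shows "x \<in> htop K closure_of V"
proof -
  have "x \<in> htop K closure_of (htop K closure_of V)"
    using assms closure_of_subset_topspace[of "htop K" V]
    unfolding closure_of_htop[of "htop K closure_of V"] by auto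
  then show ?thesis by simp
qed

lemma subspace_closure:
  assumes V: "subspace V" "V \<subseteq> hset K"
  shows "subspace (htop K closure_of V)"
  unfolding subspace_def
proof (intro conjI ballI allI)
  show "0 \<in> htop K closure_of V"
    using closure_of_subset[of V "htop K"] subspace_0[OF V(1)] V(2) by auto
  fix x assume x: "x \<in> htop K closure_of V"
  then have xK: "x \<in> hset K" by (simp add: closure_of_htop)
  show "x + y \<in> htop K closure_of V" if y: "y \<in> htop K closure_of V" for y
    unfolding closure_of_htop
  proof (intro CollectI conjI allI impI)
    have yK: "y \<in> hset K" using y by (simp add: closure_of_htop)
    show "x + y \<in> hset K" using xK yK by simp
    fix e :: real assume e: "e > 0"
    obtain u where u: "u \<in> V" "hnorm K (x - u) < e / 2"
      using x half_gt_zero[OF e] unfolding closure_of_htop by blast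
    obtain v where v: "v \<in> V" "hnorm K (y - v) < e / 2"
      using y half_gt_zero[OF e] unfolding closure_of_htop by blast
    have uv: "u \<in> hset K" "v \<in> hset K" using u v V by auto
    have eq: "x + y - (u + v) = (x - u) + (y - v)" by simp
    have "hnorm K (x + y - (u + v)) \<le> hnorm K (x - u) + hnorm K (y - v)"
      unfolding eq using norm_triangle[of "x - u" "y - v"] xK yK uv by simp
    then show "\<exists>w\<in>V. w \<in> hset K \<and> hnorm K (x + y - w) < e"
      using u v uv V(1) by (intro bexI[of _ "u + v"]) (auto simp: subspace_add)
  qed
  show "c *\<^sub>R x \<in> htop K closure_of V" for c
    unfolding closure_of_htop
  proof (intro CollectI conjI allI impI)
    show "c *\<^sub>R x \<in> hset K" using xK by simp
    fix e :: real assume e: "e > 0"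
    have "e / (\<bar>c\<bar> + 1) > 0" using e by simp
    then obtain u where u: "u \<in> V" "hnorm K (x - u) < e / (\<bar>c\<bar> + 1)"
      using x unfolding closure_of_htop by blast
    have uK: "u \<in> hset K" using u V by auto
    have "hnorm K (c *\<^sub>R x - c *\<^sub>R u) = \<bar>c\<bar> * hnorm K (x - u)"
      using norm_scale[of "x - u" c] xK uK by (simp add: scaleR_diff_right)
    also have "\<dots> \<le> (\<bar>c\<bar> + 1) * hnorm K (x - u)" using xK uK by (intro mult_right_mono) auto
    also have "\<dots> < e" using u by (simp add: field_simps)
    finally show "\<exists>w\<in>V. w \<in> hset K \<and> hnorm K (c *\<^sub>R x - w) < e"
      using u uK V(1) by (intro bexI[of _ "c *\<^sub>R u"]) (auto simp: subspace_scale)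
  qed
qed

end

lemma topspace_initial_topology [simp]: "topspace (initial_topology X I f Y) = X"
  by (auto simp: initial_topology_def)

lemma continuous_map_from_initial:
  assumes i: "i \<in> I" and im: "f i ` X \<subseteq> topspace (Y i)"
  shows "continuous_map (initial_topology X I f Y) (Y i) (f i)"
  unfolding continuous_map_alt
proof (intro conjI allI impI)
  fix U assume "openin (Y i) U"
  then have "X \<inter> f i -` U \<in> insert X {X \<inter> f i -` U | i U. i \<in> I \<and> openin (Y i) U}" using i by blast
  then have "openin (initial_topology X I f Y) (X \<inter> f i -` U)"
    unfolding initial_topology_def by (rule topology_generated_by_Basis)
  then show "openin (initial_topology X I f Y) (f i -` U \<inter> topspace (initial_topology X I f Y))"
    by (simp add: Int_commute)
qed (use im in auto)

lemma continuous_map_into_initial: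
  assumes im: "g ` topspace Z \<subseteq> X" and c: "\<And>i. i \<in> I \<Longrightarrow> continuous_map Z (Y i) (\<lambda>z. f i (g z))"
  shows "continuous_map Z (initial_topology X I f Y) g"
  unfolding initial_topology_def
proof (rule continuous_on_generated_topo)
  fix U assume "U \<in> insert X {X \<inter> f i -` U | i U. i \<in> I \<and> openin (Y i) U}"
  then consider "U = X" | i W where "i \<in> I" "openin (Y i) W" "U = X \<inter> f i -` W" by blast
  then show "openin Z (g -` U \<inter> topspace Z)"
  proof cases
    case 1
    then have "g -` U \<inter> topspace Z = topspace Z" using im by blast
    then show ?thesis by simp
  next
    case 2
    then have "g -` U \<inter> topspace Z = (\<lambda>z. f i (g z)) -` W \<inter> topspace Z" using im by auto
    then show ?thesis using c[OF 2(1)] 2(2) unfolding continuous_map_alt by simp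
  qed
qed (use im in auto)


section \<open>The spaces with factorial weights\<close>

definition weight :: "real \<Rightarrow> real \<Rightarrow> real \<Rightarrow> nat \<Rightarrow> real"
  where "weight q r \<alpha> n = r ^ n * q_fact q n powr \<alpha>"

text \<open>For \<open>\<bar>q\<bar> < 1\<close> the numbers \<open>[n]\<^sub>q\<close> stay between two positive constants, so the weights grow
  geometrically. This is what makes a change of \<open>r\<close> absorb every exponential factor below.\<close>

lemma q_int_bounds:
  assumes q: "\<bar>q\<bar> < 1" and k: "k \<ge> 1"
  shows "(1 - \<bar>q\<bar>) / 2 \<le> q_int q k" and "q_int q k \<le> 1 / (1 - \<bar>q\<bar>)"
proof -
  have q1: "q \<noteq> 1" "1 - q > 0" "1 - q \<le> 2" using q by auto
  have eq: "q_int q k = (1 - q ^ k) / (1 - q)"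
    using sum_gp_strict[of q k] q1 by (simp add: q_int_def)
  have "q ^ k \<le> \<bar>q\<bar> ^ k" by (metis abs_ge_self power_abs)
  also have "\<dots> \<le> \<bar>q\<bar> ^ 1" using q k by (intro power_decreasing) auto
  finally have "1 - \<bar>q\<bar> \<le> 1 - q ^ k" by simp
  then have "(1 - \<bar>q\<bar>) / 2 \<le> (1 - q ^ k) / (1 - q)"
    using q q1 by (intro frac_le) auto
  then show "(1 - \<bar>q\<bar>) / 2 \<le> q_int q k" by (simp add: eq)
  have "q_int q k \<le> (\<Sum>i<k. \<bar>q\<bar> ^ i)"
    unfolding q_int_def by (rule sum_mono) (metis abs_ge_self power_abs)
  also have "\<dots> = (1 - \<bar>q\<bar> ^ k) / (1 - \<bar>q\<bar>)" using q by (simp add: sum_gp_strict)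
  also have "\<dots> \<le> 1 / (1 - \<bar>q\<bar>)" using q by (intro divide_right_mono) auto
  finally show "q_int q k \<le> 1 / (1 - \<bar>q\<bar>)" .
qed

lemma weight_bounds:
  assumes q: "\<bar>q\<bar> < 1" and \<alpha>: "\<alpha> \<ge> 0"
  obtains a b where "a > 0" "b > 0"
    "\<And>r n. r \<ge> 0 \<Longrightarrow> (r * a) ^ n \<le> weight q r \<alpha> n" "\<And>r n. r \<ge> 0 \<Longrightarrow> weight q r \<alpha> n \<le> (r * b) ^ n"
proof -
  define l where "l = (1 - \<bar>q\<bar>) / 2"
  define u where "u = 1 / (1 - \<bar>q\<bar>)"
  have l: "l > 0" and u: "u > 0" using q by (auto simp: l_def u_def)
  have f: "l ^ n \<le> q_fact q n" "q_fact q n \<le> u ^ n" for n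
  proof -
    have "(\<Prod>k=1..n. l) \<le> q_fact q n"
      unfolding q_fact_def by (rule prod_mono) (use l q_int_bounds[OF q] in \<open>auto simp: l_def\<close>)
    then show "l ^ n \<le> q_fact q n" by simp
    have "q_int q k \<ge> 0" if "k \<ge> 1" for k
      using q_int_bounds(1)[OF q that] l by (simp add: l_def)
    then have "q_fact q n \<le> (\<Prod>k=1..n. u)"
      unfolding q_fact_def by (intro prod_mono) (use q_int_bounds[OF q] in \<open>auto simp: u_def\<close>)
    then show "q_fact q n \<le> u ^ n" by simp
  qed
  have pw: "(x ^ n) powr \<alpha> = (x powr \<alpha>) ^ n" if "x > 0" for x :: real and n
    using that by (simp add: powr_realpow[symmetric] powr_powr mult.commute)
  show thesis
  proof (rule that[of "l powr \<alpha>" "u powr \<alpha>"])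
    fix r :: real and n :: nat assume r: "r \<ge> 0"
    have "(l powr \<alpha>) ^ n \<le> q_fact q n powr \<alpha>"
      unfolding pw[OF l, symmetric] using f l \<alpha> by (intro powr_mono2) auto
    then show "(r * l powr \<alpha>) ^ n \<le> weight q r \<alpha> n"
      using r unfolding weight_def power_mult_distrib by (intro mult_left_mono) auto
    have "q_fact q n \<ge> 0" using f(1)[of n] l by (meson less_imp_le order_trans zero_le_power)
    then have "q_fact q n powr \<alpha> \<le> (u powr \<alpha>) ^ n"
      unfolding pw[OF u, symmetric] using f(2) \<alpha> by (intro powr_mono2) auto
    then show "weight q r \<alpha> n \<le> (r * u powr \<alpha>) ^ n"
      using r unfolding weight_def power_mult_distrib by (intro mult_left_mono) auto
  qed (use l u in auto)
qed

lemma weight_pos: "\<bar>q\<bar> < 1 \<Longrightarrow> r > 0 \<Longrightarrow> weight q r \<alpha> n > 0"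
proof -
  assume q: "\<bar>q\<bar> < 1" and r: "r > 0"
  have "q_int q k > 0" if "k \<ge> 1" for k
    using less_le_trans[OF _ q_int_bounds(1)[OF q that], of 0] q by simp
  then have "q_fact q n > 0" unfolding q_fact_def by (intro prod_pos) auto
  then show ?thesis using r by (simp add: weight_def)
qed

definition weighted_level :: "real \<Rightarrow> 'a::real_vector hspace \<Rightarrow> real \<Rightarrow> real \<Rightarrow> nat \<Rightarrow> ('a list \<Rightarrow> real) hspace"
  where "weighted_level q K r \<alpha> n = scaled_hspace (tensor_power K n) (weight q r \<alpha> n)"

lemma G_space_eq: "G_space q K r \<alpha> = hilbert_sum (weighted_level q K r \<alpha>)"
  by (simp add: G_space_def weighted_level_def[abs_def] weight_def)

lemma weighted_level_sel [simp]:
  "hset (weighted_level q K r \<alpha> n) = hset (tensor_power K n)"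
  "hip (weighted_level q K r \<alpha> n) S R = weight q r \<alpha> n * hip (tensor_power K n) S R"
  by (simp_all add: weighted_level_def scaled_hspace_def)

lemma (in ip_space) ip_space_scaled:
  assumes c: "c > 0"
  shows "ip_space (scaled_hspace K c)"
proof
  show "inner_product_space (scaled_hspace K c)"
    unfolding inner_product_space_def scaled_hspace_def
    by (intro conjI ballI allI impI) (use c subspace_hset in \<open>auto simp: add_left scale_left pos distrib_left intro: commute\<close>)
qed

lemma tensor_mult_apply: "tensor_mult F G n ys = (\<Sum>i\<le>n. F i (take i ys) * G (n - i) (drop i ys))"
  by (simp add: tensor_mult_def tensor_def sum_fun_apply)

lemma tensor_map_tensor_mult:
  "tensor_map K' K A n (tensor_mult F G n) =
    tensor_mult (\<lambda>i. tensor_map K' K A i (F i)) (\<lambda>i. tensor_map K' K A i (G i)) n"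
proof
  fix ys
  have split: "ys \<in> tuples (hset K) n \<longleftrightarrow> take i ys \<in> tuples (hset K) i \<and> drop i ys \<in> tuples (hset K) (n - i)"
    if "i \<le> n" for i
    using tuples_add_iff[of ys "hset K" i "n - i"] that by simp
  show "tensor_map K' K A n (tensor_mult F G n) ys =
    tensor_mult (\<lambda>i. tensor_map K' K A i (F i)) (\<lambda>i. tensor_map K' K A i (G i)) n ys"
  proof (cases "ys \<in> tuples (hset K) n")
    case True
    then show ?thesis
      unfolding tensor_mult_apply using split
      by (simp add: tensor_map_def tensor_mult_apply take_map drop_map)
  next
    case False
    then have "tensor_map K' K A i (F i) (take i ys) * tensor_map K' K A (n - i) (G (n - i)) (drop i ys) = 0"
      if "i \<le> n" for i
      using split[OF that] by (auto simp: tensor_map_def)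
    then have "tensor_mult (\<lambda>i. tensor_map K' K A i (F i)) (\<lambda>i. tensor_map K' K A i (G i)) n ys = 0"
      unfolding tensor_mult_apply by (intro sum.neutral) simp
    then show ?thesis using False by (simp add: tensor_map_def)
  qed
qed

lemma tensor_mult_zero [simp]: "tensor_mult 0 G = 0" "tensor_mult F 0 = 0"
  by (simp_all add: fun_eq_iff tensor_mult_apply)

lemma tensor_mult_diff_left: "tensor_mult (F - F') G = tensor_mult F G - tensor_mult F' G"
  by (simp add: fun_eq_iff tensor_mult_apply left_diff_distrib sum_subtractf)

lemma tensor_mult_diff_right: "tensor_mult F (G - G') = tensor_mult F G - tensor_mult F G'"
  by (simp add: fun_eq_iff tensor_mult_apply right_diff_distrib sum_subtractf)

lemma tensor_mult_assoc: "tensor_mult (tensor_mult F G) L = tensor_mult F (tensor_mult G L)"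
proof (intro ext)
  fix n ys
  let ?t = "\<lambda>i j. F i (take i ys) * (G j (take j (drop i ys)) * L (n - (i + j)) (drop (i + j) ys))"
  have "tensor_mult (tensor_mult F G) L n ys =
      (\<Sum>k\<le>n. \<Sum>i\<le>k. ?t i (k - i))"
    unfolding tensor_mult_apply
    by (intro sum.cong refl) (auto simp: sum_distrib_right min_def take_drop mult.assoc intro!: sum.cong)
  also have "\<dots> = (\<Sum>(i, j) | i + j \<le> n. ?t i j)"
    by (rule sum.triangle_reindex_eq[symmetric])
  also have "{(i, j). i + j \<le> n} = Sigma {..n} (\<lambda>i. {..n - i})" by auto
  also have "(\<Sum>(i, j)\<in>Sigma {..n} (\<lambda>i. {..n - i}). ?t i j) = (\<Sum>i\<le>n. \<Sum>j\<le>n - i. ?t i j)"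
    by (rule sum.Sigma[symmetric]) auto
  also have "\<dots> = tensor_mult F (tensor_mult G L) n ys"
    unfolding tensor_mult_apply
    by (intro sum.cong refl) (simp add: sum_distrib_left add.commute)
  finally show "tensor_mult (tensor_mult F G) L n ys = tensor_mult F (tensor_mult G L) n ys" .
qed

context hilbert
begin

lemma weighted_family:
  assumes "\<bar>q\<bar> < 1" "r > 0"
  shows "hilbert_sum_family (weighted_level q K r \<alpha>)"
  unfolding hilbert_sum_family_def weighted_level_def
  using tensor.ip_space_scaled weight_pos assms by blast

lemma ip_space_G_space: "\<bar>q\<bar> < 1 \<Longrightarrow> r > 0 \<Longrightarrow> ip_space (G_space q K r \<alpha>)"
  unfolding G_space_eq by (rule hilbert_sum_family.ip_space_hilbert_sum[OF weighted_family])

lemma fock_family: "\<bar>q\<bar> < 1 \<Longrightarrow> hilbert_sum_family (q_fock_level q K)"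
  unfolding hilbert_sum_family_def using ip_space_q_fock_level by blast

lemma tensor_mult_level:
  assumes F: "\<And>i. F i \<in> hset (tensor_power K i)" and G: "\<And>i. G i \<in> hset (tensor_power K i)"
  shows "tensor_mult F G n \<in> hset (tensor_power K n)"
    and "hip (tensor_power K n) (tensor_mult F G n) (tensor_mult F G n) \<le>
      real (Suc n) * (\<Sum>i\<le>n. hip (tensor_power K i) (F i) (F i) * hip (tensor_power K (n - i)) (G (n - i)) (G (n - i)))"
proof -
  have mem: "tensor i (F i) (G (n - i)) \<in> hset (tensor_power K n)"
    and norm: "hip (tensor_power K n) (tensor i (F i) (G (n - i))) (tensor i (F i) (G (n - i))) =
        hip (tensor_power K i) (F i) (F i) * hip (tensor_power K (n - i)) (G (n - i)) (G (n - i))" if "i \<le> n" for i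
    using tensor_in_tensor_power[OF F[of i] G[of "n - i"]] that by simp_all
  let ?t = "\<lambda>i. tensor i (F i) (G (n - i))" and ?N = "hnorm (tensor_power K n)"
  show m: "tensor_mult F G n \<in> hset (tensor_power K n)"
    unfolding tensor_mult_def using mem by (intro tensor.mem_sum) auto
  have "hip (tensor_power K n) (tensor_mult F G n) (tensor_mult F G n) = (?N (tensor_mult F G n))\<^sup>2"
    using tensor.norm_sq[OF m] by simp
  also have "\<dots> \<le> (\<Sum>i\<le>n. ?N (?t i))\<^sup>2"
    using tensor.norm_sum[of "{..n}" ?t n] tensor.norm_nonneg[OF m] mem
    by (intro power_mono) (auto simp: tensor_mult_def)
  also have "\<dots> \<le> (\<Sum>i\<le>n. (?N (?t i))\<^sup>2) * real (card {..n})"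
    by (rule sum_squared_le_sum_of_squares)
  also have "\<dots> = real (Suc n) * (\<Sum>i\<le>n. hip (tensor_power K i) (F i) (F i) * hip (tensor_power K (n - i)) (G (n - i)) (G (n - i)))"
    using mem norm by (simp add: tensor.norm_sq)
  finally show "hip (tensor_power K n) (tensor_mult F G n) (tensor_mult F G n) \<le>
      real (Suc n) * (\<Sum>i\<le>n. hip (tensor_power K i) (F i) (F i) * hip (tensor_power K (n - i)) (G (n - i)) (G (n - i)))" .
qed

text \<open>With \<open>n + 1 \<le> 2\<^sup>n\<close> the weight of level \<open>n\<close> for \<open>r\<close> is at most a product of weights of levels
  \<open>i\<close> and \<open>n - i\<close> for a larger \<open>r'\<close>, and the norm of a product is estimated by a Cauchy product.\<close>

lemma tensor_mult_bound:
  assumes q: "\<bar>q\<bar> < 1" and \<alpha>: "\<alpha> \<ge> 0" and r: "r \<ge> 1"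
  obtains r' where "r' \<ge> 1"
    "\<And>F G. F \<in> hset (G_space q K r' \<alpha>) \<Longrightarrow> G \<in> hset (G_space q K r' \<alpha>) \<Longrightarrow>
      tensor_mult F G \<in> hset (G_space q K r \<alpha>) \<and>
      hnorm (G_space q K r \<alpha>) (tensor_mult F G) \<le> hnorm (G_space q K r' \<alpha>) F * hnorm (G_space q K r' \<alpha>) G"
proof -
  obtain a b where ab: "a > 0" "b > 0"
    and lo: "\<And>r n. r \<ge> 0 \<Longrightarrow> (r * a) ^ n \<le> weight q r \<alpha> n"
    and up: "\<And>r n. r \<ge> 0 \<Longrightarrow> weight q r \<alpha> n \<le> (r * b) ^ n"
    using weight_bounds[OF q \<alpha>] by metis
  \<comment> \<open>the factor \<open>2\<close> pays for the \<open>n + 1\<close> summands of level \<open>n\<close>, and \<open>b / a\<close> for comparing the weights\<close>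
  define r' where "r' = max 1 (2 * r * b / a)"
  have r': "r' \<ge> 1" by (simp add: r'_def)
  have r'a: "2 * r * b \<le> r' * a" using ab by (simp add: r'_def pos_divide_le_eq[symmetric])
  let ?w = "weight q r' \<alpha>"
  have w0: "?w n \<ge> 0" for n using weight_pos[OF q, of r' \<alpha> n] r' by simp
  have ww: "weight q r \<alpha> n * real (Suc n) \<le> ?w i * ?w (n - i)" if "i \<le> n" for n i
  proof -
    have "weight q r \<alpha> n * real (Suc n) \<le> (r * b) ^ n * 2 ^ n"
    proof (rule mult_mono)
      have "Suc n \<le> 2 ^ n" by (induction n) auto
      then show "real (Suc n) \<le> 2 ^ n" by (metis of_nat_le_iff of_nat_numeral of_nat_power)
    qed (use up r ab in auto)
    also have "\<dots> = (2 * r * b) ^ n" by (simp add: power_mult_distrib)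
    also have "\<dots> \<le> (r' * a) ^ n" using r'a r ab by (intro power_mono) auto
    also have "\<dots> = (r' * a) ^ i * (r' * a) ^ (n - i)" using that by (simp add: power_add[symmetric])
    also have "\<dots> \<le> ?w i * ?w (n - i)" using lo r' ab w0 by (intro mult_mono) auto
    finally show ?thesis .
  qed
  show thesis
  proof (rule that[OF r'])
    fix F G assume F: "F \<in> hset (G_space q K r' \<alpha>)" and G: "G \<in> hset (G_space q K r' \<alpha>)"
    have Fm: "F i \<in> hset (tensor_power K i)" and Gm: "G i \<in> hset (tensor_power K i)" for i
      using F G by (auto simp: G_space_eq hset_hilbert_sum)
    define u where "u i = ?w i * hip (tensor_power K i) (F i) (F i)" for i
    define v where "v i = ?w i * hip (tensor_power K i) (G i) (G i)" for i
    have u0: "u i \<ge> 0" and v0: "v i \<ge> 0" for i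
      using w0 tensor.nonneg[OF Fm] tensor.nonneg[OF Gm] by (simp_all add: u_def v_def)
    have su: "summable u" and sv: "summable v"
      using F G by (auto simp: G_space_eq hset_hilbert_sum u_def[abs_def] v_def[abs_def])
    have uv: "(\<lambda>n. \<Sum>i\<le>n. u i * v (n - i)) sums (suminf u * suminf v)"
      using su sv u0 v0 by (intro Cauchy_product_sums) auto
    let ?M = "tensor_mult F G"
    have Mm: "?M n \<in> hset (tensor_power K n)" for n by (rule tensor_mult_level(1)[OF Fm Gm])
    have le: "weight q r \<alpha> n * hip (tensor_power K n) (?M n) (?M n) \<le> (\<Sum>i\<le>n. u i * v (n - i))" for n
    proof -
      let ?h = "\<lambda>i. hip (tensor_power K i) (F i) (F i)" and ?k = "\<lambda>i. hip (tensor_power K i) (G i) (G i)"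
      have "weight q r \<alpha> n * hip (tensor_power K n) (?M n) (?M n) \<le>
          weight q r \<alpha> n * (real (Suc n) * (\<Sum>i\<le>n. ?h i * ?k (n - i)))"
        using tensor_mult_level(2)[OF Fm Gm] weight_pos[OF q, of r \<alpha> n] r by (intro mult_left_mono) auto
      also have "\<dots> = (\<Sum>i\<le>n. (weight q r \<alpha> n * real (Suc n)) * (?h i * ?k (n - i)))"
        by (simp only: sum_distrib_left mult.assoc)
      also have "\<dots> \<le> (\<Sum>i\<le>n. (?w i * ?w (n - i)) * (?h i * ?k (n - i)))"
        using ww tensor.nonneg[OF Fm] tensor.nonneg[OF Gm] by (intro sum_mono mult_right_mono) auto
      also have "\<dots> = (\<Sum>i\<le>n. u i * v (n - i))" by (simp add: u_def v_def mult_ac)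
      finally show ?thesis .
    qed
    have sM: "summable (\<lambda>n. weight q r \<alpha> n * hip (tensor_power K n) (?M n) (?M n))"
    proof (rule summable_comparison_test'[OF sums_summable[OF uv]])
      show "norm (weight q r \<alpha> n * hip (tensor_power K n) (?M n) (?M n)) \<le> (\<Sum>i\<le>n. u i * v (n - i))" for n
        using le[of n] tensor.nonneg[OF Mm[of n]] weight_pos[OF q, of r \<alpha> n] r by simp
    qed
    have "tensor_mult F G \<in> hset (G_space q K r \<alpha>)"
      using sM Mm by (simp add: G_space_eq hset_hilbert_sum)
    moreover have "(\<Sum>n. weight q r \<alpha> n * hip (tensor_power K n) (?M n) (?M n)) \<le> suminf u * suminf v"
      unfolding sums_unique[OF uv] by (rule suminf_le[OF le sM sums_summable[OF uv]])
    then have "hnorm (G_space q K r \<alpha>) (tensor_mult F G) \<le> hnorm (G_space q K r' \<alpha>) F * hnorm (G_space q K r' \<alpha>) G"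
      unfolding hnorm_def G_space_eq hip_hilbert_sum weighted_level_sel real_sqrt_mult[symmetric]
      unfolding u_def[symmetric] v_def[symmetric] by (rule real_sqrt_le_mono)
    ultimately show "tensor_mult F G \<in> hset (G_space q K r \<alpha>) \<and>
      hnorm (G_space q K r \<alpha>) (tensor_mult F G) \<le> hnorm (G_space q K r' \<alpha>) F * hnorm (G_space q K r' \<alpha>) G" ..
  qed
qed

end

lemma bounded_bilinear_continuous_map:
  assumes A: "ip_space A" and B: "ip_space B"
    and mem: "\<And>x y. x \<in> hset A \<Longrightarrow> y \<in> hset A \<Longrightarrow> m x y \<in> hset B"
    and bd: "\<And>x y. x \<in> hset A \<Longrightarrow> y \<in> hset A \<Longrightarrow> hnorm B (m x y) \<le> hnorm A x * hnorm A y"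
    and dl: "\<And>x x' y. m (x - x') y = m x y - m x' y"
    and dr: "\<And>x y y'. m x (y - y') = m x y - m x y'"
  shows "continuous_map (prod_topology (htop A) (htop A)) (htop B) (\<lambda>(x, y). m x y)"
proof -
  interpret A: ip_space A by fact
  interpret B: ip_space B by fact
  show ?thesis
    unfolding B.continuous_map_into_htop
  proof (intro conjI ballI allI impI)
    show "(\<lambda>(x, y). m x y) ` topspace (prod_topology (htop A) (htop A)) \<subseteq> hset B"
      using mem by auto
    fix p and e :: real assume "p \<in> topspace (prod_topology (htop A) (htop A))" and e: "e > 0"
    then obtain x y where p: "p = (x, y)" and x: "x \<in> hset A" and y: "y \<in> hset A" by auto
    define s where "s = 1 + hnorm A x + hnorm A y"
    have s: "s \<ge> 1" using x y by (simp add: s_def)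
    define d where "d = min 1 (e / s)"
    have d: "d > 0" "d \<le> 1" "d * s \<le> e" using s e by (auto simp: d_def min_def field_simps)
    let ?U = "{u \<in> hset A. hnorm A (x - u) < d} \<times> {v \<in> hset A. hnorm A (y - v) < d}"
    show "\<exists>U. openin (prod_topology (htop A) (htop A)) U \<and> p \<in> U \<and>
        (\<forall>z\<in>U. hnorm B ((\<lambda>(x, y). m x y) p - (\<lambda>(x, y). m x y) z) < e)"
    proof (intro exI conjI ballI)
      show "openin (prod_topology (htop A) (htop A)) ?U"
        using x y by (simp add: openin_prod_Times_iff A.openin_ball)
      show "p \<in> ?U" using p x y d by simp
      fix z assume "z \<in> ?U"
      then obtain u v where z: "z = (u, v)" and u: "u \<in> hset A" "hnorm A (x - u) < d"
        and v: "v \<in> hset A" "hnorm A (y - v) < d" by auto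
      have vn: "hnorm A v \<le> hnorm A y + d"
        using A.norm_triangle[of y "v - y"] A.norm_minus_commute[of y v] y v by simp
      have "hnorm B (m x y - m u v) = hnorm B (m x (y - v) + m (x - u) v)" by (simp add: dl dr)
      also have "\<dots> \<le> hnorm B (m x (y - v)) + hnorm B (m (x - u) v)"
        using x y u v mem by (intro B.norm_triangle) auto
      also have "\<dots> \<le> hnorm A x * hnorm A (y - v) + hnorm A (x - u) * hnorm A v"
        using x y u v by (intro add_mono bd) auto
      also have "\<dots> \<le> hnorm A x * hnorm A (y - v) + hnorm A (x - u) * (hnorm A y + 1)"
        using vn d x u by (intro add_mono mult_left_mono) auto
      also have "\<dots> < hnorm A x * d + d * (hnorm A y + 1)"
        using x y u v by (intro add_le_less_mono mult_left_mono mult_strict_right_mono) (auto intro: add_nonneg_pos)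
      also have "\<dots> = d * s" by (simp add: s_def algebra_simps)
      also have "\<dots> \<le> e" by (rule d(3))
      finally show "hnorm B ((\<lambda>(x, y). m x y) p - (\<lambda>(x, y). m x y) z) < e" by (simp add: p z)
    qed
  qed
qed


section \<open>Embeddings, adjoints and pullbacks of forms\<close>

lemma separable_hilbert_space_hilbert: "separable_hilbert_space K \<Longrightarrow> hilbert K"
  by (simp add: separable_hilbert_space_def hilbert_def ip_space_def hilbert_axioms_def)

lemma linear_to_id: "linear_to V (\<lambda>x. x)"
  by (simp add: linear_to_def)

lemma hspace_embeddedD:
  assumes K': "hilbert K'" and K: "hilbert K" and emb: "hspace_embedded K' K"
  shows "hset K' \<subseteq> hset K"
    and "\<exists>C>0. \<forall>x\<in>hset K'. hnorm K x \<le> C * hnorm K' x"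
proof -
  interpret K': hilbert K' by fact
  interpret K: hilbert K by fact
  have c: "continuous_map (htop K') (htop K) (\<lambda>x. x)"
    using emb by (simp add: hspace_embedded_def dense_continuous_embedding_def)
  show "hset K' \<subseteq> hset K" using continuous_map_image_subset_topspace[OF c] by simp
  show "\<exists>C>0. \<forall>x\<in>hset K'. hnorm K x \<le> C * hnorm K' x"
    using continuous_linear_bounded[OF K'.ip_space_axioms K.ip_space_axioms linear_to_id c] by metis
qed

lemma hspace_embedded_refl: "hilbert K \<Longrightarrow> hspace_embedded K K"
proof -
  assume "hilbert K"
  then interpret hilbert K .
  show ?thesis
    using closure_full by (simp add: hspace_embedded_def dense_continuous_embedding_def)
qed

lemma embedding_adjoint_ex:
  assumes K': "hilbert K'" and K: "hilbert K" and emb: "hspace_embedded K' K" and y: "y \<in> hset K"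
  shows "\<exists>z\<in>hset K'. \<forall>x\<in>hset K'. hip K' x z = hip K x y"
proof -
  interpret K': hilbert K' by fact
  interpret K: hilbert K by fact
  note sub = hspace_embeddedD(1)[OF K' K emb]
  obtain C where C: "C > 0" "\<And>x. x \<in> hset K' \<Longrightarrow> hnorm K x \<le> C * hnorm K' x"
    using hspace_embeddedD(2)[OF K' K emb] by blast
  have lin: "linear_to (hset K') (\<lambda>x. hip K x y)"
    using sub y by (auto simp: linear_to_def K.add_left K.scale_left subset_iff)
  have "\<bar>hip K x y\<bar> \<le> (C * hnorm K y) * hnorm K' x" if x: "x \<in> hset K'" for x
  proof -
    have "\<bar>hip K x y\<bar> \<le> hnorm K x * hnorm K y" using K.cauchy_schwarz[of x y] sub x y by blast
    also have "\<dots> \<le> (C * hnorm K' x) * hnorm K y" using C(2)[OF x] y by (intro mult_right_mono) auto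
    finally show ?thesis by (simp add: mult_ac)
  qed
  from K'.riesz[OF lin this] show ?thesis by metis
qed

lemma embedding_adjoint:
  assumes K': "hilbert K'" and K: "hilbert K" and emb: "hspace_embedded K' K" and y: "y \<in> hset K"
  shows "hadjoint K' K (\<lambda>x. x) y \<in> hset K'"
    and "x \<in> hset K' \<Longrightarrow> hip K' x (hadjoint K' K (\<lambda>x. x) y) = hip K x y"
proof -
  interpret K': hilbert K' by fact
  let ?P = "\<lambda>z. z \<in> hset K' \<and> (\<forall>x\<in>hset K'. hip K' x z = hip K x y)"
  obtain z where z: "?P z" using embedding_adjoint_ex[OF K' K emb y] by blast
  have uniq: "w = z" if w: "?P w" for w
  proof -
    have "hip K' (w - z) (w - z) = 0" using w z by (simp add: K'.diff_right)
    then show ?thesis using w z K'.eq_zero_iff[of "w - z"] by simp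
  qed
  have "?P (hadjoint K' K (\<lambda>x. x) y)"
    unfolding hadjoint_def using z uniq by (rule theI)
  then show "hadjoint K' K (\<lambda>x. x) y \<in> hset K'"
    and "x \<in> hset K' \<Longrightarrow> hip K' x (hadjoint K' K (\<lambda>x. x) y) = hip K x y"
    by blast+
qed

lemma hadjoint_self:
  assumes K: "hilbert K" and y: "y \<in> hset K"
  shows "hadjoint K K (\<lambda>x. x) y = y"
proof -
  interpret K: hilbert K by fact
  note adj = embedding_adjoint[OF K K hspace_embedded_refl[OF K] y]
  have "hip K (hadjoint K K (\<lambda>x. x) y - y) (hadjoint K K (\<lambda>x. x) y - y) = 0"
    using adj y by (simp add: K.diff_right)
  then show ?thesis using adj(1) y K.eq_zero_iff[of "hadjoint K K (\<lambda>x. x) y - y"] by simp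
qed

lemma tensor_map_self:
  assumes K: "hilbert K" and S: "S \<in> hset (tensor_power K n)"
  shows "tensor_map K K (\<lambda>x. x) n S = S"
proof
  fix ys
  show "tensor_map K K (\<lambda>x. x) n S ys = S ys"
  proof (cases "ys \<in> tuples (hset K) n")
    case True
    then have "map (hadjoint K K (\<lambda>x. x)) ys = ys"
      using hadjoint_self[OF K] by (intro map_idI) (auto simp: tuples_def)
    then show ?thesis using True by (simp add: tensor_map_def)
  qed (simp add: tensor_map_def multilinear_form_off[OF S])
qed

text \<open>If \<open>a\<close> is the adjoint of a map, this is the tensor power of that map.\<close>

definition pullback :: "'b hspace \<Rightarrow> ('b \<Rightarrow> 'a) \<Rightarrow> nat \<Rightarrow> ('a list \<Rightarrow> real) \<Rightarrow> 'b list \<Rightarrow> real"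
  where "pullback K a n S = (\<lambda>ks. if ks \<in> tuples (hset K) n then S (map a ks) else 0)"

text \<open>The Bessel inequality for the image of an orthonormal basis under \<open>a\<close> is the boundedness of
  the adjoint of \<open>a\<close>.\<close>

lemma pullback_tensor_power:
  assumes K: "hilbert K" and L: "hilbert L"
    and lin: "linear_to (hset K) a" and im: "\<And>k. k \<in> hset K \<Longrightarrow> a k \<in> hset L"
    and bd: "\<And>k. k \<in> hset K \<Longrightarrow> hnorm L (a k) \<le> C * hnorm K k" and C: "C \<ge> 0"
    and S: "S \<in> hset (tensor_power L n)"
  shows "pullback K a n S \<in> hset (tensor_power K n)"
    and "hip (tensor_power K n) (pullback K a n S) (pullback K a n S) \<le> (C\<^sup>2) ^ n * hip (tensor_power L n) S S"
proof -
  interpret K: hilbert K by fact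
  interpret L: hilbert L by fact
  let ?E = "some_basis K" and ?F = "some_basis L"
  have Sm: "multilinear_form L n S" and Sb: "bounded_form L n S"
    and Ss: "(\<lambda>fs. (S fs)\<^sup>2) summable_on tuples ?F n"
    using S by (auto simp: hset_tensor_power)
  have mapt: "map a ks \<in> tuples (hset L) n" if "ks \<in> tuples (hset K) n" for ks
    using map_in_tuples[OF im that] .
  have "multilinear_form K n (pullback K a n S)"
    unfolding multilinear_form_def
  proof (intro conjI allI impI ballI)
    fix ks i x y b c
    assume ks: "ks \<in> tuples (hset K) n" and i: "i < n" and xy: "x \<in> hset K" "y \<in> hset K"
    have "a (b *\<^sub>R x + c *\<^sub>R y) = b *\<^sub>R a x + c *\<^sub>R a y"
      using xy by (simp add: linear_toD[OF lin])
    then show "pullback K a n S (ks[i := b *\<^sub>R x + c *\<^sub>R y]) =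
        b * pullback K a n S (ks[i := x]) + c * pullback K a n S (ks[i := y])"
      using xy multilinear_formD(2)[OF Sm mapt[OF ks] i im[OF xy(1)] im[OF xy(2)], of b c]
      by (simp add: pullback_def tuples_update[OF ks] map_update)
  qed (simp add: pullback_def)
  moreover have "bounded_form K n (pullback K a n S)"
  proof -
    obtain D where D: "\<And>ys. ys \<in> tuples (hset L) n \<Longrightarrow> \<bar>S ys\<bar> \<le> D * prod_list (map (hnorm L) ys)"
      using Sb unfolding bounded_form_def by blast
    have prod: "0 \<le> prod_list (map (hnorm L) (map a ks)) \<and>
        prod_list (map (hnorm L) (map a ks)) \<le> C ^ length ks * prod_list (map (hnorm K) ks)"
      if "set ks \<subseteq> hset K" for ks
      using that
    proof (induction ks)
      case (Cons k ks)
      let ?p = "prod_list (map (hnorm L) (map a ks))" and ?r = "prod_list (map (hnorm K) ks)"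
      have k: "k \<in> hset K" and IH: "0 \<le> ?p" "?p \<le> C ^ length ks * ?r" using Cons by auto
      have "hnorm L (a k) * ?p \<le> (C * hnorm K k) * (C ^ length ks * ?r)"
        using bd[OF k] IH C k by (intro mult_mono) auto
      then show ?case using IH im[OF k] by (simp add: mult_ac)
    qed simp
    have "\<bar>pullback K a n S ks\<bar> \<le> (\<bar>D\<bar> * C ^ n) * prod_list (map (hnorm K) ks)"
      if ks: "ks \<in> tuples (hset K) n" for ks
    proof -
      have p: "0 \<le> prod_list (map (hnorm L) (map a ks))"
        "prod_list (map (hnorm L) (map a ks)) \<le> C ^ n * prod_list (map (hnorm K) ks)"
        using prod[of ks] ks by (auto simp: tuples_def)
      have "\<bar>S (map a ks)\<bar> \<le> \<bar>D\<bar> * prod_list (map (hnorm L) (map a ks))"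
        using D[OF mapt[OF ks]] mult_right_mono[OF abs_ge_self[of D] p(1)] by linarith
      also have "\<dots> \<le> \<bar>D\<bar> * (C ^ n * prod_list (map (hnorm K) ks))" using p(2) by (rule mult_left_mono) simp
      finally show ?thesis using ks by (simp add: pullback_def mult.assoc)
    qed
    then show ?thesis unfolding bounded_form_def by blast
  qed
  moreover have bessel: "(\<lambda>es. (S (map a es))\<^sup>2) summable_on tuples ?E n \<and>
      (\<Sum>\<^sub>\<infinity>es\<in>tuples ?E n. (S (map a es))\<^sup>2) \<le> (C\<^sup>2) ^ n * (\<Sum>\<^sub>\<infinity>fs\<in>tuples ?F n. (S fs)\<^sup>2)"
  proof (rule hilbert_schmidt_form_bessel[OF L.basis_subset _ _ _ _ L.tensor_power_slots[OF S] Ss])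
    show "a e \<in> hset L" if "e \<in> ?E" for e using that K.basis_subset im by blast
    fix x assume x: "x \<in> hset L"
    have lx: "linear_to (hset K) (\<lambda>k. hip L x (a k))"
      using x im by (simp add: linear_to_def linear_toD[OF lin] L.add_right L.scale_right)
    have "\<bar>hip L x (a k)\<bar> \<le> (C * hnorm L x) * hnorm K k" if k: "k \<in> hset K" for k
      using order_trans[OF L.cauchy_schwarz[OF x im[OF k]] mult_left_mono[OF bd[OF k] L.norm_nonneg[OF x]]]
      by (simp add: mult_ac)
    moreover have "C * hnorm L x \<ge> 0" using C x by simp
    ultimately obtain z where z: "z \<in> htop K closure_of (hset K)" "\<And>k. k \<in> hset K \<Longrightarrow> hip L x (a k) = hip K k z"
        "hnorm K z \<le> C * hnorm L x"
      using K.riesz_subspace[OF K.subspace_hset subset_refl lx] by metis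
    have zK: "z \<in> hset K" using z(1) by (simp add: K.closure_full)
    have hs: "((\<lambda>e. (hip L x (a e))\<^sup>2) has_sum hip K z z) ?E"
    proof -
      have "((\<lambda>e. (hip L x (a e))\<^sup>2) has_sum hip K z z) ?E \<longleftrightarrow> ((\<lambda>e. (hip K z e)\<^sup>2) has_sum hip K z z) ?E"
        using K.basis_subset z(2) K.commute[OF zK] by (intro has_sum_cong) (auto simp: subset_iff)
      then show ?thesis using K.parseval[OF K.some_basis zK] by simp
    qed
    then show "(\<lambda>e. (hip L x (a e))\<^sup>2) summable_on ?E" by (rule has_sum_imp_summable)
    have "hip K z z \<le> (C * hnorm L x)\<^sup>2"
      using power_mono[OF z(3) K.norm_nonneg[OF zK], of 2] K.norm_sq[OF zK] by simp
    also have "\<dots> = C\<^sup>2 * (\<Sum>\<^sub>\<infinity>f\<in>?F. (hip L x f)\<^sup>2)"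
      using infsumI[OF L.parseval[OF L.some_basis x]] L.norm_sq[OF x] by (simp add: power_mult_distrib)
    finally show "(\<Sum>\<^sub>\<infinity>e\<in>?E. (hip L x (a e))\<^sup>2) \<le> C\<^sup>2 * (\<Sum>\<^sub>\<infinity>f\<in>?F. (hip L x f)\<^sup>2)"
      using infsumI[OF hs] by simp
  qed simp
  have tE: "es \<in> tuples (hset K) n" if "es \<in> tuples ?E n" for es
    using that tuples_mono[OF K.basis_subset] by blast
  have "(\<lambda>es. (pullback K a n S es)\<^sup>2) summable_on tuples ?E n \<longleftrightarrow> (\<lambda>es. (S (map a es))\<^sup>2) summable_on tuples ?E n"
    by (rule summable_on_cong) (simp add: pullback_def tE)
  ultimately show "pullback K a n S \<in> hset (tensor_power K n)"
    using bessel by (simp add: hset_tensor_power)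
  have "(\<Sum>\<^sub>\<infinity>es\<in>tuples ?E n. pullback K a n S es * pullback K a n S es) = (\<Sum>\<^sub>\<infinity>es\<in>tuples ?E n. (S (map a es))\<^sup>2)"
    by (rule infsum_cong) (simp add: pullback_def tE power2_eq_square)
  then show "hip (tensor_power K n) (pullback K a n S) (pullback K a n S) \<le> (C\<^sup>2) ^ n * hip (tensor_power L n) S S"
    using bessel by (simp add: hip_tensor_power power2_eq_square)
qed


section \<open>Nuclear families\<close>

locale nuclear =
  fixes T :: "'i set" and H :: "'i \<Rightarrow> 'v::real_vector hspace"
  assumes nuclear_family: "nuclear_family T H"
begin

abbreviation \<Phi> :: "'v set" where "\<Phi> \<equiv> nuclear_set T H"

lemma hilbert_H: "\<tau> \<in> T \<Longrightarrow> hilbert (H \<tau>)"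
  using nuclear_family by (simp add: nuclear_family_def separable_hilbert_space_hilbert)

lemma directed:
  assumes "\<tau>1 \<in> T" "\<tau>2 \<in> T"
  obtains \<tau>3 where "\<tau>3 \<in> T" "hspace_embedded (H \<tau>3) (H \<tau>1)" "hspace_embedded (H \<tau>3) (H \<tau>2)"
  using nuclear_family assms unfolding nuclear_family_def by meson

lemma nonempty: "T \<noteq> {}"
  using nuclear_family by (simp add: nuclear_family_def)

lemma nuclear_set_subset: "\<tau> \<in> T \<Longrightarrow> \<Phi> \<subseteq> hset (H \<tau>)"
  by (auto simp: nuclear_set_def)

lemma subspace_nuclear_set: "subspace \<Phi>"
  unfolding nuclear_set_def
  using hilbert_H hilbert.axioms(1) ip_space.subspace_hset by (intro subspace_Inter) blast

text \<open>A basic open set involves finitely many norms, and by directedness a single one dominates them.\<close>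

lemma openin_nuclear_topology_ball:
  assumes U: "openin (nuclear_topology T H) U" and x: "x \<in> U"
  shows "\<exists>\<tau>\<in>T. \<exists>d>0. \<forall>y\<in>\<Phi>. hnorm (H \<tau>) (x - y) < d \<longrightarrow> y \<in> U"
proof -
  have "generate_topology_on (insert \<Phi> {\<Phi> \<inter> (\<lambda>x. x) -` U | \<tau> U. \<tau> \<in> T \<and> openin (htop (H \<tau>)) U}) U"
    using U unfolding nuclear_topology_def initial_topology_def openin_topology_generated_by_iff .
  then have "U \<subseteq> \<Phi> \<and> (\<forall>x\<in>U. \<exists>\<tau>\<in>T. \<exists>d>0. \<forall>y\<in>\<Phi>. hnorm (H \<tau>) (x - y) < d \<longrightarrow> y \<in> U)"
  proof induction
    case (Int a b)
    show ?case
    proof (intro conjI ballI)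
      show "a \<inter> b \<subseteq> \<Phi>" using Int by blast
      fix x assume x: "x \<in> a \<inter> b"
      obtain \<tau>1 d1 where 1: "\<tau>1 \<in> T" "d1 > 0" "\<And>y. y \<in> \<Phi> \<Longrightarrow> hnorm (H \<tau>1) (x - y) < d1 \<Longrightarrow> y \<in> a"
        using Int x by (metis IntE)
      obtain \<tau>2 d2 where 2: "\<tau>2 \<in> T" "d2 > 0" "\<And>y. y \<in> \<Phi> \<Longrightarrow> hnorm (H \<tau>2) (x - y) < d2 \<Longrightarrow> y \<in> b"
        using Int x by (metis IntE)
      obtain \<tau> where \<tau>: "\<tau> \<in> T" and e: "hspace_embedded (H \<tau>) (H \<tau>1)" "hspace_embedded (H \<tau>) (H \<tau>2)"
        using directed[OF 1(1) 2(1)] by blast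
      obtain C1 where C1: "C1 > 0" "\<And>x. x \<in> hset (H \<tau>) \<Longrightarrow> hnorm (H \<tau>1) x \<le> C1 * hnorm (H \<tau>) x"
        using hspace_embeddedD(2)[OF hilbert_H[OF \<tau>] hilbert_H[OF 1(1)] e(1)] by blast
      obtain C2 where C2: "C2 > 0" "\<And>x. x \<in> hset (H \<tau>) \<Longrightarrow> hnorm (H \<tau>2) x \<le> C2 * hnorm (H \<tau>) x"
        using hspace_embeddedD(2)[OF hilbert_H[OF \<tau>] hilbert_H[OF 2(1)] e(2)] by blast
      have "y \<in> a \<inter> b" if y: "y \<in> \<Phi>" and n: "hnorm (H \<tau>) (x - y) < min (d1 / C1) (d2 / C2)" for y
      proof -
        have "x \<in> \<Phi>" using x Int by blast
        then have xy: "x - y \<in> hset (H \<tau>)"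
          using subspace_diff[OF subspace_nuclear_set _ y] nuclear_set_subset[OF \<tau>] by blast
        have "C1 * hnorm (H \<tau>) (x - y) < d1" "C2 * hnorm (H \<tau>) (x - y) < d2"
          using n C1(1) C2(1) by (simp_all add: field_simps)
        then have "hnorm (H \<tau>1) (x - y) < d1" "hnorm (H \<tau>2) (x - y) < d2"
          using C1(2)[OF xy] C2(2)[OF xy] by linarith+
        then show ?thesis using 1(3) 2(3) y by blast
      qed
      moreover have "min (d1 / C1) (d2 / C2) > 0" using 1 2 C1 C2 by simp
      ultimately show "\<exists>\<tau>\<in>T. \<exists>d>0. \<forall>y\<in>\<Phi>. hnorm (H \<tau>) (x - y) < d \<longrightarrow> y \<in> a \<inter> b"
        using \<tau> by blast
    qed
  next
    case (UN \<K>)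
    show ?case
    proof (intro conjI ballI)
      show "\<Union>\<K> \<subseteq> \<Phi>" using UN by blast
      fix x assume "x \<in> \<Union>\<K>"
      then obtain k where k: "k \<in> \<K>" "x \<in> k" by blast
      then obtain \<tau> d where "\<tau> \<in> T" "d > 0" "\<forall>y\<in>\<Phi>. hnorm (H \<tau>) (x - y) < d \<longrightarrow> y \<in> k" using UN by meson
      then show "\<exists>\<tau>\<in>T. \<exists>d>0. \<forall>y\<in>\<Phi>. hnorm (H \<tau>) (x - y) < d \<longrightarrow> y \<in> \<Union>\<K>" using k by blast
    qed
  next
    case (Basis s)
    then consider "s = \<Phi>" | \<tau> W where "\<tau> \<in> T" "openin (htop (H \<tau>)) W" "s = \<Phi> \<inter> W" by auto
    then show ?case
    proof cases
      case 1
      then show ?thesis using nonempty by (auto intro: exI[of _ 1])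
    next
      case 2
      interpret H: hilbert "H \<tau>" by (rule hilbert_H[OF 2(1)])
      show ?thesis
      proof (intro conjI ballI)
        fix x assume "x \<in> s"
        then obtain d where "d > 0" "\<forall>y\<in>hset (H \<tau>). hnorm (H \<tau>) (x - y) < d \<longrightarrow> y \<in> W"
          using 2(2,3) unfolding H.openin_htop by blast
        then show "\<exists>\<tau>\<in>T. \<exists>d>0. \<forall>y\<in>\<Phi>. hnorm (H \<tau>) (x - y) < d \<longrightarrow> y \<in> s"
          using 2 nuclear_set_subset[OF 2(1)] by blast
      qed (use 2 in blast)
    qed
  qed simp
  then show ?thesis using x by blast
qed

lemma continuous_linear_nuclear_bounded:
  assumes K: "ip_space K" and lin: "linear_to \<Phi> f"
    and c: "continuous_map (nuclear_topology T H) (htop K) f"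
  obtains \<tau> C where "\<tau> \<in> T" "C > 0" "\<And>x. x \<in> \<Phi> \<Longrightarrow> hnorm K (f x) \<le> C * hnorm (H \<tau>) x"
proof -
  interpret K: ip_space K by fact
  have top: "topspace (nuclear_topology T H) = \<Phi>" by (simp add: nuclear_topology_def)
  have f0: "f 0 = 0" by (rule linear_to_zero[OF lin subspace_nuclear_set])
  have fK: "f x \<in> hset K" if "x \<in> \<Phi>" for x
    using continuous_map_image_subset_topspace[OF c] that by (auto simp: top)
  have "0 \<in> \<Phi>" by (rule subspace_0[OF subspace_nuclear_set])
  then obtain U where U: "openin (nuclear_topology T H) U" "0 \<in> U" "\<And>y. y \<in> U \<Longrightarrow> hnorm K (f 0 - f y) < 1"
    using c unfolding K.continuous_map_into_htop top by (metis zero_less_one)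
  obtain \<tau> d where \<tau>: "\<tau> \<in> T" and d: "d > 0" "\<And>y. y \<in> \<Phi> \<Longrightarrow> hnorm (H \<tau>) (0 - y) < d \<Longrightarrow> y \<in> U"
    using openin_nuclear_topology_ball[OF U(1,2)] by blast
  interpret H: hilbert "H \<tau>" by (rule hilbert_H[OF \<tau>])
  have sub: "x \<in> hset (H \<tau>)" if "x \<in> \<Phi>" for x using nuclear_set_subset[OF \<tau>] that by blast
  have small: "hnorm K (f y) < 1" if y: "y \<in> \<Phi>" and n: "hnorm (H \<tau>) y < d" for y
    using U(3)[OF d(2)[OF y]] n H.norm_minus_commute[OF H.mem_0 sub[OF y]]
      K.norm_minus_commute[OF K.mem_0 fK[OF y]] by (simp add: f0)
  have "hnorm K (f x) \<le> (1 / d) * hnorm (H \<tau>) x" if x: "x \<in> \<Phi>" for x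
  proof (rule field_le_epsilon)
    fix e :: real assume e: "e > 0"
    define s where "s = hnorm (H \<tau>) x + d * e"
    have s: "s > 0" using d e H.norm_nonneg[OF sub[OF x]] by (simp add: s_def add_nonneg_pos)
    define c where "c = d / s"
    have c: "c > 0" using d s by (simp add: c_def)
    have "hnorm (H \<tau>) (c *\<^sub>R x) < d"
      using s d e H.norm_nonneg[OF sub[OF x]] by (simp add: H.norm_scale[OF sub[OF x]] c_def pos_divide_less_eq s_def)
    then have "hnorm K (f (c *\<^sub>R x)) < 1"
      using small x by (simp add: subspace_scale[OF subspace_nuclear_set])
    then have "c * hnorm K (f x) < 1"
      using c by (simp add: linear_toD(2)[OF lin x] K.norm_scale[OF fK[OF x]])
    then have "hnorm K (f x) < s / d" using s d by (simp add: c_def field_simps)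
    also have "s / d = (1 / d) * hnorm (H \<tau>) x + e" using d by (simp add: s_def field_simps)
    finally show "hnorm K (f x) \<le> (1 / d) * hnorm (H \<tau>) x + e" by simp
  qed
  then show thesis using that[OF \<tau>, of "1 / d"] d by simp
qed

end


section \<open>The projective limit of the weighted spaces\<close>

locale weighted_nuclear = nuclear T H
  for T :: "'i set" and H :: "'i \<Rightarrow> 'v::real_vector hspace" +
  fixes q \<alpha> :: real
  assumes q: "\<bar>q\<bar> < 1" and \<alpha>: "\<alpha> \<ge> 0"
begin

abbreviation \<G> :: "('i \<times> real \<Rightarrow> nat \<Rightarrow> 'v list \<Rightarrow> real) topology"
  where "\<G> \<equiv> G_nuclear q T H \<alpha>"

lemma ip_space_G: "\<tau> \<in> T \<Longrightarrow> r \<ge> 1 \<Longrightarrow> ip_space (G_space q (H \<tau>) r \<alpha>)"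
  using hilbert.ip_space_G_space[OF hilbert_H q, of \<tau> r \<alpha>] by simp

lemma mem_\<G>_iff:
  "F \<in> topspace \<G> \<longleftrightarrow>
    (\<forall>j. j \<notin> T \<times> {1..} \<longrightarrow> F j = 0) \<and>
    (\<forall>\<tau>\<in>T. \<forall>r\<ge>1. F (\<tau>, r) \<in> hset (G_space q (H \<tau>) r \<alpha>)) \<and>
    (\<forall>\<tau>\<in>T. \<forall>\<tau>'\<in>T. \<forall>r r'. 1 \<le> r \<longrightarrow> r \<le> r' \<longrightarrow> hspace_embedded (H \<tau>') (H \<tau>) \<longrightarrow>
       (\<forall>n. F (\<tau>, r) n = tensor_map (H \<tau>') (H \<tau>) (\<lambda>x. x) n (F (\<tau>', r') n)))"
  (is "_ \<longleftrightarrow> ?off \<and> ?mem \<and> ?link")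
proof -
  let ?I = "T \<times> {1::real..}"
  have "F \<in> topspace \<G> \<longleftrightarrow> ?off \<and> (\<forall>i\<in>?I. F i \<in> hset (case i of (\<tau>, r) \<Rightarrow> G_space q (H \<tau>) r \<alpha>)) \<and>
      (\<forall>i\<in>?I. \<forall>j\<in>?I. G_le H i j \<longrightarrow> F i = G_link H i j (F j))"
    unfolding G_nuclear_def proj_lim_def topspace_initial_topology proj_lim_set_def by simp
  also have "(\<forall>i\<in>?I. F i \<in> hset (case i of (\<tau>, r) \<Rightarrow> G_space q (H \<tau>) r \<alpha>)) \<longleftrightarrow> ?mem" by auto
  also have "(\<forall>i\<in>?I. \<forall>j\<in>?I. G_le H i j \<longrightarrow> F i = G_link H i j (F j)) \<longleftrightarrow> ?link"
  proof
    assume a: "\<forall>i\<in>?I. \<forall>j\<in>?I. G_le H i j \<longrightarrow> F i = G_link H i j (F j)"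
    show ?link
    proof (intro ballI allI impI)
      fix \<tau> \<tau>' and r r' :: real and n
      assume t: "\<tau> \<in> T" "\<tau>' \<in> T" "1 \<le> r" "r \<le> r'" "hspace_embedded (H \<tau>') (H \<tau>)"
      then have "F (\<tau>, r) = G_link H (\<tau>, r) (\<tau>', r') (F (\<tau>', r'))"
        by (intro a[rule_format]) (auto simp: G_le_def)
      then show "F (\<tau>, r) n = tensor_map (H \<tau>') (H \<tau>) (\<lambda>x. x) n (F (\<tau>', r') n)"
        by (simp add: G_link_def)
    qed
  next
    assume l: ?link
    show "\<forall>i\<in>?I. \<forall>j\<in>?I. G_le H i j \<longrightarrow> F i = G_link H i j (F j)"
    proof (intro ballI impI)
      fix i j assume ij: "i \<in> ?I" "j \<in> ?I" "G_le H i j"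
      obtain \<tau> r where i: "i = (\<tau>, r)" by fastforce
      obtain \<tau>' r' where j: "j = (\<tau>', r')" by fastforce
      show "F i = G_link H i j (F j)"
        using l[rule_format, of \<tau> \<tau>' r r'] ij by (auto simp: i j G_le_def G_link_def fun_eq_iff)
    qed
  qed
  finally show ?thesis .
qed

lemma \<G>_off: "F \<in> topspace \<G> \<Longrightarrow> j \<notin> T \<times> {1..} \<Longrightarrow> F j = 0"
  unfolding mem_\<G>_iff by blast

lemma \<G>_mem: "F \<in> topspace \<G> \<Longrightarrow> \<tau> \<in> T \<Longrightarrow> r \<ge> 1 \<Longrightarrow> F (\<tau>, r) \<in> hset (G_space q (H \<tau>) r \<alpha>)"
  unfolding mem_\<G>_iff by blast

lemma \<G>_link:
  "F \<in> topspace \<G> \<Longrightarrow> \<tau> \<in> T \<Longrightarrow> \<tau>' \<in> T \<Longrightarrow> 1 \<le> r \<Longrightarrow> r \<le> r' \<Longrightarrow> hspace_embedded (H \<tau>') (H \<tau>) \<Longrightarrow>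
    F (\<tau>, r) n = tensor_map (H \<tau>') (H \<tau>) (\<lambda>x. x) n (F (\<tau>', r') n)"
  unfolding mem_\<G>_iff by blast

lemma \<G>_level: "F \<in> topspace \<G> \<Longrightarrow> \<tau> \<in> T \<Longrightarrow> r \<ge> 1 \<Longrightarrow> F (\<tau>, r) n \<in> hset (tensor_power (H \<tau>) n)"
  using \<G>_mem by (simp add: G_space_eq hset_hilbert_sum)

text \<open>The transition from \<open>r'\<close> to \<open>r\<close> is composition with the adjoint of the identity. So an element may
  be estimated with any \<open>r'\<close> when its component at \<open>r\<close> is concerned.\<close>

lemma \<G>_radius:
  assumes F: "F \<in> topspace \<G>" and \<tau>: "\<tau> \<in> T" and r: "1 \<le> r" "1 \<le> r'"
  shows "F (\<tau>, r) = F (\<tau>, r')"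
proof -
  have "F (\<tau>, s) = F (\<tau>, s')" if s: "1 \<le> s" "s \<le> s'" for s s'
  proof
    fix n
    have s': "1 \<le> s'" using s by simp
    have "F (\<tau>, s) n = tensor_map (H \<tau>) (H \<tau>) (\<lambda>x. x) n (F (\<tau>, s') n)"
      by (rule \<G>_link[OF F \<tau> \<tau> s hspace_embedded_refl[OF hilbert_H[OF \<tau>]]])
    then show "F (\<tau>, s) n = F (\<tau>, s') n"
      by (simp add: tensor_map_self[OF hilbert_H[OF \<tau>] \<G>_level[OF F \<tau> s']])
  qed
  then show ?thesis using r by (metis linear)
qed

lemma subspace_\<G>: "subspace (topspace \<G>)"
proof -
  have G0: "subspace (hset (G_space q (H \<tau>) r \<alpha>))" if "\<tau> \<in> T" "r \<ge> 1" for \<tau> r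
    using ip_space.subspace_hset[OF ip_space_G[OF that]] .
  have tm: "tensor_map K L A n 0 = 0" "tensor_map K L A n (S + R) = tensor_map K L A n S + tensor_map K L A n R"
    "tensor_map K L A n (c *\<^sub>R S) = c *\<^sub>R tensor_map K L A n S"
    for K L :: "'v hspace" and A n S R c
    by (auto simp: tensor_map_def fun_eq_iff)
  show ?thesis
    unfolding subspace_def
  proof (intro conjI ballI allI)
    show "0 \<in> topspace \<G>"
      unfolding mem_\<G>_iff using subspace_0[OF G0] by (simp add: tm)
    fix F assume F: "F \<in> topspace \<G>"
    show "F + F' \<in> topspace \<G>" if F': "F' \<in> topspace \<G>" for F'
      unfolding mem_\<G>_iff
    proof (intro conjI ballI allI impI)
      show "(F + F') j = 0" if "j \<notin> T \<times> {1..}" for j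
        using \<G>_off[OF F that] \<G>_off[OF F' that] by simp
      show "(F + F') (\<tau>, r) \<in> hset (G_space q (H \<tau>) r \<alpha>)" if "\<tau> \<in> T" "1 \<le> r" for \<tau> r
        using subspace_add[OF G0[OF that] \<G>_mem[OF F that] \<G>_mem[OF F' that]] by simp
      show "(F + F') (\<tau>, r) n = tensor_map (H \<tau>') (H \<tau>) (\<lambda>x. x) n ((F + F') (\<tau>', r') n)"
        if "\<tau> \<in> T" "\<tau>' \<in> T" "1 \<le> r" "r \<le> r'" "hspace_embedded (H \<tau>') (H \<tau>)" for \<tau> \<tau>' r r' n
        using \<G>_link[OF F that, of n] \<G>_link[OF F' that, of n] by (simp add: tm)
    qed
    show "c *\<^sub>R F \<in> topspace \<G>" for c
      unfolding mem_\<G>_iff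
    proof (intro conjI ballI allI impI)
      show "(c *\<^sub>R F) j = 0" if "j \<notin> T \<times> {1..}" for j
        using \<G>_off[OF F that] by simp
      show "(c *\<^sub>R F) (\<tau>, r) \<in> hset (G_space q (H \<tau>) r \<alpha>)" if "\<tau> \<in> T" "1 \<le> r" for \<tau> r
        using subspace_scale[OF G0[OF that] \<G>_mem[OF F that], of c] by simp
      show "(c *\<^sub>R F) (\<tau>, r) n = tensor_map (H \<tau>') (H \<tau>) (\<lambda>x. x) n ((c *\<^sub>R F) (\<tau>', r') n)"
        if "\<tau> \<in> T" "\<tau>' \<in> T" "1 \<le> r" "r \<le> r'" "hspace_embedded (H \<tau>') (H \<tau>)" for \<tau> \<tau>' r r' n
        using \<G>_link[OF F that, of n] by (simp add: tm)
    qed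
  qed
qed

text \<open>This is the point that makes the embedding into the Fock space injective. Two components of a
  compatible family are represented by the same vector in each single argument, because the
  transition between them is composition with the adjoint of an inclusion; that vector therefore
  lies in all the spaces \<open>H \<tau>\<close>.\<close>

lemma \<G>_slots:
  assumes F: "F \<in> topspace \<G>" and \<tau>: "\<tau> \<in> T" and r: "r \<ge> 1"
  shows "slots_in (H \<tau>) \<Phi> n (F (\<tau>, r) n)"
  unfolding slots_in_def
proof (intro ballI allI impI)
  fix ys i assume ys: "ys \<in> tuples (hset (H \<tau>)) n" and i: "i < n"
  interpret H: hilbert "H \<tau>" by (rule hilbert_H[OF \<tau>])
  obtain x where x: "x \<in> hset (H \<tau>)" "\<And>z. z \<in> hset (H \<tau>) \<Longrightarrow> F (\<tau>, r) n (ys[i := z]) = hip (H \<tau>) x z"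
    using H.tensor_power_slots[OF \<G>_level[OF F \<tau> r]] ys i unfolding slots_in_def by blast
  have "x \<in> hset (H \<sigma>)" if \<sigma>: "\<sigma> \<in> T" for \<sigma>
  proof -
    obtain \<rho> where \<rho>: "\<rho> \<in> T" and e: "hspace_embedded (H \<rho>) (H \<tau>)" and e': "hspace_embedded (H \<rho>) (H \<sigma>)"
      using directed[OF \<tau> \<sigma>] by blast
    interpret R: hilbert "H \<rho>" by (rule hilbert_H[OF \<rho>])
    let ?a = "hadjoint (H \<rho>) (H \<tau>) (\<lambda>x. x)"
    note adj = embedding_adjoint[OF hilbert_H[OF \<rho>] hilbert_H[OF \<tau>] e]
    have "map ?a ys \<in> tuples (hset (H \<rho>)) n" using map_in_tuples[OF adj(1) ys] .
    then obtain w where w: "w \<in> hset (H \<rho>)"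
      "\<And>z. z \<in> hset (H \<rho>) \<Longrightarrow> F (\<rho>, r) n ((map ?a ys)[i := z]) = hip (H \<rho>) w z"
      using R.tensor_power_slots[OF \<G>_level[OF F \<rho> r]] i unfolding slots_in_def by blast
    have wH: "w \<in> hset (H \<tau>)" using w(1) hspace_embeddedD(1)[OF hilbert_H[OF \<rho>] hilbert_H[OF \<tau>] e] by blast
    have "hip (H \<tau>) x z = hip (H \<tau>) w z" if z: "z \<in> hset (H \<tau>)" for z
    proof -
      have "hip (H \<tau>) x z = F (\<tau>, r) n (ys[i := z])" using x(2)[OF z] by simp
      also have "\<dots> = F (\<rho>, r) n (map ?a (ys[i := z]))"
        using \<G>_link[OF F \<tau> \<rho> r order_refl e, of n] tuples_update[OF ys z, of i] by (simp add: tensor_map_def)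
      also have "\<dots> = hip (H \<rho>) w (?a z)" using w(2)[OF adj(1)[OF z]] by (simp add: map_update)
      also have "\<dots> = hip (H \<tau>) w z" by (rule adj(2)[OF z w(1)])
      finally show ?thesis .
    qed
    from this[of "x - w"] have "hip (H \<tau>) (x - w) (x - w) = 0" using x(1) wH by (simp add: H.diff_left)
    then have "x = w" using x(1) wH H.eq_zero_iff[of "x - w"] by simp
    then show ?thesis using w(1) hspace_embeddedD(1)[OF hilbert_H[OF \<rho>] hilbert_H[OF \<sigma>] e'] by blast
  qed
  then have "x \<in> \<Phi>" by (simp add: nuclear_set_def)
  then show "\<exists>x\<in>\<Phi>. \<forall>z\<in>hset (H \<tau>). F (\<tau>, r) n (ys[i := z]) = hip (H \<tau>) x z" using x(2) by blast
qed

lemma continuous_map_component: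
  assumes \<tau>: "\<tau> \<in> T" and r: "r \<ge> 1"
  shows "continuous_map \<G> (htop (G_space q (H \<tau>) r \<alpha>)) (\<lambda>F. F (\<tau>, r))"
proof -
  have "continuous_map \<G> (htop (case (\<tau>, r) of (\<tau>, r) \<Rightarrow> G_space q (H \<tau>) r \<alpha>)) (\<lambda>F. F (\<tau>, r))"
    unfolding G_nuclear_def proj_lim_def
  proof (rule continuous_map_from_initial)
    show "(\<tau>, r) \<in> T \<times> {1..}" using \<tau> r by simp
    show "(\<lambda>F. F (\<tau>, r)) ` proj_lim_set (T \<times> {1..}) (G_le H) (\<lambda>(\<tau>, r). G_space q (H \<tau>) r \<alpha>) (G_link H)
        \<subseteq> topspace (htop (case (\<tau>, r) of (\<tau>, r) \<Rightarrow> G_space q (H \<tau>) r \<alpha>))"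
      using \<tau> r by (auto simp: proj_lim_set_def ip_space.topspace_htop[OF ip_space_G])
  qed
  then show ?thesis by simp
qed

lemma continuous_map_into_\<G>:
  assumes "g ` topspace Z \<subseteq> topspace \<G>"
    and "\<And>\<tau> r. \<tau> \<in> T \<Longrightarrow> r \<ge> 1 \<Longrightarrow> continuous_map Z (htop (G_space q (H \<tau>) r \<alpha>)) (\<lambda>z. g z (\<tau>, r))"
  shows "continuous_map Z \<G> g"
  using assms unfolding G_nuclear_def proj_lim_def topspace_initial_topology
  by (intro continuous_map_into_initial) auto

lemma family_mult_closed:
  assumes F: "F \<in> topspace \<G>" and G: "G \<in> topspace \<G>"
  shows "family_mult F G \<in> topspace \<G>"
  unfolding mem_\<G>_iff
proof (intro conjI ballI allI impI)
  show "family_mult F G j = 0" if "j \<notin> T \<times> {1..}" for j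
    using \<G>_off[OF F that] by (simp add: family_mult_def)
  show "family_mult F G (\<tau>, r) \<in> hset (G_space q (H \<tau>) r \<alpha>)" if \<tau>: "\<tau> \<in> T" and r: "1 \<le> r" for \<tau> r
  proof -
    obtain r' where r': "r' \<ge> 1" and "\<And>F G. F \<in> hset (G_space q (H \<tau>) r' \<alpha>) \<Longrightarrow> G \<in> hset (G_space q (H \<tau>) r' \<alpha>) \<Longrightarrow>
      tensor_mult F G \<in> hset (G_space q (H \<tau>) r \<alpha>)"
      using hilbert.tensor_mult_bound[OF hilbert_H[OF \<tau>] q \<alpha> r] by metis
    then have "tensor_mult (F (\<tau>, r')) (G (\<tau>, r')) \<in> hset (G_space q (H \<tau>) r \<alpha>)"
      using \<G>_mem[OF F \<tau> r'] \<G>_mem[OF G \<tau> r'] by blast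
    then show ?thesis
      using \<G>_radius[OF F \<tau> r r'] \<G>_radius[OF G \<tau> r r'] by (simp add: family_mult_def)
  qed
  fix \<tau> \<tau>' and r r' :: real and n
  assume link: "\<tau> \<in> T" "\<tau>' \<in> T" "1 \<le> r" "r \<le> r'" "hspace_embedded (H \<tau>') (H \<tau>)"
  show "family_mult F G (\<tau>, r) n = tensor_map (H \<tau>') (H \<tau>) (\<lambda>x. x) n (family_mult F G (\<tau>', r') n)"
    unfolding family_mult_def tensor_map_tensor_mult
    using \<G>_link[OF F link] \<G>_link[OF G link] by (simp add: tensor_mult_def)
qed

lemma continuous_family_mult:
  "continuous_map (prod_topology \<G> \<G>) \<G> (\<lambda>(F, G). family_mult F G)"
proof (rule continuous_map_into_\<G>)
  show "(\<lambda>(F, G). family_mult F G) ` topspace (prod_topology \<G> \<G>) \<subseteq> topspace \<G>"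
    using family_mult_closed by auto
  fix \<tau> and r :: real assume \<tau>: "\<tau> \<in> T" and r: "r \<ge> 1"
  obtain r' where r': "r' \<ge> 1" and bound: "\<And>F G. F \<in> hset (G_space q (H \<tau>) r' \<alpha>) \<Longrightarrow> G \<in> hset (G_space q (H \<tau>) r' \<alpha>) \<Longrightarrow>
      tensor_mult F G \<in> hset (G_space q (H \<tau>) r \<alpha>) \<and>
      hnorm (G_space q (H \<tau>) r \<alpha>) (tensor_mult F G) \<le> hnorm (G_space q (H \<tau>) r' \<alpha>) F * hnorm (G_space q (H \<tau>) r' \<alpha>) G"
    using hilbert.tensor_mult_bound[OF hilbert_H[OF \<tau>] q \<alpha> r] by metis
  let ?A = "htop (G_space q (H \<tau>) r' \<alpha>)"
  have "continuous_map (prod_topology ?A ?A) (htop (G_space q (H \<tau>) r \<alpha>)) (\<lambda>(F, G). tensor_mult F G)"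
    using bound
    by (intro bounded_bilinear_continuous_map[OF ip_space_G[OF \<tau> r'] ip_space_G[OF \<tau> r]])
      (simp_all add: tensor_mult_diff_left tensor_mult_diff_right)
  moreover have "continuous_map (prod_topology \<G> \<G>) (prod_topology ?A ?A) (\<lambda>(F, G). (F (\<tau>, r'), G (\<tau>, r')))"
    using continuous_map_component[OF \<tau> r'] by (simp add: continuous_map_prod_top)
  ultimately have "continuous_map (prod_topology \<G> \<G>) (htop (G_space q (H \<tau>) r \<alpha>))
      ((\<lambda>(F, G). tensor_mult F G) \<circ> (\<lambda>(F, G). (F (\<tau>, r'), G (\<tau>, r'))))"
    by (rule continuous_map_compose[rotated])
  then show "continuous_map (prod_topology \<G> \<G>) (htop (G_space q (H \<tau>) r \<alpha>))
      (\<lambda>z. (case z of (F, G) \<Rightarrow> family_mult F G) (\<tau>, r))"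
  proof (rule continuous_map_eq)
    fix z assume "z \<in> topspace (prod_topology \<G> \<G>)"
    then obtain F G where z: "z = (F, G)" and FG: "F \<in> topspace \<G>" "G \<in> topspace \<G>" by auto
    show "((\<lambda>(F, G). tensor_mult F G) \<circ> (\<lambda>(F, G). (F (\<tau>, r'), G (\<tau>, r')))) z =
        (case z of (F, G) \<Rightarrow> family_mult F G) (\<tau>, r)"
      using \<G>_radius[OF FG(1) \<tau> r r'] \<G>_radius[OF FG(2) \<tau> r r'] by (simp add: z family_mult_def)
  qed
qed

lemma real_algebra_\<G>: "real_algebra_on (topspace \<G>) family_mult"
  unfolding real_algebra_on_def
proof (intro conjI ballI allI)
  show "subspace (topspace \<G>)" by (rule subspace_\<G>)
  show "family_mult F G \<in> topspace \<G>" if "F \<in> topspace \<G>" "G \<in> topspace \<G>" for F G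
    using that by (rule family_mult_closed)
  show "family_mult (family_mult F G) L = family_mult F (family_mult G L)" for F G L
    by (simp add: family_mult_def tensor_mult_assoc)
qed (auto simp: family_mult_def fun_eq_iff tensor_mult_apply algebra_simps sum.distrib sum_distrib_left)

lemma pure_family_mem:
  assumes fs: "set fs \<subseteq> \<Phi>"
  shows "pure_family T H fs \<in> topspace \<G>"
  unfolding mem_\<G>_iff
proof (intro conjI ballI allI impI)
  show "pure_family T H fs j = 0" if "j \<notin> T \<times> {1..}" for j
    using that by (simp add: pure_family_def)
  show "pure_family T H fs (\<tau>, r) \<in> hset (G_space q (H \<tau>) r \<alpha>)" if \<tau>: "\<tau> \<in> T" and r: "1 \<le> r" for \<tau> r
  proof -
    interpret H: hilbert "H \<tau>" by (rule hilbert_H[OF \<tau>])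
    interpret X: hilbert_sum_family "weighted_level q (H \<tau>) r \<alpha>"
      using H.weighted_family[OF q] r by simp
    have "fs \<in> tuples (hset (H \<tau>)) (length fs)"
      using fs nuclear_set_subset[OF \<tau>] by (auto simp: tuples_def)
    then have "at_level (length fs) (pure_tensor (H \<tau>) fs) \<in> hset (hilbert_sum (weighted_level q (H \<tau>) r \<alpha>))"
      by (intro X.at_level_mem) (simp add: H.pure_tensor_mem)
    then show ?thesis
      using \<tau> r by (simp add: pure_family_def pure_seq_def G_space_eq at_level_def)
  qed
  fix \<tau> \<tau>' and r r' :: real and n
  assume link: "\<tau> \<in> T" "\<tau>' \<in> T" "1 \<le> r" "r \<le> r'" "hspace_embedded (H \<tau>') (H \<tau>)"
  interpret H': hilbert "H \<tau>'" by (rule hilbert_H[OF link(2)])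
  have "tensor_map (H \<tau>') (H \<tau>) (\<lambda>x. x) (length fs) (pure_tensor (H \<tau>') fs) = pure_tensor (H \<tau>) (map (\<lambda>x. x) fs)"
    using fs nuclear_set_subset[OF link(2)]
    by (intro tensor_map_pure_tensor H'.ips embedding_adjoint_ex hilbert_H link) auto
  moreover have "tensor_map (H \<tau>') (H \<tau>) (\<lambda>x. x) n 0 = 0" by (simp add: tensor_map_def fun_eq_iff)
  ultimately show "pure_family T H fs (\<tau>, r) n = tensor_map (H \<tau>') (H \<tau>) (\<lambda>x. x) n (pure_family T H fs (\<tau>', r') n)"
    using link by (simp add: pure_family_def pure_seq_def)
qed

end


section \<open>The embedding into the Fock space\<close>

lemma at_level_diff: "at_level n x - at_level n y = at_level n (x - y)"
  for x y :: "'a::ab_group_add"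
  by (simp add: at_level_def fun_eq_iff)

lemma at_level_scale: "at_level n (c *\<^sub>R x) = c *\<^sub>R at_level n x"
  for x :: "'a::real_vector"
  by (simp add: at_level_def fun_eq_iff)

lemma at_level_sum: "at_level n (\<Sum>i\<in>I. x i) = (\<Sum>i\<in>I. at_level n (x i))"
  for x :: "'b \<Rightarrow> 'a::ab_group_add"
  by (simp add: at_level_def fun_eq_iff sum_fun_apply)

lemma pure_seq_eq_at_level: "pure_seq K fs = at_level (length fs) (pure_tensor K fs)"
  by (simp add: pure_seq_def at_level_def)

text \<open>On each single level the Fock norm is dominated by the norm of the tensor power, so it suffices to
  approximate there: pure tensors by pure tensors over \<open>D\<close>, arbitrary tensors by finite sums of pure
  ones, and sequences by their truncations.\<close>

lemma (in hilbert) dense_in_q_fock: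
  assumes q: "\<bar>q\<bar> < 1" and V: "subspace V" "V \<subseteq> hset (q_fock q K)"
    and D: "D \<subseteq> hset K" and dense: "htop K closure_of D = hset K"
    and pure: "\<And>ds. set ds \<subseteq> D \<Longrightarrow> pure_seq K ds \<in> V"
  shows "htop (q_fock q K) closure_of V = hset (q_fock q K)"
proof -
  interpret X: hilbert_sum_family "q_fock_level q K" by (rule fock_family[OF q])
  have V': "V \<subseteq> hset (hilbert_sum (q_fock_level q K))" using V by (simp add: q_fock_def)
  let ?Q = "hilbert_sum (q_fock_level q K)"
  let ?C = "htop ?Q closure_of V"
  have VC: "V \<subseteq> ?C" using closure_of_subset[of V "htop ?Q"] V' by simp
  have subC: "subspace ?C" by (rule X.subspace_closure[OF V(1) V'])
  define c where "c n = sqrt ((1 / (1 - \<bar>q\<bar>)) ^ n)" for n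
  have c: "c n > 0" for n using q by (simp add: c_def)
  have norm: "hnorm ?Q (at_level n S) \<le> c n * hnorm (tensor_power K n) S"
    if S: "S \<in> hset (tensor_power K n)" for n S
  proof -
    have "hnorm ?Q (at_level n S) = hnorm (q_fock_level q K n) S"
      using S by (intro X.at_level_mem(2)) simp
    also have "\<dots> \<le> c n * hnorm (tensor_power K n) S"
      unfolding hnorm_def c_def real_sqrt_mult[symmetric]
      by (intro real_sqrt_le_mono hip_q_fock_level_le[OF q S])
    finally show ?thesis .
  qed
  have atC: "at_level n S \<in> ?C"
    if S: "S \<in> hset (tensor_power K n)"
      and near: "\<And>e. e > 0 \<Longrightarrow> \<exists>R\<in>hset (tensor_power K n). at_level n R \<in> ?C \<and> hnorm (tensor_power K n) (S - R) < e"
    for n S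
  proof (rule X.closure_ofI)
    show "at_level n S \<in> hset ?Q" using S by (intro X.at_level_mem(1)) simp
    fix e :: real assume "e > 0"
    then have "e / c n > 0" using c by simp
    then obtain R where R: "R \<in> hset (tensor_power K n)" "at_level n R \<in> ?C" "hnorm (tensor_power K n) (S - R) < e / c n"
      using near by blast
    have "hnorm ?Q (at_level n S - at_level n R) \<le> c n * hnorm (tensor_power K n) (S - R)"
      unfolding at_level_diff using S R(1) by (intro norm) simp
    also have "\<dots> < e" using R(3) c[of n] by (simp add: field_simps)
    finally show "\<exists>y\<in>?C. hnorm ?Q (at_level n S - y) < e" using R(2) by blast
  qed
  have pureC: "at_level n (pure_tensor K es) \<in> ?C" if es: "es \<in> tuples (hset K) n" for n es
  proof (rule atC[OF pure_tensor_mem[OF es]])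
    fix e :: real assume "e > 0"
    from pure_tensor_approx[OF D dense es this]
    obtain ds where ds: "ds \<in> tuples D n" "hnorm (tensor_power K n) (pure_tensor K es - pure_tensor K ds) < e" by blast
    have "at_level n (pure_tensor K ds) \<in> V"
      using pure[of ds] ds(1) by (simp add: pure_seq_eq_at_level tuples_def)
    moreover have "ds \<in> tuples (hset K) n" using ds(1) tuples_mono[OF D] by blast
    ultimately show "\<exists>R\<in>hset (tensor_power K n). at_level n R \<in> ?C \<and>
        hnorm (tensor_power K n) (pure_tensor K es - R) < e"
      using ds(2) VC pure_tensor_mem by blast
  qed
  have levelC: "at_level n S \<in> ?C" if S: "S \<in> hset (tensor_power K n)" for n S
  proof (rule atC[OF S])
    fix e :: real assume "e > 0"
    then obtain E where E: "finite E" "E \<subseteq> tuples (some_basis K) n"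
      "hnorm (tensor_power K n) (S - (\<Sum>es\<in>E. S es *\<^sub>R pure_tensor K es)) < e"
      using finite_basis_approx[OF S] by blast
    have EK: "es \<in> tuples (hset K) n" if "es \<in> E" for es
      using that E(2) tuples_mono[OF basis_subset] by blast
    have "at_level n (\<Sum>es\<in>E. S es *\<^sub>R pure_tensor K es) \<in> ?C"
      unfolding at_level_sum at_level_scale using pureC EK by (intro subspace_sum[OF subC] subspace_scale[OF subC]) auto
    moreover have "(\<Sum>es\<in>E. S es *\<^sub>R pure_tensor K es) \<in> hset (tensor_power K n)"
      using EK by (intro tensor.mem_sum tensor.mem_scale pure_tensor_mem)
    ultimately show "\<exists>R\<in>hset (tensor_power K n). at_level n R \<in> ?C \<and> hnorm (tensor_power K n) (S - R) < e"
      using E(3) by blast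
  qed
  have "F \<in> ?C" if F: "F \<in> hset ?Q" for F
  proof (rule X.closure_ofI[OF F])
    fix e :: real assume "e > 0"
    then obtain N where N: "hnorm ?Q (F - (\<Sum>n<N. at_level n (F n))) < e"
      using X.truncation_approx[OF F] by blast
    have "(\<Sum>n<N. at_level n (F n)) \<in> ?C"
      using F by (intro subspace_sum[OF subC] levelC) (simp add: hset_hilbert_sum)
    then show "\<exists>y\<in>?C. hnorm ?Q (F - y) < e" using N by blast
  qed
  then show ?thesis
    using closure_of_subset_topspace[of "htop ?Q" V] by (auto simp: q_fock_def)
qed

locale fock_embedding = weighted_nuclear T H q \<alpha>
  for T :: "'i set" and H :: "'i \<Rightarrow> 'v::real_vector hspace" and q \<alpha> :: real +
  fixes K :: "'h::real_vector hspace" and \<iota> :: "'v \<Rightarrow> 'h"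
  assumes K: "separable_hilbert_space K"
    and \<iota>: "dense_continuous_embedding (nuclear_topology T H) (htop K) \<iota>"
begin

sublocale K: hilbert K
  by (rule separable_hilbert_space_hilbert[OF K])

lemma topspace_nuclear: "topspace (nuclear_topology T H) = \<Phi>"
  by (simp add: nuclear_topology_def)

lemma \<iota>_linear: "linear_to \<Phi> \<iota>"
  using \<iota> by (simp add: dense_continuous_embedding_def topspace_nuclear linear_to_def)

lemma \<iota>_inj: "inj_on \<iota> \<Phi>"
  and \<iota>_continuous: "continuous_map (nuclear_topology T H) (htop K) \<iota>"
  and \<iota>_dense: "htop K closure_of (\<iota> ` \<Phi>) = hset K"
  using \<iota> by (simp_all add: dense_continuous_embedding_def topspace_nuclear)

lemma \<iota>_mem: "x \<in> \<Phi> \<Longrightarrow> \<iota> x \<in> hset K"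
  using continuous_map_image_subset_topspace[OF \<iota>_continuous] by (auto simp: topspace_nuclear)

lemma \<iota>_eq_0: "x \<in> \<Phi> \<Longrightarrow> \<iota> x = 0 \<Longrightarrow> x = 0"
  using inj_onD[OF \<iota>_inj, of x 0] linear_to_zero[OF \<iota>_linear subspace_nuclear_set]
    subspace_0[OF subspace_nuclear_set] by simp

text \<open>The adjoint of \<open>\<iota>\<close> takes its values in the closure of \<open>\<Phi>\<close> in one of the spaces \<open>H \<tau>\<close>, where the
  representing vectors are unique.\<close>

lemma \<iota>_adjoint:
  obtains \<tau> C a where "\<tau> \<in> T" "C \<ge> 0" "linear_to (hset K) a"
    "\<And>k. k \<in> hset K \<Longrightarrow> a k \<in> hset (H \<tau>)"
    "\<And>k. k \<in> hset K \<Longrightarrow> hnorm (H \<tau>) (a k) \<le> C * hnorm K k"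
    "\<And>k x. k \<in> hset K \<Longrightarrow> x \<in> \<Phi> \<Longrightarrow> hip (H \<tau>) x (a k) = hip K (\<iota> x) k"
proof -
  obtain \<tau> C where \<tau>: "\<tau> \<in> T" and C: "C > 0" and bd: "\<And>x. x \<in> \<Phi> \<Longrightarrow> hnorm K (\<iota> x) \<le> C * hnorm (H \<tau>) x"
    using continuous_linear_nuclear_bounded[OF K.ip_space_axioms \<iota>_linear \<iota>_continuous] by blast
  interpret H: hilbert "H \<tau>" by (rule hilbert_H[OF \<tau>])
  note sub = nuclear_set_subset[OF \<tau>]
  let ?cl = "htop (H \<tau>) closure_of \<Phi>"
  have clH: "z \<in> hset (H \<tau>)" if "z \<in> ?cl" for z using that by (simp add: H.closure_of_htop)
  have sub_cl: "subspace ?cl" by (rule H.subspace_closure[OF subspace_nuclear_set sub])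
  define P where "P k z \<longleftrightarrow> z \<in> ?cl \<and> (\<forall>x\<in>\<Phi>. hip (H \<tau>) x z = hip K (\<iota> x) k) \<and> hnorm (H \<tau>) z \<le> C * hnorm K k" for k z
  have ex: "\<exists>z. P k z" if k: "k \<in> hset K" for k
  proof -
    have lin: "linear_to \<Phi> (\<lambda>x. hip K (\<iota> x) k)"
      using k \<iota>_mem by (simp add: linear_to_def linear_toD[OF \<iota>_linear] K.add_left K.scale_left)
    have "\<bar>hip K (\<iota> x) k\<bar> \<le> (C * hnorm K k) * hnorm (H \<tau>) x" if x: "x \<in> \<Phi>" for x
      using order_trans[OF K.cauchy_schwarz[OF \<iota>_mem[OF x] k] mult_right_mono[OF bd[OF x] K.norm_nonneg[OF k]]]
      by (simp add: mult_ac)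
    moreover have "C * hnorm K k \<ge> 0" using C k by simp
    ultimately obtain z where "z \<in> ?cl" "\<And>x. x \<in> \<Phi> \<Longrightarrow> hip K (\<iota> x) k = hip (H \<tau>) x z" "hnorm (H \<tau>) z \<le> C * hnorm K k"
      using H.riesz_subspace[OF subspace_nuclear_set sub lin] by metis
    then show ?thesis unfolding P_def by metis
  qed
  have uniq: "z = w" if z: "z \<in> ?cl" and w: "w \<in> ?cl" and eq: "\<And>x. x \<in> \<Phi> \<Longrightarrow> hip (H \<tau>) x z = hip (H \<tau>) x w" for z w
  proof -
    have zw: "z - w \<in> ?cl" by (rule subspace_diff[OF sub_cl z w])
    have orth: "hip (H \<tau>) (z - w) x = 0" if x: "x \<in> \<Phi>" for x
    proof -
      have xH: "x \<in> hset (H \<tau>)" using sub x by blast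
      have "hip (H \<tau>) (z - w) x = hip (H \<tau>) x (z - w)" by (rule H.commute[OF clH[OF zw] xH])
      then show ?thesis using eq[OF x] clH[OF z] clH[OF w] xH by (simp add: H.diff_right)
    qed
    have span: "span \<Phi> = \<Phi>" using span_eq_iff subspace_nuclear_set by blast
    have "hip (H \<tau>) (z - w) (z - w) = 0"
      by (rule H.orthogonal_closure_span[OF sub clH[OF zw] orth]) (simp_all only: span zw)
    then show ?thesis using H.eq_zero_iff[OF clH[OF zw]] by simp
  qed
  define a where "a k = (SOME z. P k z)" for k
  have a: "P k (a k)" if "k \<in> hset K" for k
    unfolding a_def by (rule someI_ex) (rule ex[OF that])
  have a_cl: "a k \<in> ?cl" and a_rep: "\<And>x. x \<in> \<Phi> \<Longrightarrow> hip (H \<tau>) x (a k) = hip K (\<iota> x) k"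
    and a_bd: "hnorm (H \<tau>) (a k) \<le> C * hnorm K k" if "k \<in> hset K" for k
    using a[OF that] by (auto simp: P_def)
  have "linear_to (hset K) a"
    unfolding linear_to_def
  proof (intro conjI ballI allI)
    fix k l assume k: "k \<in> hset K" and l: "l \<in> hset K"
    show "a (k + l) = a k + a l"
    proof (rule uniq)
      show "a (k + l) \<in> ?cl" using k l by (intro a_cl) simp
      show "a k + a l \<in> ?cl" using a_cl k l by (intro subspace_add[OF sub_cl])
      fix x assume x: "x \<in> \<Phi>"
      have xH: "x \<in> hset (H \<tau>)" using sub x by blast
      show "hip (H \<tau>) x (a (k + l)) = hip (H \<tau>) x (a k + a l)"
        using k l x xH clH[OF a_cl[OF k]] clH[OF a_cl[OF l]] \<iota>_mem[OF x]
        by (simp add: a_rep H.add_right K.add_right)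
    qed
  next
    fix c k assume k: "k \<in> hset K"
    show "a (c *\<^sub>R k) = c *\<^sub>R a k"
    proof (rule uniq)
      show "a (c *\<^sub>R k) \<in> ?cl" using k by (intro a_cl) simp
      show "c *\<^sub>R a k \<in> ?cl" using a_cl k by (intro subspace_scale[OF sub_cl])
      fix x assume x: "x \<in> \<Phi>"
      have xH: "x \<in> hset (H \<tau>)" using sub x by blast
      show "hip (H \<tau>) x (a (c *\<^sub>R k)) = hip (H \<tau>) x (c *\<^sub>R a k)"
        using k x xH clH[OF a_cl[OF k]] \<iota>_mem[OF x] by (simp add: a_rep H.scale_right K.scale_right)
    qed
  qed
  then show thesis
    using that[of \<tau> C a] \<tau> C clH a_cl a_bd a_rep by (metis less_imp_le)
qed

text \<open>The embedding is a pullback along the adjoint of \<open>\<iota>\<close>, computed in a single component. For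
  injectivity the vanishing of this component is transported to a space \<open>H \<rho>\<close> that embeds into both
  \<open>H \<tau>\<close> and any given \<open>H \<sigma>\<close>.\<close>

lemma fock_embedding:
  "\<exists>J. dense_continuous_embedding \<G> (htop (q_fock q K)) J \<and>
    (\<forall>fs. set fs \<subseteq> \<Phi> \<longrightarrow> J (pure_family T H fs) = pure_seq K (map \<iota> fs))"
proof -
  obtain \<tau> C a where \<tau>: "\<tau> \<in> T" and C: "C \<ge> 0" and lin: "linear_to (hset K) a"
    and aH: "\<And>k. k \<in> hset K \<Longrightarrow> a k \<in> hset (H \<tau>)"
    and bd: "\<And>k. k \<in> hset K \<Longrightarrow> hnorm (H \<tau>) (a k) \<le> C * hnorm K k"
    and rep: "\<And>k x. k \<in> hset K \<Longrightarrow> x \<in> \<Phi> \<Longrightarrow> hip (H \<tau>) x (a k) = hip K (\<iota> x) k"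
    using \<iota>_adjoint by blast
  interpret H: hilbert "H \<tau>" by (rule hilbert_H[OF \<tau>])
  interpret X: hilbert_sum_family "q_fock_level q K" by (rule K.fock_family[OF q])
  obtain l where l: "l > 0" and lo: "\<And>r n. r \<ge> 0 \<Longrightarrow> (r * l) ^ n \<le> weight q r \<alpha> n"
    using weight_bounds[OF q \<alpha>] by metis
  define b where "b = 1 / (1 - \<bar>q\<bar>)"
  have b: "b > 0" using q by (simp add: b_def)
  \<comment> \<open>so large that the weights dominate \<open>b\<^sup>n\<close>, a bound for \<open>P\<close>, and \<open>C\<^sup>2\<^sup>n\<close>, a bound for the pullback\<close>
  define r where "r = max 1 (b * C\<^sup>2 / l)"
  have r: "r \<ge> 1" by (simp add: r_def)
  have rl: "b * C\<^sup>2 \<le> r * l" using l by (simp add: r_def pos_divide_le_eq[symmetric])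
  interpret Y: hilbert_sum_family "weighted_level q (H \<tau>) r \<alpha>"
    using H.weighted_family[OF q] r by simp
  let ?Q = "hilbert_sum (q_fock_level q K)" and ?G = "hilbert_sum (weighted_level q (H \<tau>) r \<alpha>)"
  define j where "j F = (\<lambda>n. pullback K a n (F n))" for F
  define J where "J F = j (F (\<tau>, r))" for F :: "'i \<times> real \<Rightarrow> nat \<Rightarrow> 'v list \<Rightarrow> real"
  have pull: "pullback K a n S \<in> hset (tensor_power K n)"
    "hip (tensor_power K n) (pullback K a n S) (pullback K a n S) \<le> (C\<^sup>2) ^ n * hip (tensor_power (H \<tau>) n) S S"
    if "S \<in> hset (tensor_power (H \<tau>) n)" for n S
    using pullback_tensor_power[of K "H \<tau>" a C, OF K.hilbert_axioms H.hilbert_axioms lin _ _ C that] aH bd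
    by blast+
  have level: "hip (q_fock_level q K n) (pullback K a n S) (pullback K a n S) \<le> weight q r \<alpha> n * hip (tensor_power (H \<tau>) n) S S"
    if S: "S \<in> hset (tensor_power (H \<tau>) n)" for n S
  proof -
    let ?h = "hip (tensor_power (H \<tau>) n) S S"
    have "hip (q_fock_level q K n) (pullback K a n S) (pullback K a n S) \<le> b ^ n * hip (tensor_power K n) (pullback K a n S) (pullback K a n S)"
      unfolding b_def by (rule hip_q_fock_level_le[OF q pull(1)[OF S]])
    also have "\<dots> \<le> b ^ n * ((C\<^sup>2) ^ n * ?h)" using pull(2)[OF S] b by (intro mult_left_mono) auto
    also have "\<dots> = (b * C\<^sup>2) ^ n * ?h" by (simp add: power_mult_distrib)
    also have "\<dots> \<le> (r * l) ^ n * ?h"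
      using rl b H.tensor.nonneg[OF S] by (intro mult_right_mono power_mono) auto
    also have "\<dots> \<le> weight q r \<alpha> n * ?h"
      using lo[of r n] r H.tensor.nonneg[OF S] by (intro mult_right_mono) auto
    finally show ?thesis .
  qed
  have j: "j F \<in> hset ?Q" "hnorm ?Q (j F) \<le> hnorm ?G F" if F: "F \<in> hset ?G" for F
  proof -
    have Fn: "F n \<in> hset (tensor_power (H \<tau>) n)" for n using F by (simp add: hset_hilbert_sum)
    have mem: "j F n \<in> hset (q_fock_level q K n)" for n using pull(1)[OF Fn] by (simp add: j_def)
    have le: "hip (q_fock_level q K n) (j F n) (j F n) \<le> hip (weighted_level q (H \<tau>) r \<alpha> n) (F n) (F n)" for n
      using level[OF Fn] by (simp add: j_def)
    show "j F \<in> hset ?Q" "hnorm ?Q (j F) \<le> hnorm ?G F"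
      using hilbert_sum_mono[OF Y.hilbert_sum_family_axioms X.hilbert_sum_family_axioms F mem le] by auto
  qed
  have jadd: "j (F + F') = j F + j F'" and jscale: "j (c *\<^sub>R F) = c *\<^sub>R j F" for F F' c
    by (auto simp: j_def pullback_def fun_eq_iff)
  have FG: "F (\<tau>, r) \<in> hset ?G" if "F \<in> topspace \<G>" for F
    using \<G>_mem[OF that \<tau> r] by (simp add: G_space_eq)
  have J_linear: "J (F + F') = J F + J F'" "J (c *\<^sub>R F) = c *\<^sub>R J F" for F F' c
    by (simp_all add: J_def jadd jscale)
  have "continuous_map (htop ?G) (htop ?Q) j"
    using j by (intro bounded_linear_continuous_map[OF Y.ip_space_hilbert_sum X.ip_space_hilbert_sum, where C = 1])
      (auto simp: linear_to_def jadd jscale)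
  then have J_cont: "continuous_map \<G> (htop ?Q) J"
    using continuous_map_compose[OF continuous_map_component[OF \<tau> r, unfolded G_space_eq]]
    by (simp add: J_def[abs_def] comp_def)
  have J_inj: "inj_on J (topspace \<G>)"
  proof (rule inj_onI)
    fix F F' assume FF: "F \<in> topspace \<G>" "F' \<in> topspace \<G>" "J F = J F'"
    define D where "D = F - F'"
    have D: "D \<in> topspace \<G>" unfolding D_def by (rule subspace_diff[OF subspace_\<G> FF(1,2)])
    have JD: "D (\<tau>, r) n (map a ks) = 0" if "ks \<in> tuples (hset K) n" for n ks
      using FF(3) that by (auto simp: D_def J_def j_def pullback_def fun_eq_iff split: if_splits)
    have "D (\<sigma>, s) = 0" if \<sigma>: "\<sigma> \<in> T" and s: "s \<ge> 1" for \<sigma> s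
    proof
      fix n
      obtain \<rho> where \<rho>: "\<rho> \<in> T" and e: "hspace_embedded (H \<rho>) (H \<tau>)" and e': "hspace_embedded (H \<rho>) (H \<sigma>)"
        using directed[OF \<tau> \<sigma>] by blast
      define t where "t = max r s"
      have t: "t \<ge> 1" "r \<le> t" "s \<le> t" using r by (auto simp: t_def)
      interpret R: hilbert "H \<rho>" by (rule hilbert_H[OF \<rho>])
      let ?i = "hadjoint (H \<rho>) (H \<tau>) (\<lambda>x. x)"
      note adj = embedding_adjoint[OF hilbert_H[OF \<rho>] hilbert_H[OF \<tau>] e]
      let ?D = "(\<lambda>k. ?i (a k)) ` hset K"
      have "D (\<rho>, t) n = 0"
      proof (rule form_eq_zero[where K = "H \<rho>" and P = \<Phi> and D = ?D])
        show "?D \<subseteq> hset (H \<rho>)" using adj(1) aH by blast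
        show "slots_in (H \<rho>) \<Phi> n (D (\<rho>, t) n)" by (rule \<G>_slots[OF D \<rho> t(1)])
        show "D (\<rho>, t) n ys = 0" if "ys \<notin> tuples (hset (H \<rho>)) n" for ys
          by (rule multilinear_form_off[OF \<G>_level[OF D \<rho> t(1)] that])
        show "hip (H \<rho>) 0 z = 0" if "z \<in> hset (H \<rho>)" for z using that by simp
        show "x = 0" if x: "x \<in> \<Phi>" and orth: "\<And>d. d \<in> ?D \<Longrightarrow> hip (H \<rho>) x d = 0" for x
        proof -
          have xR: "x \<in> hset (H \<rho>)" using nuclear_set_subset[OF \<rho>] x by blast
          have "hip K (\<iota> x) k = 0" if k: "k \<in> hset K" for k
            using orth[of "?i (a k)"] adj(2)[OF aH[OF k] xR] rep[OF k x] k by simp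
          then have "hip K (\<iota> x) (\<iota> x) = 0" using \<iota>_mem[OF x] by blast
          then show "x = 0" using K.eq_zero_iff[OF \<iota>_mem[OF x]] \<iota>_eq_0[OF x] by simp
        qed
        show "D (\<rho>, t) n ys = 0" if ys: "ys \<in> tuples ?D n" for ys
        proof -
          have "set ys \<subseteq> (\<lambda>k. ?i (a k)) ` hset K" using ys by (simp add: tuples_def)
          then have "ys \<in> map (\<lambda>k. ?i (a k)) ` lists (hset K)"
            unfolding lists_image[symmetric] by (simp add: lists_eq_set)
          then obtain ks where ks: "ys = map (\<lambda>k. ?i (a k)) ks" "ks \<in> lists (hset K)" by blast
          have ksn: "ks \<in> tuples (hset K) n" using ks ys by (auto simp: tuples_def)
          have "map a ks \<in> tuples (hset (H \<tau>)) n" by (rule map_in_tuples[OF aH ksn])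
          then have "D (\<tau>, r) n (map a ks) = D (\<rho>, t) n (map ?i (map a ks))"
            using \<G>_link[OF D \<tau> \<rho> r t(2) e, of n] by (simp add: tensor_map_def)
          then show ?thesis using JD[OF ksn] ks(1) by (simp add: comp_def)
        qed
      qed
      then have "D (\<sigma>, s) n = tensor_map (H \<rho>) (H \<sigma>) (\<lambda>x. x) n 0"
        using \<G>_link[OF D \<sigma> \<rho> s t(3) e', of n] by simp
      then show "D (\<sigma>, s) n = 0 n" by (simp add: tensor_map_def fun_eq_iff)
    qed
    moreover have "D i = 0" if "i \<notin> T \<times> {1..}" for i by (rule \<G>_off[OF D that])
    ultimately have "D i = 0" for i by (cases i; cases "i \<in> T \<times> {1..}") auto
    then have "D = 0" by (simp add: fun_eq_iff)
    then show "F = F'" by (simp add: D_def)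
  qed
  have J_pure: "J (pure_family T H fs) = pure_seq K (map \<iota> fs)" if fs: "set fs \<subseteq> \<Phi>" for fs
  proof (intro ext)
    fix n ks
    have fam: "pure_family T H fs (\<tau>, r) = pure_seq (H \<tau>) fs" using \<tau> r by (simp add: pure_family_def)
    show "J (pure_family T H fs) n ks = pure_seq K (map \<iota> fs) n ks"
    proof (cases "n = length fs \<and> ks \<in> tuples (hset K) n")
      case True
      then have n: "n = length fs" and ks: "ks \<in> tuples (hset K) n" by auto
      have len: "length ks = n" using ks by (simp add: tuples_def)
      have "map a ks \<in> tuples (hset (H \<tau>)) n" by (rule map_in_tuples[OF aH ks])
      then have "J (pure_family T H fs) n ks = (\<Prod>i<n. hip (H \<tau>) (fs ! i) (map a ks ! i))"
        using n ks by (simp add: J_def j_def fam pullback_def pure_seq_def pure_tensor_def)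
      also have "\<dots> = (\<Prod>i<n. hip K (map \<iota> fs ! i) (ks ! i))"
      proof (rule prod.cong[OF refl])
        fix i assume i: "i \<in> {..<n}"
        have "ks ! i \<in> hset K" using ks i len by (auto simp: tuples_def dest: nth_mem)
        moreover have "fs ! i \<in> \<Phi>" using fs i n by (auto dest: nth_mem)
        ultimately show "hip (H \<tau>) (fs ! i) (map a ks ! i) = hip K (map \<iota> fs ! i) (ks ! i)"
          using i n len by (simp add: rep)
      qed
      also have "\<dots> = pure_seq K (map \<iota> fs) n ks" using n ks by (simp add: pure_seq_def pure_tensor_def)
      finally show ?thesis .
    next
      case False
      then show ?thesis
        by (auto simp: J_def j_def fam pullback_def pure_seq_def pure_tensor_def)
    qed
  qed
  have J_mem: "J F \<in> hset ?Q" if "F \<in> topspace \<G>" for F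
    unfolding J_def by (rule j(1)[OF FG[OF that]])
  have J_dense: "htop (q_fock q K) closure_of (J ` topspace \<G>) = hset (q_fock q K)"
  proof (rule K.dense_in_q_fock[OF q _ _ _ \<iota>_dense])
    show "subspace (J ` topspace \<G>)"
      unfolding subspace_def
    proof (intro conjI ballI allI)
      have "J 0 = 0" using J_linear(2)[of 0 0] by simp
      then show "0 \<in> J ` topspace \<G>"
        using imageI[OF subspace_0[OF subspace_\<G>], of J] by (simp only:)
      fix x assume "x \<in> J ` topspace \<G>"
      then obtain F where F: "x = J F" "F \<in> topspace \<G>" by (rule imageE)
      show "x + y \<in> J ` topspace \<G>" if y: "y \<in> J ` topspace \<G>" for y
      proof -
        obtain F' where F': "y = J F'" "F' \<in> topspace \<G>" using y by (rule imageE)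
        show ?thesis
          unfolding F(1) F'(1) J_linear(1)[symmetric]
          by (rule imageI[OF subspace_add[OF subspace_\<G> F(2) F'(2)]])
      qed
      show "c *\<^sub>R x \<in> J ` topspace \<G>" for c
        unfolding F(1) J_linear(2)[symmetric]
        by (rule imageI[OF subspace_scale[OF subspace_\<G> F(2)]])
    qed
    show "J ` topspace \<G> \<subseteq> hset (q_fock q K)" using J_mem by (auto simp: q_fock_def)
    show "\<iota> ` \<Phi> \<subseteq> hset K" using \<iota>_mem by blast
    fix ds assume "set ds \<subseteq> \<iota> ` \<Phi>"
    then have "ds \<in> map \<iota> ` lists \<Phi>" unfolding lists_image[symmetric] by (simp add: lists_eq_set)
    then obtain fs where "ds = map \<iota> fs" "set fs \<subseteq> \<Phi>" by (auto simp: lists_eq_set)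
    then show "pure_seq K ds \<in> J ` topspace \<G>"
      using J_pure imageI[OF pure_family_mem, of fs J] by simp
  qed
  have "dense_continuous_embedding \<G> (htop (q_fock q K)) J"
    unfolding dense_continuous_embedding_def
    using J_linear J_inj J_cont J_dense X.topspace_htop by (simp add: q_fock_def)
  then show ?thesis using J_pure by blast
qed

end

theorem corollary4p5:
  fixes q \<alpha> :: real
    and K :: "'h::real_vector hspace"
    and T :: "'i set"
    and H :: "'i \<Rightarrow> 'v::real_vector hspace"
    and \<iota> :: "'v \<Rightarrow> 'h"
  assumes "-1 < q" and "q < 1"
    and "separable_hilbert_space K"
    and "nuclear_family T H"
    and "dense_continuous_embedding (nuclear_topology T H) (htop K) \<iota>"
    and "\<alpha> \<ge> 1"
  shows "(\<exists>J. dense_continuous_embedding (G_nuclear q T H \<alpha>) (htop (q_fock q K)) J \<and>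
            (\<forall>fs. set fs \<subseteq> nuclear_set T H \<longrightarrow> J (pure_family T H fs) = pure_seq K (map \<iota> fs))) \<and>
         real_algebra_on (topspace (G_nuclear q T H \<alpha>)) family_mult \<and>
         continuous_map (prod_topology (G_nuclear q T H \<alpha>) (G_nuclear q T H \<alpha>)) (G_nuclear q T H \<alpha>)
           (\<lambda>(F, G). family_mult F G)"
proof -
  have q: "\<bar>q\<bar> < 1" using assms(1,2) by simp
  have \<alpha>: "\<alpha> \<ge> 0" using assms(6) by simp
  interpret fock_embedding T H q \<alpha> K \<iota>
    using assms(3-5) q \<alpha> by unfold_locales
  show ?thesis
    by (intro conjI fock_embedding real_algebra_\<G> continuous_family_mult)
qed

end
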